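(* Let $k$ be a field and let $A$ and $B$ be $k$-algebras such that $A\otimes_k B$ is Noetherian. Let $I$ and $J$ be proper ideals of $A$ and $B$, respectively. Then: a) $G(I\otimes_k B)=G(I)$ and, similarly, $G(A\otimes_k J)=G(J)$. b) $G(I\otimes_k B+A\otimes_k J)=G(I)+G(J)$. c) $G(I\otimes_k J)=\inf(G(I),G(J))$.
   Context: All rings and algebras are commutative with identity and non-trivial (nonzero); ring homomorphisms are unital. For ideals $I\subseteq A$ and $J\subseteq B$, since $k$ is a field, $I\otimes_k B$, $A\otimes_k J$ and $I\otimes_k J$ are identified with their images in $A\otimes_k B$, where they are ideals. An $R$-sequence in a ring $R$ is a sequence $x_1,\dots,x_n$ of elements of $R$ such that $(x_1,\dots,x_n)\neq R$ and, for each $i$, $x_i$ is not a zero-divisor on $R/(x_1,\dots,x_{i-1})$. For a Noetherian ring $R$ and a proper ideal $I$ of $R$, the grade $G(I)$ is the common length of all maximal $R$-sequences in $I$. (When $A\otimes_k B$ is Noetherian, $A$ and $B$ are Noetherian too, so the grades $G(I)$, $G(J)$, taken in $A$ and $B$ respectively, are defined; the other grades are taken in $A\otimes_k B$.) *)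

theory Defs
  imports "HOL-Algebra.Algebra"
begin

section \<open>Tensor product of algebras\<close>

text \<open>
  The monoid algebra $K[M]$. Its elements are the finitely supported families of coefficients
  in \<open>K\<close> indexed by \<open>carrier M\<close>, extended by zero outside \<open>carrier M\<close>.
\<close>

definition monoid_algebra ::
  "('k, 'r) ring_scheme \<Rightarrow> ('m, 's) monoid_scheme \<Rightarrow> ('m \<Rightarrow> 'k) ring" where
  "monoid_algebra K M =
    \<lparr>carrier = {f. range f \<subseteq> carrier K \<and> finite {p. f p \<noteq> \<zero>\<^bsub>K\<^esub>} \<and> {p. f p \<noteq> \<zero>\<^bsub>K\<^esub>} \<subseteq> carrier M},
     monoid.mult = (\<lambda>f g p. \<Oplus>\<^bsub>K\<^esub>x \<in> {(q, r). f q \<noteq> \<zero>\<^bsub>K\<^esub> \<and> g r \<noteq> \<zero>\<^bsub>K\<^esub> \<and> q \<otimes>\<^bsub>M\<^esub> r = p}.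
                        f (fst x) \<otimes>\<^bsub>K\<^esub> g (snd x)),
     one = (\<lambda>p. if p = \<one>\<^bsub>M\<^esub> then \<one>\<^bsub>K\<^esub> else \<zero>\<^bsub>K\<^esub>),
     ring.zero = (\<lambda>p. \<zero>\<^bsub>K\<^esub>),
     add = (\<lambda>f g p. f p \<oplus>\<^bsub>K\<^esub> g p)\<rparr>"

definition monomial :: "('k, 'r) ring_scheme \<Rightarrow> 'k \<Rightarrow> 'm \<Rightarrow> 'm \<Rightarrow> 'k" where
  "monomial K c p = (\<lambda>q. if q = p then c else \<zero>\<^bsub>K\<^esub>)"

text \<open>
  The free \<open>K\<close>-module on $A \times B$ is the monoid algebra of the multiplicative monoid
  \<open>A \<times>\<times> B\<close>, with $(a,b)(a',b') = (aa',bb')$. The tensor product is its quotient by the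
  bilinearity relations. Multiplying a relation by a monomial gives a scalar multiple of a
  relation of the same kind, so the ideal generated by the relations is the \<open>K\<close>-submodule they
  span, and the quotient is the usual tensor product of modules with
  $(a \otimes b)(a' \otimes b') = aa' \otimes bb'$.
\<close>

definition bilinear_relations ::
  "('k, 'r) ring_scheme \<Rightarrow> ('k, 'a, 's) module_scheme \<Rightarrow> ('k, 'b, 't) module_scheme
    \<Rightarrow> ('a \<times> 'b \<Rightarrow> 'k) set" where
  "bilinear_relations K A B =
    (let F = monoid_algebra K (A \<times>\<times> B); e = monomial K \<one>\<^bsub>K\<^esub> in
      {e (a \<oplus>\<^bsub>A\<^esub> a', b) \<ominus>\<^bsub>F\<^esub> e (a, b) \<ominus>\<^bsub>F\<^esub> e (a', b) | a a' b.
         a \<in> carrier A \<and> a' \<in> carrier A \<and> b \<in> carrier B}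
    \<union> {e (a, b \<oplus>\<^bsub>B\<^esub> b') \<ominus>\<^bsub>F\<^esub> e (a, b) \<ominus>\<^bsub>F\<^esub> e (a, b') | a b b'.
         a \<in> carrier A \<and> b \<in> carrier B \<and> b' \<in> carrier B}
    \<union> {e (c \<odot>\<^bsub>A\<^esub> a, b) \<ominus>\<^bsub>F\<^esub> monomial K c (a, b) | c a b.
         c \<in> carrier K \<and> a \<in> carrier A \<and> b \<in> carrier B}
    \<union> {e (a, c \<odot>\<^bsub>B\<^esub> b) \<ominus>\<^bsub>F\<^esub> monomial K c (a, b) | c a b.
         c \<in> carrier K \<and> a \<in> carrier A \<and> b \<in> carrier B})"

definition tensor_kernel ::
  "('k, 'r) ring_scheme \<Rightarrow> ('k, 'a, 's) module_scheme \<Rightarrow> ('k, 'b, 't) module_scheme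
    \<Rightarrow> ('a \<times> 'b \<Rightarrow> 'k) set" where
  "tensor_kernel K A B = Idl\<^bsub>monoid_algebra K (A \<times>\<times> B)\<^esub> (bilinear_relations K A B)"

definition tensor_algebra ::
  "('k, 'r) ring_scheme \<Rightarrow> ('k, 'a, 's) module_scheme \<Rightarrow> ('k, 'b, 't) module_scheme
    \<Rightarrow> ('a \<times> 'b \<Rightarrow> 'k) set ring" where
  "tensor_algebra K A B = monoid_algebra K (A \<times>\<times> B) Quot tensor_kernel K A B"

definition pure_tensor ::
  "('k, 'r) ring_scheme \<Rightarrow> ('k, 'a, 's) module_scheme \<Rightarrow> ('k, 'b, 't) module_scheme
    \<Rightarrow> 'a \<Rightarrow> 'b \<Rightarrow> ('a \<times> 'b \<Rightarrow> 'k) set" where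
  "pure_tensor K A B a b =
    tensor_kernel K A B +>\<^bsub>monoid_algebra K (A \<times>\<times> B)\<^esub> monomial K \<one>\<^bsub>K\<^esub> (a, b)"

text \<open>
  For ideals \<open>I\<close> and \<open>J\<close>, the image of $I \otimes_K J$ in $A \otimes_K B$: the finite sums of
  tensors $a \otimes b$ with $a \in I$ and $b \in J$.
\<close>

definition tensor_image ::
  "('k, 'r) ring_scheme \<Rightarrow> ('k, 'a, 's) module_scheme \<Rightarrow> ('k, 'b, 't) module_scheme
    \<Rightarrow> 'a set \<Rightarrow> 'b set \<Rightarrow> ('a \<times> 'b \<Rightarrow> 'k) set set" where
  "tensor_image K A B I J =
    generate (add_monoid (tensor_algebra K A B)) {pure_tensor K A B a b | a b. a \<in> I \<and> b \<in> J}"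

section \<open>Regular sequences and grade\<close>

definition zero_divisor :: "('a, 'r) ring_scheme \<Rightarrow> 'a \<Rightarrow> bool" where
  "zero_divisor R x \<longleftrightarrow> (\<exists>y \<in> carrier R. y \<noteq> \<zero>\<^bsub>R\<^esub> \<and> x \<otimes>\<^bsub>R\<^esub> y = \<zero>\<^bsub>R\<^esub>)"

definition regular_sequence :: "('a, 'r) ring_scheme \<Rightarrow> 'a list \<Rightarrow> bool" where
  "regular_sequence R xs \<longleftrightarrow>
    set xs \<subseteq> carrier R \<and> Idl\<^bsub>R\<^esub> (set xs) \<noteq> carrier R \<and>
    (\<forall>i < length xs. let Q = Idl\<^bsub>R\<^esub> (set (take i xs)) in
       \<not> zero_divisor (R Quot Q) (Q +>\<^bsub>R\<^esub> xs ! i))"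

definition maximal_regular_sequence :: "('a, 'r) ring_scheme \<Rightarrow> 'a set \<Rightarrow> 'a list \<Rightarrow> bool" where
  "maximal_regular_sequence R I xs \<longleftrightarrow>
    regular_sequence R xs \<and> set xs \<subseteq> I \<and> \<not> (\<exists>x \<in> I. regular_sequence R (xs @ [x]))"

text \<open>
  The common length of all maximal regular sequences in \<open>I\<close>. It exists for a proper ideal \<open>I\<close> of
  a commutative Noetherian ring \<open>R\<close>; otherwise the value of \<open>grade R I\<close> may be arbitrary.
\<close>

definition grade :: "('a, 'r) ring_scheme \<Rightarrow> 'a set \<Rightarrow> nat" where
  "grade R I = (THE n. length ` {xs. maximal_regular_sequence R I xs} = {n})"

end

theory Submission
  imports Defs
begin

text \<open>
  Equality of the lengths of maximal regular sequences follows Kaplansky: two sequences of equal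
  length in \<open>I\<close> are compared by routing both through an element \<open>z \<in> I\<close> that is regular modulo
  everything in sight, which prime avoidance provides, and then working modulo \<open>z\<close>. A regular
  sequence in \<open>I\<close> over the Noetherian ring \<open>R\<close> is therefore known to have length $G(I)$ as soon as
  some \<open>a\<close> outside the ideal \<open>Q\<close> it generates satisfies $Ia \subseteq Q$.

  For ideals \<open>Q\<close> of \<open>A\<close> and \<open>P\<close> of \<open>B\<close>, an element of $A \otimes B$ lies in
  $Q \otimes B + A \otimes P$ if and only if $\mathrm{id} \otimes f$ maps it into \<open>Q\<close> for every linear
  functional \<open>f\<close> on \<open>B\<close> that vanishes on \<open>P\<close>. Hence $x \otimes 1$ is regular modulo this ideal when
  \<open>x\<close> is regular modulo \<open>Q\<close>, and $a \otimes b$ is outside it when $a \notin Q$ and $b \notin P$. So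
  maximal regular sequences in \<open>I\<close> and in \<open>J\<close> concatenate to one in $I \otimes B + A \otimes J$, with
  the witness $a \otimes b$ for maximality. This is (b), and (a) is the case of a zero ideal. For (c),
  $I \otimes J$ lies between the product and the intersection of $I \otimes B$ and $A \otimes J$, and
  in any Noetherian ring such an ideal has as its grade the minimum of the two grades.
\<close>

section \<open>Prime avoidance and zero divisors modulo finitely many ideals\<close>

text \<open>The obstacle is that working modulo an element changes the ring, and with it the type.
  Every statement is therefore kept inside one ring and made relative to an ideal \<open>Q\<close>:
  \<open>regular_mod\<close>, \<open>killed_mod\<close> and \<open>regular_over\<close> describe
  \<open>R/Q\<close> without forming it, and an induction through successive quotients becomes one
  that quantifies over all \<open>Q\<close>. Modulo \<open>Q\<close>, an ideal \<open>I\<close>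
  either contains a nonzerodivisor or annihilates a nonzero class; this dichotomy rests on the
  Noetherian hypothesis, through the finiteness of the set of maximal annihilators of nonzero
  classes. The second alternative certifies maximality: being the existence of one element rather
  than the absence of an extension, it can be carried to the tensor product. There the maps id
  \<otimes> f, which are \<open>A\<close>-linear, replace bases and flatness. What is used of the
  tensor product is isolated in a locale whose conditions are symmetric in \<open>A\<close> and
  \<open>B\<close>, so that facts about \<open>B\<close> are facts about \<open>A\<close> with the
  factors exchanged; the explicit construction is matched with it only at the end.\<close>

locale noetherian_cring = noetherian_ring R + cring R for R (structure)

section \<open>Maximal elements and finite generation\<close>

context noetherian_cring
begin

text \<open>In a Noetherian ring a nonempty chain of ideals contains its own union. The bound
  demanded by Zorn's lemma therefore already lies in \<open>S\<close>, whatever set of ideals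
  \<open>S\<close> is.\<close>

lemma ideals_have_maximal:
  assumes "S \<noteq> {}" and "\<And>L. L \<in> S \<Longrightarrow> ideal L R"
  shows "\<exists>M \<in> S. \<forall>N \<in> S. M \<subseteq> N \<longrightarrow> N = M"
proof (rule subset_Zorn)
  fix C assume C: "subset.chain S C"
  show "\<exists>U \<in> S. \<forall>G \<in> C. G \<subseteq> U"
  proof (cases "C = {}")
    case True
    then show ?thesis using assms(1) by auto
  next
    case False
    have "subset.chain {L. ideal L R} C"
      using C assms(2) by (auto simp: subset_chain_def)
    then have "\<Union>C \<in> C" using ideal_chain_is_trivial False by blast
    then show ?thesis using C by (auto simp: subset_chain_def)
  qed
qed

lemma ideals_have_maximal_above:
  assumes "L \<in> S" and "\<And>L. L \<in> S \<Longrightarrow> ideal L R"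
  obtains M where "M \<in> S" "L \<subseteq> M" "\<And>N. N \<in> S \<Longrightarrow> M \<subseteq> N \<Longrightarrow> N = M"
proof -
  let ?S = "{N \<in> S. L \<subseteq> N}"
  have "?S \<noteq> {}" using assms(1) by blast
  moreover have "ideal N R" if "N \<in> ?S" for N using that assms(2) by blast
  ultimately have "\<exists>M \<in> ?S. \<forall>N \<in> ?S. M \<subseteq> N \<longrightarrow> N = M" by (rule ideals_have_maximal)
  then obtain M where M: "M \<in> ?S" "\<forall>N \<in> ?S. M \<subseteq> N \<longrightarrow> N = M" ..
  show thesis
  proof (rule that)
    show "M \<in> S" "L \<subseteq> M" using M(1) by simp_all
    show "N = M" if "N \<in> S" "M \<subseteq> N" for N
    proof -
      have "L \<subseteq> N" using \<open>L \<subseteq> M\<close> that(2) by (rule subset_trans)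
      then show ?thesis using M(2) that by simp
    qed
  qed
qed

text \<open>A maximal one among the ideals generated by finite subsets of \<open>G\<close> absorbs
  every element of \<open>G\<close>. Taking the generators from \<open>G\<close> itself is the
  point: later \<open>G\<close> is a set of chosen witnesses, or the image of an ideal, and each
  generator must come from there.\<close>

lemma finite_generating_subset:
  assumes "G \<subseteq> carrier R"
  obtains Y where "finite Y" "Y \<subseteq> G" "Idl Y = Idl G"
proof -
  let ?S = "{Idl Y | Y. finite Y \<and> Y \<subseteq> G}"
  have "\<exists>M \<in> ?S. \<forall>N \<in> ?S. M \<subseteq> N \<longrightarrow> N = M"
    by (rule ideals_have_maximal) (use assms in \<open>auto intro!: genideal_ideal\<close>)
  then obtain M where M: "M \<in> ?S" and max: "\<forall>N \<in> ?S. M \<subseteq> N \<longrightarrow> N = M" ..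
  from M obtain Y where Y: "M = Idl Y" "finite Y" "Y \<subseteq> G" by auto
  have YC: "Y \<subseteq> carrier R" using Y assms by auto
  have "x \<in> Idl Y" if "x \<in> G" for x
  proof -
    have c: "insert x Y \<subseteq> carrier R" using that assms YC by auto
    have "Idl (insert x Y) \<in> ?S" using Y that by (intro CollectI exI[of _ "insert x Y"]) simp
    moreover have "Idl Y \<subseteq> Idl (insert x Y)" by (rule subset_Idl_subset[OF c]) auto
    ultimately have "Idl (insert x Y) = Idl Y" using max Y(1) by simp
    then show ?thesis using genideal_self[OF c] by auto
  qed
  then have "Idl G \<subseteq> Idl Y" by (intro genideal_minimal genideal_ideal YC) auto
  moreover have "Idl Y \<subseteq> Idl G" by (rule subset_Idl_subset[OF assms Y(3)])
  ultimately show thesis using that[of Y] Y by simp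
qed

end

section \<open>Prime avoidance\<close>

context cring
begin

text \<open>A product of witnesses, one for each \<open>Q\<close>, lies in every \<open>Q\<close>
  and avoids the prime \<open>P\<close>. With \<open>carrier R\<close> for \<open>I\<close> this
  says that a prime containing a finite intersection of ideals contains one of them.\<close>

lemma common_element_outside_prime:
  assumes "finite \<Q>" "\<Q> \<noteq> {}" and P: "primeideal P R" and I: "ideal I R"
    and "\<And>Q. Q \<in> \<Q> \<Longrightarrow> ideal Q R" and "\<And>Q. Q \<in> \<Q> \<Longrightarrow> \<exists>z \<in> I. z \<in> Q \<and> z \<notin> P"
  shows "\<exists>w \<in> I. w \<notin> P \<and> (\<forall>Q \<in> \<Q>. w \<in> Q)"
  using assms(1,2,5,6)
proof (induction \<Q> rule: finite_ne_induct)
  case (singleton Q)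
  then show ?case by auto
next
  case (insert Q \<Q>)
  obtain w where w: "w \<in> I" "w \<notin> P" "\<forall>Q \<in> \<Q>. w \<in> Q" using insert by auto
  obtain z where z: "z \<in> I" "z \<in> Q" "z \<notin> P" using insert.prems by auto
  have c: "w \<in> carrier R" "z \<in> carrier R" using w z ideal.Icarr[OF I] by auto
  have "w \<otimes> z \<notin> P" using primeideal.I_prime[OF P] c w z by blast
  moreover have "w \<otimes> z \<in> I" using ideal.I_l_closed[OF I] c z by auto
  moreover have "w \<otimes> z \<in> Q" using ideal.I_l_closed c z insert.prems by (metis insertCI)
  moreover have "w \<otimes> z \<in> Q'" if "Q' \<in> \<Q>" for Q'
    using that ideal.I_r_closed c w insert.prems by (metis insertCI)
  ultimately show ?case by auto
qed

text \<open>In a cover that cannot be thinned out, each prime \<open>P\<close> owns an element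
  \<open>z P\<close> of \<open>I\<close> lying in no other member. Adding to \<open>z P\<close> an
  element \<open>w\<close> of \<open>I\<close> that lies in all other members but not in
  \<open>P\<close> gives an element of \<open>I\<close> outside the whole union.\<close>

lemma prime_avoidance:
  assumes "finite \<P>" and "\<And>P. P \<in> \<P> \<Longrightarrow> primeideal P R" and I: "ideal I R" and "I \<subseteq> \<Union>\<P>"
  shows "\<exists>P \<in> \<P>. I \<subseteq> P"
  using assms(1,2,4)
proof (induction \<P> rule: finite_psubset_induct)
  case (psubset \<P>)
  show ?case
  proof (rule ccontr)
    assume no: "\<not> ?thesis"
    have "\<exists>z \<in> I. z \<in> P \<and> z \<notin> \<Union>(\<P> - {P})" if "P \<in> \<P>" for P
    proof -
      have "\<not> I \<subseteq> \<Union>(\<P> - {P})"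
        using psubset.IH[of "\<P> - {P}"] psubset.prems that no by blast
      then show ?thesis using psubset.prems(2) by blast
    qed
    then obtain z where z: "\<And>P. P \<in> \<P> \<Longrightarrow> z P \<in> I \<and> z P \<in> P \<and> z P \<notin> \<Union>(\<P> - {P})" by metis
    have "\<zero> \<in> I" using I by (simp add: additive_subgroup.zero_closed ideal.axioms(1))
    then obtain P where P: "P \<in> \<P>" using psubset.prems by blast
    have P_ne: "\<P> - {P} \<noteq> {}"
    proof
      assume "\<P> - {P} = {}"
      then have "\<P> = {P}" using P by auto
      then show False using no psubset.prems(2) by simp
    qed
    have id: "ideal Q R" if "Q \<in> \<P>" for Q
      using psubset.prems that by (simp add: primeideal.axioms(1))
    have "\<exists>w \<in> I. w \<notin> P \<and> (\<forall>Q \<in> \<P> - {P}. w \<in> Q)"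
    proof (rule common_element_outside_prime)
      show "finite (\<P> - {P})" using psubset.hyps by simp
      show "primeideal P R" using psubset.prems(1) P .
      show "\<exists>z \<in> I. z \<in> Q \<and> z \<notin> P" if "Q \<in> \<P> - {P}" for Q
        using z[of Q] that P by (intro bexI[of _ "z Q"]) auto
    qed (use P_ne I id in simp_all)
    then obtain w where w: "w \<in> I" "w \<notin> P" "\<And>Q. Q \<in> \<P> \<Longrightarrow> Q \<noteq> P \<Longrightarrow> w \<in> Q" by auto
    have c: "w \<in> carrier R" "z P \<in> carrier R" using w z[OF P] ideal.Icarr[OF I] by auto
    have "z P \<oplus> w \<in> I" using z[OF P] w(1) I
      by (simp add: additive_subgroup.a_closed ideal.axioms(1))
    then obtain Q where Q: "Q \<in> \<P>" "z P \<oplus> w \<in> Q" using psubset.prems by blast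
    interpret Q: ideal Q R using id Q by auto
    show False
    proof (cases "Q = P")
      case True
      then have "z P \<in> Q" using z[OF P] by simp
      then have "\<ominus> z P \<oplus> (z P \<oplus> w) \<in> Q" by (rule Q.a_closed[OF Q.a_inv_closed Q(2)])
      then show ?thesis using w(2) True c by (simp add: r_neg1)
    next
      case False
      then have "w \<in> Q" using w(3) Q(1) by simp
      then have "(z P \<oplus> w) \<oplus> \<ominus> w \<in> Q" by (rule Q.a_closed[OF Q(2) Q.a_inv_closed])
      then have "z P \<in> Q" using c by (simp add: a_assoc r_neg)
      then show ?thesis using z[OF P] Q False by auto
    qed
  qed
qed

end

text \<open>Nonzerodivisor on \<open>R/Q\<close>, phrased inside \<open>R\<close> so that several
  ideals can be compared in one type. Modulo the whole ring every element is regular.\<close>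

definition regular_mod :: "('a, 'r) ring_scheme \<Rightarrow> 'a set \<Rightarrow> 'a \<Rightarrow> bool" where
  "regular_mod R Q x \<longleftrightarrow> (\<forall>r \<in> carrier R. x \<otimes>\<^bsub>R\<^esub> r \<in> Q \<longrightarrow> r \<in> Q)"

text \<open>For an ideal \<open>I\<close> this says that Hom(R/I, R/Q) is nonzero, the bottom case
  of the description of grade by Ext.\<close>

definition killed_mod :: "('a, 'r) ring_scheme \<Rightarrow> 'a set \<Rightarrow> 'a set \<Rightarrow> bool" where
  "killed_mod R I Q \<longleftrightarrow> (\<exists>a \<in> carrier R. a \<notin> Q \<and> (\<forall>i \<in> I. i \<otimes>\<^bsub>R\<^esub> a \<in> Q))"

definition colon :: "('a, 'r) ring_scheme \<Rightarrow> 'a set \<Rightarrow> 'a \<Rightarrow> 'a set" where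
  "colon R Q a = {r \<in> carrier R. r \<otimes>\<^bsub>R\<^esub> a \<in> Q}"

context cring
begin

lemma colon_ideal:
  assumes "ideal Q R" "a \<in> carrier R"
  shows "ideal (colon R Q a) R"
proof -
  interpret Q: ideal Q R by fact
  have mi: "\<ominus> x \<otimes> a = \<ominus> (x \<otimes> a)" if "x \<in> carrier R" for x
    using that assms by (simp add: l_minus)
  show ?thesis
  proof (rule idealI[OF ring_axioms])
    show "subgroup (colon R Q a) (add_monoid R)"
      by (rule add.subgroupI)
        (auto simp: colon_def l_distr assms mi simp flip: a_inv_def intro: exI[of _ \<zero>])
  next
    fix x y assume x: "x \<in> colon R Q a" and y: "y \<in> carrier R"
    have "y \<otimes> (x \<otimes> a) \<in> Q" using x y by (auto simp: colon_def intro: Q.I_l_closed)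
    then show 1: "y \<otimes> x \<in> colon R Q a" using x y assms by (auto simp: colon_def m_assoc)
    show "x \<otimes> y \<in> colon R Q a" using 1 x y by (simp add: colon_def m_comm)
  qed
qed

lemma colon_mult_subset:
  assumes "ideal Q R" "a \<in> carrier R" "s \<in> carrier R"
  shows "colon R Q a \<subseteq> colon R Q (s \<otimes> a)"
proof
  fix r assume r: "r \<in> colon R Q a"
  have "s \<otimes> (r \<otimes> a) \<in> Q" using r assms by (auto simp: colon_def intro: ideal.I_l_closed)
  moreover have "s \<otimes> (r \<otimes> a) = r \<otimes> (s \<otimes> a)" using r assms by (simp add: colon_def m_lcomm)
  ultimately show "r \<in> colon R Q (s \<otimes> a)" using r by (simp add: colon_def)
qed

end

section \<open>Maximal annihilators modulo an ideal\<close>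

context noetherian_cring
begin

text \<open>These are the maximal associated primes of \<open>R/Q\<close>. Their union already
  contains all zero divisors modulo \<open>Q\<close>, and their finiteness follows without primary
  decomposition.\<close>

definition assoc_max :: "'a set \<Rightarrow> 'a set set" where
  "assoc_max Q = {P \<in> colon R Q ` (carrier R - Q).
     \<forall>N \<in> colon R Q ` (carrier R - Q). P \<subseteq> N \<longrightarrow> N = P}"

lemma assoc_maxD:
  assumes "P \<in> assoc_max Q"
  shows "\<exists>a. a \<in> carrier R \<and> a \<notin> Q \<and> colon R Q a = P"
    and "\<And>b. b \<in> carrier R \<Longrightarrow> b \<notin> Q \<Longrightarrow> P \<subseteq> colon R Q b \<Longrightarrow> colon R Q b = P"
  using assms by (auto simp: assoc_max_def)

text \<open>If \<open>s\<close> is not in \<open>P\<close>, then \<open>s \<otimes> a\<close> is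
  still nonzero modulo \<open>Q\<close>, and its annihilator contains \<open>P\<close>; by
  maximality it equals \<open>P\<close>. So \<open>r \<otimes> s \<in> P\<close> forces
  \<open>r \<in> P\<close>.\<close>

lemma assoc_max_prime:
  assumes Q: "ideal Q R" and P: "P \<in> assoc_max Q"
  shows "primeideal P R"
proof -
  obtain a where a: "a \<in> carrier R" "a \<notin> Q" "P = colon R Q a"
    and max: "\<And>b. b \<in> carrier R \<Longrightarrow> b \<notin> Q \<Longrightarrow> P \<subseteq> colon R Q b \<Longrightarrow> colon R Q b = P"
    using assoc_maxD[OF P] by metis
  have "\<one> \<notin> P" using a by (simp add: colon_def)
  then have "carrier R \<noteq> P" by auto
  moreover have "r \<in> P \<or> s \<in> P" if c: "r \<in> carrier R" "s \<in> carrier R" and rs: "r \<otimes> s \<in> P" for r s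
  proof (rule disjCI)
    assume "s \<notin> P"
    then have "s \<otimes> a \<notin> Q" using a c by (simp add: colon_def)
    then have "colon R Q (s \<otimes> a) = P"
      using max[of "s \<otimes> a"] colon_mult_subset[OF Q, of a s] a c by auto
    moreover have "r \<in> colon R Q (s \<otimes> a)" using rs a c by (simp add: colon_def m_assoc)
    ultimately show "r \<in> P" by simp
  qed
  moreover have "ideal P R" using colon_ideal[OF Q] a by simp
  ultimately show ?thesis by (intro primeidealI is_cring)
qed

lemma zero_divisor_in_assoc_max:
  assumes Q: "ideal Q R" and "z \<in> carrier R" "\<not> regular_mod R Q z"
  shows "\<exists>P \<in> assoc_max Q. z \<in> P"
proof -
  obtain a where a: "a \<in> carrier R" "a \<notin> Q" "z \<otimes> a \<in> Q"
    using assms by (auto simp: regular_mod_def)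
  let ?S = "colon R Q ` (carrier R - Q)"
  have "colon R Q a \<in> ?S" using a by auto
  then obtain P where P: "P \<in> ?S" "colon R Q a \<subseteq> P" "\<And>N. N \<in> ?S \<Longrightarrow> P \<subseteq> N \<Longrightarrow> N = P"
    by (rule ideals_have_maximal_above) (use colon_ideal[OF Q] in auto)
  then have "P \<in> assoc_max Q" by (auto simp: assoc_max_def)
  moreover have "z \<in> P" using P(2) a assms by (auto simp: colon_def)
  ultimately show ?thesis by auto
qed

text \<open>Finitely many of the chosen witnesses \<open>a P\<close> generate the ideal of all of
  them. Every maximal annihilator then contains the intersection of the finitely many that belong to
  these generators, by primeness contains one of them, and by maximality equals it.\<close>

lemma finite_assoc_max:
  assumes Q: "ideal Q R"
  shows "finite (assoc_max Q)"
proof -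
  define a where "a = (\<lambda>P. SOME a. a \<in> carrier R \<and> a \<notin> Q \<and> colon R Q a = P)"
  have a_ex: "a P \<in> carrier R \<and> a P \<notin> Q \<and> colon R Q (a P) = P" if "P \<in> assoc_max Q" for P
    unfolding a_def by (rule someI_ex[OF assoc_maxD(1)[OF that]])
  have a: "a P \<in> carrier R - Q" if "P \<in> assoc_max Q" for P
    using a_ex[OF that] by (intro DiffI) (elim conjE, assumption)+
  have a_colon: "colon R Q (a P) = P" if "P \<in> assoc_max Q" for P
    using a_ex[OF that] by (elim conjE)
  have aC: "a ` assoc_max Q \<subseteq> carrier R" using a by auto
  then obtain Y where Y: "finite Y" "Y \<subseteq> a ` assoc_max Q" "Idl Y = Idl (a ` assoc_max Q)"
    by (rule finite_generating_subset)
  obtain \<Q> where \<Q>: "\<Q> \<subseteq> assoc_max Q" "finite \<Q>" "Y = a ` \<Q>"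
    using finite_subset_image[OF Y(1,2)] by blast
  have YC: "Y \<subseteq> carrier R" using Y aC by auto
  have "assoc_max Q \<subseteq> \<Q>"
  proof
    fix P assume P: "P \<in> assoc_max Q"
    have pP: "primeideal P R" by (rule assoc_max_prime[OF Q P])
    \<comment> \<open>Lying in all members of \<open>\<Q>\<close> means annihilating
      \<open>Y\<close> modulo \<open>Q\<close>, hence annihilating the ideal generated by
      \<open>Y\<close>, to which \<open>a P\<close> belongs.\<close>
    have sub: "r \<in> P" if r: "r \<in> carrier R" "\<And>P'. P' \<in> \<Q> \<Longrightarrow> r \<in> P'" for r
    proof -
      have "Y \<subseteq> colon R Q r"
      proof
        fix y assume y: "y \<in> Y"
        then obtain P' where P': "P' \<in> \<Q>" "y = a P'" using \<Q> by auto
        have "r \<in> colon R Q (a P')" using r(2)[OF P'(1)] a_colon[of P'] P' \<Q> by auto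
        then show "y \<in> colon R Q r" using P' y YC by (auto simp: colon_def m_comm)
      qed
      then have "Idl Y \<subseteq> colon R Q r" by (intro genideal_minimal colon_ideal Q r)
      moreover have "a P \<in> Idl Y" using Y(3) genideal_self[OF aC] P by auto
      ultimately have "a P \<otimes> r \<in> Q" by (auto simp: colon_def)
      then have "r \<otimes> a P \<in> Q" using r a[OF P] by (simp add: m_comm)
      then show "r \<in> P" using a_colon[OF P] r by (auto simp: colon_def)
    qed
    have one: "\<one> \<notin> P" using pP
      by (metis ideal.one_imp_carrier primeideal.I_notcarr primeideal.axioms(1))
    have ne: "\<Q> \<noteq> {}" using sub[of \<one>] one by auto
    have id: "ideal P' R" if "P' \<in> \<Q>" for P'
      using that \<Q> assoc_max_prime[OF Q] by (meson primeideal.axioms(1) subsetD)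
    have "\<exists>P' \<in> \<Q>. P' \<subseteq> P"
    proof (rule ccontr)
      assume n: "\<not> ?thesis"
      have "\<exists>w \<in> carrier R. w \<notin> P \<and> (\<forall>P' \<in> \<Q>. w \<in> P')"
      proof (rule common_element_outside_prime[OF \<Q>(2) ne pP oneideal id])
        fix P' assume "P' \<in> \<Q>"
        then show "\<exists>z \<in> carrier R. z \<in> P' \<and> z \<notin> P" using n ideal.Icarr[OF id] by blast
      qed auto
      then show False using sub by auto
    qed
    then obtain P' where P': "P' \<in> \<Q>" "P' \<subseteq> P" by auto
    moreover have "colon R Q (a P) = P" "a P \<in> carrier R - Q" using a_colon[OF P] a[OF P] .
    ultimately have "P = P'" using assoc_maxD(2)[of P' Q "a P"] P' \<Q>(1) by auto
    then show "P \<in> \<Q>" using P' by simp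
  qed
  then show ?thesis using \<Q>(2) finite_subset by blast
qed

text \<open>Several ideals are treated at once because the proof of Rees' theorem needs one element that
  is regular modulo two of them.\<close>

lemma exists_regular_mod:
  assumes "finite \<F>" and F: "\<And>Q. Q \<in> \<F> \<Longrightarrow> ideal Q R" and I: "ideal I R"
    and nk: "\<And>Q. Q \<in> \<F> \<Longrightarrow> \<not> killed_mod R I Q"
  shows "\<exists>z \<in> I. \<forall>Q \<in> \<F>. regular_mod R Q z"
proof (rule ccontr)
  assume n: "\<not> ?thesis"
  let ?P = "\<Union>Q \<in> \<F>. assoc_max Q"
  have "I \<subseteq> \<Union>?P"
  proof
    fix z assume z: "z \<in> I"
    then obtain Q where Q: "Q \<in> \<F>" "\<not> regular_mod R Q z" using n by blast
    have "\<exists>P \<in> assoc_max Q. z \<in> P"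
      by (rule zero_divisor_in_assoc_max[OF F[OF Q(1)] ideal.Icarr[OF I z] Q(2)])
    then show "z \<in> \<Union>?P" using Q(1) by blast
  qed
  moreover have "finite ?P" using assms(1) finite_assoc_max[OF F] by blast
  moreover have "primeideal P R" if "P \<in> ?P" for P
    using that assoc_max_prime[OF F] by blast
  ultimately have "\<exists>P \<in> ?P. I \<subseteq> P" by (intro prime_avoidance I)
  \<comment> \<open>The prime that contains \<open>I\<close> is the annihilator of a nonzero class
    modulo one of the ideals \<open>Q\<close>, and this class is then killed by
    \<open>I\<close>.\<close>
  then obtain P Q where PQ: "Q \<in> \<F>" "P \<in> assoc_max Q" "I \<subseteq> P" by blast
  then obtain a where a: "a \<in> carrier R - Q" "I \<subseteq> colon R Q a"
    using assoc_maxD(1)[OF PQ(2)] by blast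
  then have "killed_mod R I Q" unfolding killed_mod_def colon_def by blast
  then show False using nk PQ by blast
qed

end

section \<open>Regular sequences over an ideal and the theorem of Rees\<close>

text \<open>A regular sequence on \<open>R/Q\<close> without the demand that the final quotient be
  nonzero; that demand is recovered later from a proper ideal containing the sequence.\<close>

definition regular_over :: "('a, 'r) ring_scheme \<Rightarrow> 'a set \<Rightarrow> 'a list \<Rightarrow> bool" where
  "regular_over R Q xs \<longleftrightarrow> (\<forall>i < length xs. regular_mod R (Idl\<^bsub>R\<^esub> (Q \<union> set (take i xs))) (xs ! i))"

lemma regular_over_Nil [simp]: "regular_over R Q []"
  by (simp add: regular_over_def)

lemma regular_over_snoc:
  "regular_over R Q (xs @ [x]) \<longleftrightarrow> regular_over R Q xs \<and> regular_mod R (Idl\<^bsub>R\<^esub> (Q \<union> set xs)) x"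
  by (auto simp: regular_over_def nth_append less_Suc_eq)

lemma regular_modD:
  "regular_mod R Q x \<Longrightarrow> x \<otimes>\<^bsub>R\<^esub> r \<in> Q \<Longrightarrow> r \<in> carrier R \<Longrightarrow> r \<in> Q"
  by (simp add: regular_mod_def)

section \<open>Calculation modulo the ideals \<open>Q + (x)\<close>\<close>

context cring
begin

lemma ideal_subset: "ideal Q R \<Longrightarrow> Q \<subseteq> carrier R"
  using ideal.Icarr by (rule subsetI)

lemma Idl_ideal:
  assumes "ideal Q R"
  shows "Idl Q = Q"
  by (rule equalityI[OF genideal_minimal[OF assms] genideal_self[OF ideal_subset[OF assms]]]) simp

lemma Idl_insert_zero:
  assumes "S \<subseteq> carrier R"
  shows "Idl (insert \<zero> S) = Idl S"
proof (rule equalityI)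
  have "\<zero> \<in> Idl S" using genideal_ideal[OF assms]
    by (simp add: additive_subgroup.zero_closed ideal.axioms(1))
  then show "Idl (insert \<zero> S) \<subseteq> Idl S"
    by (intro genideal_minimal genideal_ideal insert_subsetI genideal_self assms)
  show "Idl S \<subseteq> Idl (insert \<zero> S)" by (rule subset_Idl_subset) (use assms in auto)
qed

lemma Idl_Un_Idl:
  assumes "S \<subseteq> carrier R" "U \<subseteq> carrier R"
  shows "Idl (Idl S \<union> U) = Idl (S \<union> U)"
proof (rule equalityI)
  have c: "S \<union> U \<subseteq> carrier R" using assms by blast
  have S: "Idl S \<subseteq> Idl (S \<union> U)" by (rule subset_Idl_subset[OF c]) blast
  have U: "U \<subseteq> Idl (S \<union> U)" using genideal_self[OF c] by blast
  show "Idl (Idl S \<union> U) \<subseteq> Idl (S \<union> U)"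
    by (rule genideal_minimal[OF genideal_ideal[OF c]]) (use S U in blast)
  have i: "Idl S \<subseteq> carrier R" by (rule ideal_subset[OF genideal_ideal[OF assms(1)]])
  show "Idl (S \<union> U) \<subseteq> Idl (Idl S \<union> U)"
    by (rule subset_Idl_subset) (use i genideal_self[OF assms(1)] assms in blast)+
qed

text \<open>The normal form through which all calculations modulo \<open>Q + (x)\<close> are
  done.\<close>

lemma mem_Idl_insert:
  assumes Q: "ideal Q R" and x: "x \<in> carrier R"
  shows "r \<in> Idl (insert x Q) \<longleftrightarrow> (\<exists>q \<in> Q. \<exists>s \<in> carrier R. r = q \<oplus> x \<otimes> s)"
proof -
  interpret Q: ideal Q R by fact
  have P: "ideal (PIdl x) R" by (rule cgenideal_ideal[OF x])
  have PI: "PIdl x = (\<lambda>s. x \<otimes> s) ` carrier R"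
    using x by (auto simp: cgenideal_def m_comm image_iff)
  have mem: "r \<in> Q <+> PIdl x \<longleftrightarrow> (\<exists>q \<in> Q. \<exists>s \<in> carrier R. r = q \<oplus> x \<otimes> s)" for r
    unfolding set_add_def' PI by auto
  have "Idl (Q \<union> PIdl x) = Q <+> PIdl x" by (rule union_genideal[OF Q P])
  moreover have "PIdl x = Idl {x}" by (rule cgenideal_eq_genideal[OF x])
  moreover have "Idl (Idl {x} \<union> Q) = Idl ({x} \<union> Q)" by (rule Idl_Un_Idl) (use x Q.Icarr in auto)
  ultimately show ?thesis using mem by (simp add: Un_commute)
qed

lemma ideal_Idl_Un: "ideal Q R \<Longrightarrow> S \<subseteq> carrier R \<Longrightarrow> ideal (Idl (Q \<union> S)) R"
  by (rule genideal_ideal) (simp add: ideal_subset)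

lemma ideal_Idl_insert: "ideal Q R \<Longrightarrow> x \<in> carrier R \<Longrightarrow> ideal (Idl (insert x Q)) R"
  using ideal_Idl_Un[of Q "{x}"] by simp

lemma Idl_insert_Un:
  assumes "ideal Q R" "x \<in> carrier R" "S \<subseteq> carrier R"
  shows "Idl (Idl (insert x Q) \<union> S) = Idl (insert x (Q \<union> S))"
proof -
  have "insert x Q \<subseteq> carrier R" using assms ideal_subset by simp
  from Idl_Un_Idl[OF this assms(3)] show ?thesis by simp
qed

lemma Idl_insert_swap:
  assumes "ideal Q R" "x \<in> carrier R" "z \<in> carrier R"
  shows "Idl (insert x (Idl (insert z Q))) = Idl (insert z (Idl (insert x Q)))"
  using Idl_insert_Un[of Q x "{z}"] Idl_insert_Un[of Q z "{x}"] assms by (simp add: insert_commute)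

lemma regular_over_append:
  assumes "ideal Q R" "set xs \<subseteq> carrier R" "set ys \<subseteq> carrier R"
  shows "regular_over R Q (xs @ ys) \<longleftrightarrow> regular_over R Q xs \<and> regular_over R (Idl (Q \<union> set xs)) ys"
  using assms(3)
proof (induction ys rule: rev_induct)
  case (snoc y ys)
  have "Q \<union> set xs \<subseteq> carrier R" using assms ideal_subset by simp
  from Idl_Un_Idl[OF this, of "set ys"] snoc
  have "Idl (Q \<union> set (xs @ ys)) = Idl (Idl (Q \<union> set xs) \<union> set ys)" by (simp add: Un_assoc)
  moreover have "regular_over R Q (xs @ ys @ [y]) \<longleftrightarrow>
      regular_over R Q (xs @ ys) \<and> regular_mod R (Idl (Q \<union> set (xs @ ys))) y"
    using regular_over_snoc[of R Q "xs @ ys" y] by simp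
  ultimately show ?case using snoc by (auto simp: regular_over_snoc)
qed simp

text \<open>Removing the first element replaces the base \<open>Q\<close> by \<open>Q + (x)\<close>;
  in the inductions on length this stands for passing to the quotient by \<open>x\<close>.\<close>

lemma regular_over_Cons:
  assumes "ideal Q R" "x \<in> carrier R" "set xs \<subseteq> carrier R"
  shows "regular_over R Q (x # xs) \<longleftrightarrow> regular_mod R Q x \<and> regular_over R (Idl (insert x Q)) xs"
proof -
  have "regular_over R Q [x] \<longleftrightarrow> regular_mod R Q x"
    by (simp add: regular_over_def Idl_ideal[OF assms(1)])
  then show ?thesis using regular_over_append[of Q "[x]" xs] assms by simp
qed

lemma regular_mod_not_killed_mod:
  assumes "x \<in> I" "regular_mod R Q x"
  shows "\<not> killed_mod R I Q"
  using assms unfolding regular_mod_def killed_mod_def by blast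

text \<open>Through \<open>y u = x v\<close> modulo \<open>Q\<close>, a class \<open>u\<close>
  modulo \<open>Q + (x)\<close> killed by \<open>I\<close> corresponds to a class \<open>v\<close>
  modulo \<open>Q + (y)\<close> killed by \<open>I\<close>, because \<open>x\<close> and
  \<open>y\<close> can both be cancelled. Conceptually both sets of classes are Ext^1(R/I,
  R/Q).\<close>

lemma killed_mod_exchange1:
  assumes I: "ideal I R" and Q: "ideal Q R" and x: "x \<in> I" "regular_mod R Q x"
    and y: "y \<in> I" "regular_mod R Q y" and k: "killed_mod R I (Idl (insert x Q))"
  shows "killed_mod R I (Idl (insert y Q))"
proof -
  interpret Q: ideal Q R by fact
  have c: "x \<in> carrier R" "y \<in> carrier R" using x y ideal.Icarr[OF I] by auto
  note memx = mem_Idl_insert[OF Q c(1)]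
  note memy = mem_Idl_insert[OF Q c(2)]
  obtain u where u: "u \<in> carrier R" "u \<notin> Idl (insert x Q)"
    "\<And>i. i \<in> I \<Longrightarrow> i \<otimes> u \<in> Idl (insert x Q)" using k by (auto simp: killed_mod_def)
  \<comment> \<open>As \<open>y\<close> lies in \<open>I\<close>, it multiplies the witness
    \<open>u\<close> into \<open>Q + (x)\<close>; the coefficient of \<open>x\<close> is the new
    witness.\<close>
  from u(3)[OF y(1)] obtain q v where v: "q \<in> Q" "v \<in> carrier R" "y \<otimes> u = q \<oplus> x \<otimes> v"
    unfolding memx by blast
  \<comment> \<open>Otherwise \<open>v = q' + y w\<close>, and cancelling \<open>y\<close> puts
    \<open>u - x w\<close> into \<open>Q\<close>, so that \<open>u\<close> would vanish modulo
    \<open>Q + (x)\<close>.\<close>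
  have "v \<notin> Idl (insert y Q)"
  proof
    assume "v \<in> Idl (insert y Q)"
    then obtain q' w where w: "q' \<in> Q" "w \<in> carrier R" "v = q' \<oplus> y \<otimes> w" unfolding memy by blast
    have qc: "q \<in> carrier R" "q' \<in> carrier R" using v w Q.Icarr by auto
    have "y \<otimes> (u \<ominus> x \<otimes> w) = (y \<otimes> u) \<ominus> y \<otimes> (x \<otimes> w)"
      using c u(1) w(2) by (simp add: a_minus_def r_distr r_minus)
    also have "\<dots> = q \<oplus> x \<otimes> q'"
    proof -
      have "y \<otimes> u = (q \<oplus> x \<otimes> q') \<oplus> y \<otimes> (x \<otimes> w)"
        unfolding v(3) w(3) using c qc w(2) by (simp add: r_distr a_assoc m_lcomm)
      then show ?thesis using c qc w(2) by (simp add: a_minus_def a_assoc r_neg)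
    qed
    also have "\<dots> \<in> Q" using v(1) w(1) c by (intro Q.a_closed Q.I_l_closed)
    finally have "u \<ominus> x \<otimes> w \<in> Q"
      by (rule regular_modD[OF y(2)]) (use u(1) w(2) c in simp)
    moreover have "u = (u \<ominus> x \<otimes> w) \<oplus> x \<otimes> w"
      using u(1) w(2) c by (simp add: a_minus_def a_assoc l_neg)
    ultimately have "u \<in> Idl (insert x Q)" using memx w(2) by blast
    then show False using u by simp
  qed
  \<comment> \<open>Here \<open>x\<close> is cancelled: with \<open>i u = q' + x t\<close>, the
    element \<open>x (i v - y t)\<close> lies in \<open>Q\<close>.\<close>
  moreover have "i \<otimes> v \<in> Idl (insert y Q)" if i: "i \<in> I" for i
  proof -
    have ic: "i \<in> carrier R" using i ideal.Icarr[OF I] by simp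
    from u(3)[OF i] obtain q' t where t: "q' \<in> Q" "t \<in> carrier R" "i \<otimes> u = q' \<oplus> x \<otimes> t"
      unfolding memx by blast
    have qc: "q \<in> carrier R" "q' \<in> carrier R" using v t Q.Icarr by auto
    have "x \<otimes> v = y \<otimes> u \<ominus> q" unfolding v(3) using v(2) qc c
      by (simp add: a_minus_def a_ac r_neg1 r_neg2)
    then have "i \<otimes> (x \<otimes> v) = i \<otimes> (y \<otimes> u) \<ominus> i \<otimes> q"
      using ic c u(1) qc by (simp add: a_minus_def r_distr r_minus)
    also have "i \<otimes> (y \<otimes> u) = y \<otimes> (i \<otimes> u)" using ic c u(1) by (simp add: m_lcomm)
    also have "y \<otimes> (i \<otimes> u) = y \<otimes> q' \<oplus> x \<otimes> (y \<otimes> t)"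
      unfolding t(3) using c t(2) qc by (simp add: r_distr m_lcomm)
    finally have e: "i \<otimes> (x \<otimes> v) = (y \<otimes> q' \<oplus> x \<otimes> (y \<otimes> t)) \<ominus> i \<otimes> q" .
    have "x \<otimes> (i \<otimes> v \<ominus> y \<otimes> t) = i \<otimes> (x \<otimes> v) \<ominus> x \<otimes> (y \<otimes> t)"
      using c ic v(2) t(2) by (simp add: a_minus_def r_distr r_minus m_lcomm)
    also have "\<dots> = y \<otimes> q' \<ominus> i \<otimes> q"
      unfolding e using c ic t(2) qc by (simp add: a_minus_def a_ac r_neg1 r_neg2 r_neg)
    also have "\<dots> \<in> Q" unfolding a_minus_def using t(1) v(1) c ic
      by (intro Q.a_closed Q.I_l_closed Q.a_inv_closed)
    finally have "i \<otimes> v \<ominus> y \<otimes> t \<in> Q"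
      by (rule regular_modD[OF x(2)]) (use c ic v(2) t(2) in simp)
    moreover have "i \<otimes> v = (i \<otimes> v \<ominus> y \<otimes> t) \<oplus> y \<otimes> t"
      using c ic v(2) t(2) by (simp add: a_minus_def a_assoc l_neg)
    ultimately show ?thesis using memy t(2) by blast
  qed
  ultimately show ?thesis using v(2) unfolding killed_mod_def by blast
qed

text \<open>One half of interchanging a two-term regular sequence: \<open>x r = q + z s\<close>
  forces \<open>s = q' + x t\<close>, and then \<open>x\<close> cancels from
  \<open>x (r - z t)\<close>. The other half, regularity of \<open>z\<close> modulo
  \<open>Q\<close>, can fail in general and has to be secured by the choice of
  \<open>z\<close>.\<close>

lemma regular_mod_swap:
  assumes Q: "ideal Q R" and c: "x \<in> carrier R" "z \<in> carrier R"
    and x: "regular_mod R Q x" and zx: "regular_mod R (Idl (insert x Q)) z"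
  shows "regular_mod R (Idl (insert z Q)) x"
  unfolding regular_mod_def
proof (intro ballI impI)
  interpret Q: ideal Q R by fact
  fix r assume r: "r \<in> carrier R" "x \<otimes> r \<in> Idl (insert z Q)"
  then obtain q s where s: "q \<in> Q" "s \<in> carrier R" "x \<otimes> r = q \<oplus> z \<otimes> s"
    unfolding mem_Idl_insert[OF Q c(2)] by blast
  have qc: "q \<in> carrier R" using s Q.Icarr by auto
  have "z \<otimes> s = \<ominus> q \<oplus> x \<otimes> r" unfolding s(3) using s(2) qc c by (simp add: r_neg1)
  then have "z \<otimes> s \<in> Idl (insert x Q)"
    unfolding mem_Idl_insert[OF Q c(1)] using s(1) r(1) Q.a_inv_closed by blast
  then have "s \<in> Idl (insert x Q)" by (rule regular_modD[OF zx]) (rule s(2))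
  then obtain q' t where t: "q' \<in> Q" "t \<in> carrier R" "s = q' \<oplus> x \<otimes> t"
    unfolding mem_Idl_insert[OF Q c(1)] by blast
  have q'c: "q' \<in> carrier R" using t Q.Icarr by auto
  have "x \<otimes> r = (q \<oplus> z \<otimes> q') \<oplus> x \<otimes> (z \<otimes> t)"
    unfolding s(3) t(3) using t(2) q'c qc c by (simp add: r_distr a_assoc m_lcomm)
  then have "x \<otimes> (r \<ominus> z \<otimes> t) = q \<oplus> z \<otimes> q'"
    using c r(1) t(2) qc q'c by (simp add: a_minus_def r_distr r_minus a_assoc r_neg)
  also have "\<dots> \<in> Q" using s(1) t(1) c by (intro Q.a_closed Q.I_l_closed)
  finally have "r \<ominus> z \<otimes> t \<in> Q"
    by (rule regular_modD[OF x]) (use c r(1) t(2) in simp)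
  moreover have "r = (r \<ominus> z \<otimes> t) \<oplus> z \<otimes> t"
    using c r(1) t(2) by (simp add: a_minus_def a_assoc l_neg)
  ultimately show "r \<in> Idl (insert z Q)" unfolding mem_Idl_insert[OF Q c(2)] using t(2) by blast
qed

lemma regular_over_take_not_killed:
  assumes "regular_over R Q xs" "set xs \<subseteq> I" "k < length xs"
  shows "\<not> killed_mod R I (Idl (Q \<union> set (take k xs)))"
  using assms by (intro regular_mod_not_killed_mod[of "xs ! k"]) (auto simp: regular_over_def)

lemma regular_over_take:
  assumes "regular_over R Q xs"
  shows "regular_over R Q (take k xs)"
  using assms by (auto simp: regular_over_def min_def)

end

text \<open>\<open>Q\<close> is quantified inside, since the induction on \<open>n\<close> keeps
  \<open>I\<close> and moves from \<open>Q\<close> to \<open>Q\<close> enlarged by one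
  element.\<close>

definition exchange :: "('a, 'r) ring_scheme \<Rightarrow> 'a set \<Rightarrow> nat \<Rightarrow> bool" where
  "exchange R I n \<longleftrightarrow> (\<forall>Q xs ys. ideal Q R \<longrightarrow> length xs = n \<longrightarrow> length ys = n \<longrightarrow>
     set xs \<subseteq> I \<longrightarrow> set ys \<subseteq> I \<longrightarrow> regular_over R Q xs \<longrightarrow> regular_over R Q ys \<longrightarrow>
     killed_mod R I (Idl\<^bsub>R\<^esub> (Q \<union> set xs)) \<longrightarrow> killed_mod R I (Idl\<^bsub>R\<^esub> (Q \<union> set ys)))"

lemma exchangeD:
  assumes "exchange R I n" "ideal Q R" "length xs = n" "length ys = n" "set xs \<subseteq> I" "set ys \<subseteq> I"
    "regular_over R Q xs" "regular_over R Q ys" "killed_mod R I (Idl\<^bsub>R\<^esub> (Q \<union> set xs))"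
  shows "killed_mod R I (Idl\<^bsub>R\<^esub> (Q \<union> set ys))"
  using assms unfolding exchange_def by blast

section \<open>Rees' theorem on the lengths of maximal regular sequences\<close>

context noetherian_cring
begin

lemma exists_regular_snoc:
  assumes I: "ideal I R" and Q: "ideal Q R" and "set xs \<subseteq> I" "regular_over R Q xs"
    and "\<not> killed_mod R I (Idl (Q \<union> set xs))"
  shows "\<exists>z \<in> I. regular_over R Q (xs @ [z])"
proof -
  have "set xs \<subseteq> carrier R" using assms(3) ideal_subset[OF I] by simp
  then have "ideal (Idl (Q \<union> set xs)) R" by (rule ideal_Idl_Un[OF Q])
  with exists_regular_mod[of "{Idl (Q \<union> set xs)}" I] assms
  show ?thesis by (simp add: regular_over_snoc)
qed

text \<open>A shorter sequence \<open>zs\<close> cannot get stuck: the prefix of \<open>xs\<close>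
  of the same length is followed by a regular element of \<open>I\<close>, so its ideal is not
  killed, and by exchange neither is that of \<open>zs\<close>. Exchange is asked only below the
  length of \<open>xs\<close>, which is what the induction for \<open>exchange_all\<close> can
  supply.\<close>

lemma regular_over_extend:
  assumes ex: "\<And>k. k < length xs \<Longrightarrow> exchange R I k" and I: "ideal I R" and Q: "ideal Q R"
    and xs: "set xs \<subseteq> I" "regular_over R Q xs"
  shows "set zs \<subseteq> I \<Longrightarrow> regular_over R Q zs \<Longrightarrow> length zs \<le> length xs \<Longrightarrow>
    \<exists>ws. length (zs @ ws) = length xs \<and> set ws \<subseteq> I \<and> regular_over R Q (zs @ ws)"
proof (induction "length xs - length zs" arbitrary: zs)
  case 0
  then show ?case by (intro exI[of _ "[]"]) simp
next
  case (Suc n)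
  let ?k = "length zs"
  have k: "?k < length xs" using Suc.hyps(2) by simp
  have xk: "set (take ?k xs) \<subseteq> I" using xs(1) set_take_subset by (rule subset_trans[rotated])
  have "\<not> killed_mod R I (Idl (Q \<union> set (take ?k xs)))"
    by (rule regular_over_take_not_killed[OF xs(2,1) k])
  then have "\<not> killed_mod R I (Idl (Q \<union> set zs))"
    using exchangeD[OF ex[OF k] Q, of zs "take ?k xs"] k Suc.prems(1,2) xk
      regular_over_take[OF xs(2), of ?k] by auto
  then obtain z where z: "z \<in> I" "regular_over R Q (zs @ [z])"
    using exists_regular_snoc[OF I Q Suc.prems(1,2)] by auto
  have "n = length xs - length (zs @ [z])" using Suc.hyps(2) by simp
  from Suc.hyps(1)[OF this] z Suc.prems(1) k
  obtain ws where "length ((zs @ [z]) @ ws) = length xs" "set ws \<subseteq> I"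
    "regular_over R Q ((zs @ [z]) @ ws)" by auto
  then show ?case using z(1) by (intro exI[of _ "z # ws"]) simp
qed

text \<open>For sequences of length at least 2 with first elements \<open>x\<close> and \<open>y\<close>, choose \<open>z\<close> regular
  modulo \<open>Q\<close>, \<open>Q + (x)\<close> and \<open>Q + (y)\<close>. Both sequences can be replaced by ones starting with
  \<open>x, z\<close> and \<open>y, z\<close>, hence, after a swap, by ones starting with \<open>z\<close>.\<close>

lemma exchange_all:
  assumes I: "ideal I R"
  shows "exchange R I n"
proof (induction n rule: less_induct)
  case (less n)
  show ?case
    unfolding exchange_def
  proof (intro allI impI)
    fix Q xs ys
    assume Q: "ideal Q R" and len: "length xs = n" "length ys = n" and xI: "set xs \<subseteq> I"
      and yI: "set ys \<subseteq> I" and xreg: "regular_over R Q xs" and yreg: "regular_over R Q ys"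
      and k: "killed_mod R I (Idl (Q \<union> set xs))"
    have Ic: "I \<subseteq> carrier R" by (rule ideal_subset[OF I])
    show "killed_mod R I (Idl (Q \<union> set ys))"
    proof (cases "n = 0")
      case True
      then show ?thesis using k len by simp
    next
      case False
      then obtain x xr where xs: "xs = x # xr" using len by (cases xs) auto
      obtain y yr where ys: "ys = y # yr" using False len by (cases ys) auto
      have c: "x \<in> carrier R" "y \<in> carrier R" "set xr \<subseteq> carrier R" "set yr \<subseteq> carrier R"
        using xI yI Ic xs ys by auto
      have m: "x \<in> I" "y \<in> I" "set xr \<subseteq> I" "set yr \<subseteq> I" using xI yI xs ys by auto
      let ?Qx = "Idl (insert x Q)" and ?Qy = "Idl (insert y Q)"
      have Qx: "ideal ?Qx R" and Qy: "ideal ?Qy R"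
        using ideal_Idl_insert Q c by auto
      have rx: "regular_mod R Q x" "regular_over R ?Qx xr"
        using xreg regular_over_Cons[OF Q c(1,3)] xs by auto
      have ry: "regular_mod R Q y" "regular_over R ?Qy yr"
        using yreg regular_over_Cons[OF Q c(2,4)] ys by auto
      have kx: "killed_mod R I (Idl (?Qx \<union> set xr))"
        using k Idl_insert_Un[OF Q c(1,3)] xs by simp
      have goal_eq: "Idl (Q \<union> set ys) = Idl (?Qy \<union> set yr)"
        using Idl_insert_Un[OF Q c(2,4)] ys by simp
      show ?thesis
      proof (cases "xr = []")
        case True
        then have "yr = []" using len xs ys by auto
        moreover have "killed_mod R I ?Qx" using kx True Idl_ideal[OF Qx] by simp
        then have "killed_mod R I ?Qy"
          by (rule killed_mod_exchange1[OF I Q m(1) rx(1) m(2) ry(1)])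
        ultimately show ?thesis using ys by simp
      next
        case False
        have pos: "0 < length xr" "0 < length yr" "length xr < n" "length yr = length xr"
          using False len xs ys by auto
        \<comment> \<open>Since both sequences have a second element, \<open>I\<close> contains an
          element regular modulo each of the three ideals, so none of them is killed and a common
          \<open>z\<close> exists.\<close>
        have n1: "\<not> killed_mod R I Q" by (rule regular_mod_not_killed_mod[OF m(1) rx(1)])
        have n2: "\<not> killed_mod R I ?Qx"
          using regular_over_take_not_killed[OF rx(2) m(3) pos(1)] Idl_ideal[OF Qx] by simp
        have n3: "\<not> killed_mod R I ?Qy"
          using regular_over_take_not_killed[OF ry(2) m(4) pos(2)] Idl_ideal[OF Qy] by simp
        have "\<exists>z \<in> I. \<forall>L \<in> {Q, ?Qx, ?Qy}. regular_mod R L z"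
          by (rule exists_regular_mod) (use Q Qx Qy I n1 n2 n3 in auto)
        then obtain z where z: "z \<in> I" "regular_mod R Q z" "regular_mod R ?Qx z" "regular_mod R ?Qy z"
          by auto
        have zc: "z \<in> carrier R" using z(1) Ic by auto
        let ?Qz = "Idl (insert z Q)"
        have Qz: "ideal ?Qz R" using ideal_Idl_insert Q zc by auto
        \<comment> \<open>The tail after \<open>u\<close> is replaced by one of equal length
          starting with \<open>z\<close>, and then \<open>u\<close> and \<open>z\<close> change
          places. The generated ideal is unaffected by the interchange; \<open>u\<close> will be
          \<open>x\<close> and \<open>y\<close>.\<close>
        have through_z: "\<exists>w. length (z # w) = length ur \<and> set (z # w) \<subseteq> I \<and>
            regular_over R (Idl (insert u Q)) (z # w) \<and> regular_over R ?Qz (u # w) \<and>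
            Idl (Idl (insert u Q) \<union> set (z # w)) = Idl (?Qz \<union> set (u # w))"
          if u: "u \<in> I" "regular_mod R Q u" "regular_mod R (Idl (insert u Q)) z"
            and ur: "set ur \<subseteq> I" "regular_over R (Idl (insert u Q)) ur" "length ur = length xr" for u ur
        proof -
          have uc: "u \<in> carrier R" using u Ic by auto
          let ?Qu = "Idl (insert u Q)"
          have Qu: "ideal ?Qu R" using ideal_Idl_insert Q uc by auto
          have "regular_over R ?Qu [z]" using regular_over_Cons[OF Qu zc, of "[]"] u(3) by simp
          moreover have "exchange R I k" if "k < length ur" for k
            by (rule less.IH) (use that ur(3) pos(3) in simp)
          ultimately obtain w where w: "length ([z] @ w) = length ur" "set w \<subseteq> I"
            "regular_over R ?Qu ([z] @ w)"
            using regular_over_extend[OF _ I Qu ur(1,2), of "[z]"] z(1) ur(3) pos(1) by auto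
          have wc: "set w \<subseteq> carrier R" using w(2) Ic by auto
          have sw: "Idl (insert z ?Qu) = Idl (insert u ?Qz)" by (rule Idl_insert_swap[OF Q zc uc])
          have "regular_mod R ?Qz u" by (rule regular_mod_swap[OF Q uc zc u(2,3)])
          moreover have "regular_over R (Idl (insert z ?Qu)) w"
            using w(3) regular_over_Cons[OF Qu zc wc] by simp
          ultimately have "regular_over R ?Qz (u # w)"
            using regular_over_Cons[OF Qz uc wc] sw by simp
          moreover have "Idl (?Qu \<union> set (z # w)) = Idl (?Qz \<union> set (u # w))"
            using Idl_insert_Un[OF Q uc, of "set (z # w)"] Idl_insert_Un[OF Q zc, of "set (u # w)"]
              uc zc wc by (simp add: insert_commute)
          ultimately show ?thesis using w z(1) by (intro exI[of _ w]) simp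
        qed
        from through_z[OF m(1) rx(1) z(3) m(3) rx(2)] obtain w where w:
          "length (z # w) = length xr" "set (z # w) \<subseteq> I" "regular_over R ?Qx (z # w)"
          "regular_over R ?Qz (x # w)" "Idl (?Qx \<union> set (z # w)) = Idl (?Qz \<union> set (x # w))" by blast
        from through_z[OF m(2) ry(1) z(4) m(4) ry(2) pos(4)] obtain v where v:
          "length (z # v) = length yr" "set (z # v) \<subseteq> I" "regular_over R ?Qy (z # v)"
          "regular_over R ?Qz (y # v)" "Idl (?Qy \<union> set (z # v)) = Idl (?Qz \<union> set (y # v))" by blast
        \<comment> \<open>The witness travels along \<open>x, xr\<close> to \<open>x, z, w\<close>
          to \<open>z, x, w\<close> to \<open>z, y, v\<close> to \<open>y, z, v\<close> to
          \<open>y, yr\<close>. The interchanges are equalities of ideals; the other three moves are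
          exchanges of length \<open>n - 1\<close> over \<open>?Qx\<close>, \<open>?Qz\<close> and
          \<open>?Qy\<close>.\<close>
        note IH = less.IH[OF pos(3)]
        have "killed_mod R I (Idl (?Qx \<union> set (z # w)))"
          by (rule exchangeD[OF IH Qx refl w(1) m(3) w(2) rx(2) w(3) kx])
        then have 1: "killed_mod R I (Idl (?Qz \<union> set (x # w)))" unfolding w(5) .
        have "killed_mod R I (Idl (?Qz \<union> set (y # v)))"
          by (rule exchangeD[OF IH Qz _ _ _ _ w(4) v(4) 1]) (use w v pos m in auto)
        then have 2: "killed_mod R I (Idl (?Qy \<union> set (z # v)))" unfolding v(5) .
        have "killed_mod R I (Idl (?Qy \<union> set yr))"
          by (rule exchangeD[OF IH Qy _ _ v(2) m(4) v(3) ry(2) 2]) (use v pos in auto)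
        then show ?thesis unfolding goal_eq .
      qed
    qed
  qed
qed

end

section \<open>Translation of the definition by quotient rings\<close>

context cring
begin

lemma zero_divisor_Quot_iff:
  assumes Q: "ideal Q R" and x: "x \<in> carrier R"
  shows "zero_divisor (R Quot Q) (Q +> x) \<longleftrightarrow> \<not> regular_mod R Q x"
proof -
  interpret Q: ideal Q R by fact
  have zero: "Q +> r = \<zero>\<^bsub>R Quot Q\<^esub> \<longleftrightarrow> r \<in> Q" if "r \<in> carrier R" for r
    using that Q.a_rcos_const Q.rcos_const_imp_mem by (auto simp: FactRing_def)
  have m: "(Q +> x) \<otimes>\<^bsub>R Quot Q\<^esub> (Q +> r) = Q +> (x \<otimes> r)" if "r \<in> carrier R" for r
    using Q.rcoset_mult_add[OF x that] by (simp add: FactRing_def)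
  have car: "carrier (R Quot Q) = (+>) Q ` carrier R"
    by (auto simp: FactRing_def A_RCOSETS_def')
  show ?thesis
    unfolding zero_divisor_def car regular_mod_def using zero m x by auto
qed

text \<open>The base is \<open>{\<zero>}\<close> rather than the empty set, so that the results
  about ideals \<open>Q\<close> apply; a zero among the generators does not change the generated
  ideal.\<close>

lemma regular_sequence_iff:
  "regular_sequence R xs \<longleftrightarrow>
    set xs \<subseteq> carrier R \<and> Idl (set xs) \<noteq> carrier R \<and> regular_over R {\<zero>} xs"
proof (cases "set xs \<subseteq> carrier R")
  case True
  have "\<not> zero_divisor (R Quot (Idl (set (take i xs)))) (Idl (set (take i xs)) +> xs ! i) \<longleftrightarrow>
    regular_mod R (Idl ({\<zero>} \<union> set (take i xs))) (xs ! i)" if i: "i < length xs" for i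
  proof -
    have c: "set (take i xs) \<subseteq> carrier R" using True set_take_subset by fast
    have x: "xs ! i \<in> carrier R" using True i nth_mem by blast
    show ?thesis using zero_divisor_Quot_iff[OF genideal_ideal[OF c] x] Idl_insert_zero[OF c] by simp
  qed
  then show ?thesis by (auto simp: regular_sequence_def regular_over_def Let_def)
qed (simp add: regular_sequence_def)

end

section \<open>Grade\<close>

text \<open>Maximality expressed by an element instead of by the failure of every extension. Unlike
  the latter, an element can be transported into another ring.\<close>

definition grade_witness :: "('a, 'r) ring_scheme \<Rightarrow> 'a set \<Rightarrow> 'a list \<Rightarrow> bool" where
  "grade_witness R I xs \<longleftrightarrow>
    set xs \<subseteq> I \<and> regular_over R {\<zero>\<^bsub>R\<^esub>} xs \<and> killed_mod R I (Idl\<^bsub>R\<^esub> (insert \<zero>\<^bsub>R\<^esub> (set xs)))"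

context noetherian_cring
begin

lemma regular_sequence_in_proper_ideal:
  assumes I: "ideal I R" and "I \<noteq> carrier R" and "set xs \<subseteq> I" and "regular_over R {\<zero>} xs"
  shows "regular_sequence R xs"
proof -
  have "Idl (set xs) \<subseteq> I" by (rule genideal_minimal[OF I assms(3)])
  then have "Idl (set xs) \<noteq> carrier R" using assms(2) ideal_subset[OF I] by auto
  then show ?thesis unfolding regular_sequence_iff using assms(3,4) ideal_subset[OF I] by simp
qed

text \<open>An ideal that kills no class contains a regular element, and the sequence extended by it
  remains proper because it stays in \<open>I\<close>. Conversely a killed class rules out any
  regular element of \<open>I\<close>.\<close>

lemma maximal_regular_sequence_iff:
  assumes I: "ideal I R" and ne: "I \<noteq> carrier R"
  shows "maximal_regular_sequence R I xs \<longleftrightarrow> grade_witness R I xs"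
proof
  assume m: "maximal_regular_sequence R I xs"
  then have xs: "set xs \<subseteq> I" "regular_over R {\<zero>} xs"
    by (auto simp: maximal_regular_sequence_def regular_sequence_iff)
  have "killed_mod R I (Idl ({\<zero>} \<union> set xs))"
  proof (rule ccontr)
    assume "\<not> ?thesis"
    from exists_regular_snoc[OF I zeroideal xs this]
    obtain z where z: "z \<in> I" "regular_over R {\<zero>} (xs @ [z])" by auto
    have "regular_sequence R (xs @ [z])"
      by (rule regular_sequence_in_proper_ideal[OF I ne _ z(2)]) (use xs z(1) in simp)
    then show False using m z(1) by (auto simp: maximal_regular_sequence_def)
  qed
  then show "grade_witness R I xs" using xs by (simp add: grade_witness_def)
next
  assume w: "grade_witness R I xs"
  have "\<not> regular_sequence R (xs @ [x])" if "x \<in> I" for x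
    using w regular_mod_not_killed_mod[OF that]
    by (auto simp: grade_witness_def regular_sequence_iff regular_over_snoc)
  then show "maximal_regular_sequence R I xs"
    using w regular_sequence_in_proper_ideal[OF I ne, of xs]
    by (auto simp: grade_witness_def maximal_regular_sequence_def)
qed

text \<open>If \<open>ys\<close> were longer, its prefix of the length of \<open>xs\<close> would
  inherit a killed class by exchange, although the next element of \<open>ys\<close> lies in
  \<open>I\<close> and is regular there.\<close>

lemma grade_witness_length_le:
  assumes I: "ideal I R" and x: "grade_witness R I xs"
    and y: "set ys \<subseteq> I" "regular_over R {\<zero>} ys"
  shows "length ys \<le> length xs"
proof (rule ccontr)
  assume n: "\<not> ?thesis"
  let ?y = "take (length xs) ys"
  have "killed_mod R I (Idl ({\<zero>} \<union> set ?y))"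
  proof (rule exchangeD[OF exchange_all[OF I] zeroideal, of xs])
    show "set ?y \<subseteq> I" using set_take_subset y(1) by (rule subset_trans)
    show "regular_over R {\<zero>} ?y" by (rule regular_over_take[OF y(2)])
  qed (use n x in \<open>auto simp: grade_witness_def\<close>)
  then show False using regular_over_take_not_killed[OF y(2,1)] n by simp
qed

text \<open>Among the ideals generated by regular sequences in \<open>I\<close> a maximal one is
  chosen. A further regular element \<open>z\<close> would already belong to it.\<close>

lemma exists_grade_witness:
  assumes I: "ideal I R" and ne: "I \<noteq> carrier R"
  obtains xs where "grade_witness R I xs"
proof -
  let ?S = "{Idl (insert \<zero> (set xs)) | xs. set xs \<subseteq> I \<and> regular_over R {\<zero>} xs}"
  have zI: "\<zero> \<in> I" using I by (simp add: additive_subgroup.zero_closed ideal.axioms(1))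
  have c: "insert \<zero> (set xs) \<subseteq> carrier R" if "set xs \<subseteq> I" for xs
    using that ideal_subset[OF I] by auto
  have "\<exists>M \<in> ?S. \<forall>N \<in> ?S. M \<subseteq> N \<longrightarrow> N = M"
  proof (rule ideals_have_maximal)
    show "?S \<noteq> {}" by (auto intro: exI[of _ "[]"])
    show "ideal L R" if "L \<in> ?S" for L using that c by (auto intro: genideal_ideal)
  qed
  then obtain M where M: "M \<in> ?S" and max: "\<forall>N \<in> ?S. M \<subseteq> N \<longrightarrow> N = M" ..
  from M obtain xs where xs: "M = Idl (insert \<zero> (set xs))" "set xs \<subseteq> I" "regular_over R {\<zero>} xs"
    by auto
  have "killed_mod R I (Idl ({\<zero>} \<union> set xs))"
  proof (rule ccontr)
    assume "\<not> ?thesis"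
    from exists_regular_snoc[OF I zeroideal xs(2,3) this]
    obtain z where z: "z \<in> I" "regular_over R {\<zero>} (xs @ [z])" by auto
    let ?N = "Idl (insert \<zero> (set (xs @ [z])))"
    have zs: "set (xs @ [z]) \<subseteq> I" using xs(2) z(1) by simp
    have "?N \<in> ?S" using z(2) zs by (intro CollectI exI[of _ "xs @ [z]"]) simp
    moreover have "M \<subseteq> ?N" unfolding xs(1) by (rule subset_Idl_subset[OF c[OF zs]]) auto
    ultimately have eq: "?N = M" using max by simp
    have "z \<in> ?N" using genideal_self[OF c[OF zs]] by auto
    then have zM: "z \<in> M" using eq by simp
    have zc: "z \<in> carrier R" using z(1) ideal.Icarr[OF I] by simp
    \<comment> \<open>An element of \<open>M\<close> that is regular modulo \<open>M\<close> can be
      cancelled from \<open>z \<otimes> \<one>\<close>, which puts \<open>\<one>\<close> into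
      \<open>M\<close> and hence into \<open>I\<close>.\<close>
    have "regular_mod R M z" using z(2) xs(1) by (simp add: regular_over_snoc)
    then have "\<one> \<in> M" using zM zc by (auto elim: regular_modD)
    moreover have "M \<subseteq> I" unfolding xs(1) by (rule genideal_minimal[OF I]) (use xs(2) zI in auto)
    ultimately show False using ideal.one_imp_carrier[OF I] ne by auto
  qed
  then show thesis using that[of xs] xs(2,3) by (simp add: grade_witness_def)
qed

text \<open>Comparing lengths in both directions, all witnesses have one length; exhibiting a single
  witness therefore settles the definite description in \<open>grade\<close>.\<close>

lemma grade_eqI:
  assumes I: "ideal I R" and ne: "I \<noteq> carrier R" and x: "grade_witness R I xs"
  shows "grade R I = length xs"
proof -
  have le: "length ys \<le> length zs" if "grade_witness R I ys" "grade_witness R I zs" for ys zs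
    using grade_witness_length_le[OF I that(2), of ys] that(1) by (simp add: grade_witness_def)
  have "length ` {xs. grade_witness R I xs} = {length xs}"
  proof (rule equalityI; rule subsetI)
    fix n assume "n \<in> length ` {xs. grade_witness R I xs}"
    then obtain ys where "n = length ys" "grade_witness R I ys" by auto
    then show "n \<in> {length xs}" using le[of ys xs] le[of xs ys] x by simp
  qed (use x in auto)
  then show ?thesis unfolding grade_def maximal_regular_sequence_iff[OF I ne]
    by (intro the_equality) auto
qed

lemma grade_witness_zero_ideal:
  assumes "\<one> \<noteq> \<zero>"
  shows "grade_witness R {\<zero>} []"
proof -
  have "Idl {\<zero>} = {\<zero>}" by (rule genideal_zero)
  then show ?thesis using assms unfolding grade_witness_def killed_mod_def by auto
qed

text \<open>A regular sequence in \<open>L\<close> that is shorter than both grades extends by a product of an element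
  of \<open>I\<close> and an element of \<open>J\<close>.\<close>

lemma grade_between_product_and_inter:
  assumes I: "ideal I R" "I \<noteq> carrier R" and J: "ideal J R" "J \<noteq> carrier R" and L: "ideal L R"
    and sub: "L \<subseteq> I" "L \<subseteq> J" and prod: "\<And>u v. u \<in> I \<Longrightarrow> v \<in> J \<Longrightarrow> u \<otimes> v \<in> L"
  shows "grade R L = min (grade R I) (grade R J)"
proof -
  have Lne: "L \<noteq> carrier R" using sub(1) ideal_subset[OF I(1)] I(2) by auto
  obtain zs where z: "grade_witness R L zs" by (rule exists_grade_witness[OF L Lne])
  obtain xs where x: "grade_witness R I xs" by (rule exists_grade_witness[OF I])
  obtain ys where y: "grade_witness R J ys" by (rule exists_grade_witness[OF J])
  have zL: "set zs \<subseteq> L" "regular_over R {\<zero>} zs" using z by (simp_all add: grade_witness_def)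
  have zI: "set zs \<subseteq> I" "set zs \<subseteq> J" using zL sub by auto
  have c: "set zs \<subseteq> carrier R" using zI ideal_subset[OF I(1)] by auto
  let ?Z = "Idl ({\<zero>} \<union> set zs)"
  have "length zs \<le> length xs" "length zs \<le> length ys"
    using grade_witness_length_le[OF I(1) x zI(1) zL(2)] grade_witness_length_le[OF J(1) y zI(2) zL(2)] .
  moreover have "length zs = length xs \<or> length zs = length ys"
  proof (rule ccontr)
    assume n: "\<not> ?thesis"
    \<comment> \<open>Otherwise \<open>zs\<close> would itself be a witness for \<open>I'\<close>,
      and its length would be the grade of \<open>I'\<close>.\<close>
    have nk: "\<not> killed_mod R I' ?Z"
      if I': "ideal I' R" "I' \<noteq> carrier R" "set zs \<subseteq> I'"
        and ws: "grade_witness R I' ws" "length ws \<noteq> length zs" for I' ws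
    proof
      assume "killed_mod R I' ?Z"
      then have "grade_witness R I' zs" using I'(3) zL(2) by (simp add: grade_witness_def)
      then show False using grade_eqI[OF I'(1,2)] ws by metis
    qed
    obtain u where u: "u \<in> I" "regular_over R {\<zero>} (zs @ [u])"
      using exists_regular_snoc[OF I(1) zeroideal zI(1) zL(2) nk[OF I zI(1) x]] n by auto
    obtain v where v: "v \<in> J" "regular_over R {\<zero>} (zs @ [v])"
      using exists_regular_snoc[OF J(1) zeroideal zI(2) zL(2) nk[OF J zI(2) y]] n by auto
    have uvc: "u \<in> carrier R" "v \<in> carrier R"
      using u(1) v(1) ideal.Icarr[OF I(1)] ideal.Icarr[OF J(1)] by auto
    have uv: "regular_mod R ?Z u" "regular_mod R ?Z v"
      using u(2) v(2) unfolding regular_over_snoc by auto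
    have "regular_mod R ?Z (u \<otimes> v)"
      unfolding regular_mod_def
    proof (intro ballI impI)
      fix r assume r: "r \<in> carrier R" "u \<otimes> v \<otimes> r \<in> ?Z"
      have "u \<otimes> (v \<otimes> r) \<in> ?Z" using r uvc by (simp add: m_assoc)
      then have "v \<otimes> r \<in> ?Z" by (rule regular_modD[OF uv(1)]) (use r uvc in simp)
      then show "r \<in> ?Z" by (rule regular_modD[OF uv(2)]) (rule r)
    qed
    then have "\<not> killed_mod R L ?Z" by (rule regular_mod_not_killed_mod[OF prod[OF u(1) v(1)]])
    then show False using z by (simp add: grade_witness_def)
  qed
  ultimately show ?thesis
    using grade_eqI[OF I x] grade_eqI[OF J y] grade_eqI[OF L Lne z] by auto
qed

end

section \<open>Linear functionals\<close>

definition subspace :: "('k, 'r) ring_scheme \<Rightarrow> ('k, 'a, 's) module_scheme \<Rightarrow> 'a set \<Rightarrow> bool" where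
  "subspace K V P \<longleftrightarrow> P \<subseteq> carrier V \<and> \<zero>\<^bsub>V\<^esub> \<in> P \<and> (\<forall>u \<in> P. \<forall>v \<in> P. u \<oplus>\<^bsub>V\<^esub> v \<in> P) \<and>
    (\<forall>c \<in> carrier K. \<forall>v \<in> P. c \<odot>\<^bsub>V\<^esub> v \<in> P)"

definition linear_functional ::
  "('k, 'r) ring_scheme \<Rightarrow> ('k, 'a, 's) module_scheme \<Rightarrow> ('a \<Rightarrow> 'k) \<Rightarrow> bool" where
  "linear_functional K V f \<longleftrightarrow> (\<forall>v \<in> carrier V. f v \<in> carrier K) \<and>
    (\<forall>u \<in> carrier V. \<forall>v \<in> carrier V. f (u \<oplus>\<^bsub>V\<^esub> v) = f u \<oplus>\<^bsub>K\<^esub> f v) \<and>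
    (\<forall>c \<in> carrier K. \<forall>v \<in> carrier V. f (c \<odot>\<^bsub>V\<^esub> v) = c \<otimes>\<^bsub>K\<^esub> f v)"

locale vector_space = K: field K + module K V
  for K :: "('k, 'r) ring_scheme" and V :: "('k, 'a, 's) module_scheme" (structure)
begin

lemma subspaceD:
  assumes "subspace K V P"
  shows "P \<subseteq> carrier V" "\<zero> \<in> P" "\<And>u v. u \<in> P \<Longrightarrow> v \<in> P \<Longrightarrow> u \<oplus> v \<in> P"
    "\<And>c v. c \<in> carrier K \<Longrightarrow> v \<in> P \<Longrightarrow> c \<odot> v \<in> P" "\<And>v. v \<in> P \<Longrightarrow> v \<in> carrier V"
  using assms by (auto simp: subspace_def)

lemma subspace_minus:
  assumes P: "subspace K V P" and v: "v \<in> P"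
  shows "\<ominus> v \<in> P"
proof -
  have vc: "v \<in> carrier V" using subspaceD(5)[OF P v] .
  have "(\<ominus>\<^bsub>K\<^esub> \<one>\<^bsub>K\<^esub>) \<odot> v = \<ominus> v" using smult_l_minus[of "\<one>\<^bsub>K\<^esub>" v] vc by simp
  then show ?thesis using subspaceD(4)[OF P _ v, of "\<ominus>\<^bsub>K\<^esub> \<one>\<^bsub>K\<^esub>"] by simp
qed

definition extend_by :: "'a set \<Rightarrow> 'a \<Rightarrow> 'a set" where
  "extend_by P b = {v \<oplus> c \<odot> b | v c. v \<in> P \<and> c \<in> carrier K}"

lemma extend_byI: "v \<in> P \<Longrightarrow> c \<in> carrier K \<Longrightarrow> v \<oplus> c \<odot> b \<in> extend_by P b"
  unfolding extend_by_def by blast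

lemma extend_byE:
  assumes "w \<in> extend_by P b"
  obtains v c where "v \<in> P" "c \<in> carrier K" "w = v \<oplus> c \<odot> b"
  using assms unfolding extend_by_def by blast

lemma extend_by_subspace:
  assumes P: "subspace K V P" and b: "b \<in> carrier V"
  shows "subspace K V (extend_by P b)"
  unfolding subspace_def
proof (intro conjI ballI subsetI)
  note D = subspaceD[OF P]
  show "w \<in> carrier V" if "w \<in> extend_by P b" for w
    using that b D(5) by (auto elim!: extend_byE)
  have "\<zero> \<oplus> \<zero>\<^bsub>K\<^esub> \<odot> b \<in> extend_by P b" by (rule extend_byI[OF D(2)]) simp
  then show "\<zero> \<in> extend_by P b" using b by simp
  show "u \<oplus> w \<in> extend_by P b" if uw: "u \<in> extend_by P b" "w \<in> extend_by P b" for u w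
  proof -
    obtain u' c where u: "u' \<in> P" "c \<in> carrier K" "u = u' \<oplus> c \<odot> b" using uw(1) by (rule extend_byE)
    obtain w' d where w: "w' \<in> P" "d \<in> carrier K" "w = w' \<oplus> d \<odot> b" using uw(2) by (rule extend_byE)
    have "u \<oplus> w = (u' \<oplus> w') \<oplus> (c \<oplus>\<^bsub>K\<^esub> d) \<odot> b"
      using u w b D(5) by (simp add: smult_l_distr M.a_ac)
    then show ?thesis using extend_byI[OF D(3)[OF u(1) w(1)], of "c \<oplus>\<^bsub>K\<^esub> d"] u(2) w(2) by simp
  qed
  show "d \<odot> u \<in> extend_by P b" if d: "d \<in> carrier K" and u0: "u \<in> extend_by P b" for d u
  proof -
    obtain u' c where u: "u' \<in> P" "c \<in> carrier K" "u = u' \<oplus> c \<odot> b" using u0 by (rule extend_byE)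
    have "d \<odot> u = d \<odot> u' \<oplus> (d \<otimes>\<^bsub>K\<^esub> c) \<odot> b"
      using u d b D(5) by (simp add: smult_r_distr smult_assoc1)
    then show ?thesis using extend_byI[OF D(4)[OF d u(1)], of "d \<otimes>\<^bsub>K\<^esub> c"] u(2) d by simp
  qed
qed

lemma extend_by_supset:
  assumes P: "subspace K V P" and b: "b \<in> carrier V"
  shows "P \<subseteq> extend_by P b" "b \<in> extend_by P b"
proof -
  note D = subspaceD[OF P]
  show "P \<subseteq> extend_by P b"
  proof
    fix v assume v: "v \<in> P"
    then show "v \<in> extend_by P b" using extend_byI[OF v K.zero_closed, of b] b D(5)[OF v] by simp
  qed
  show "b \<in> extend_by P b" using extend_byI[OF D(2) K.one_closed, of b] b by simp
qed

text \<open>The complement of the line through \<open>b\<close> is a subspace containing \<open>P\<close> and maximal with respect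
  to missing \<open>b\<close>.\<close>

lemma exists_functional:
  assumes P: "subspace K V P" and b: "b \<in> carrier V" "b \<notin> P"
  shows "\<exists>f. linear_functional K V f \<and> (\<forall>v \<in> P. f v = \<zero>\<^bsub>K\<^esub>) \<and> f b = \<one>\<^bsub>K\<^esub>"
proof -
  let ?S = "{N. subspace K V N \<and> P \<subseteq> N \<and> b \<notin> N}"
  have "\<exists>M \<in> ?S. \<forall>N \<in> ?S. M \<subseteq> N \<longrightarrow> N = M"
  proof (rule subset_Zorn)
    fix C assume C: "subset.chain ?S C"
    show "\<exists>U \<in> ?S. \<forall>N \<in> C. N \<subseteq> U"
    proof (cases "C = {}")
      case True
      then show ?thesis using P b by auto
    next
      case False
      then obtain N0 where N0: "N0 \<in> C" by auto
      have CS: "N \<in> ?S" if "N \<in> C" for N using C that by (auto simp: subset_chain_def)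
      have dir: "N \<subseteq> N' \<or> N' \<subseteq> N" if "N \<in> C" "N' \<in> C" for N N'
        using C that by (auto simp: subset_chain_def)
      have D: "subspace K V N" if "N \<in> C" for N using CS[OF that] by simp
      have "subspace K V (\<Union>C)"
        unfolding subspace_def
      proof (intro conjI ballI)
        show "\<Union>C \<subseteq> carrier V" using subspaceD(1)[OF D] by (rule Union_least)
        show "\<zero> \<in> \<Union>C" using subspaceD(2)[OF D[OF N0]] N0 by (rule UnionI[rotated])
        show "u \<oplus> v \<in> \<Union>C" if uv: "u \<in> \<Union>C" "v \<in> \<Union>C" for u v
        proof -
          obtain M N where MN: "M \<in> C" "u \<in> M" "N \<in> C" "v \<in> N" using uv by auto
          then obtain L where L: "L \<in> C" "u \<in> L" "v \<in> L" using dir[of M N] by auto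
          show ?thesis using subspaceD(3)[OF D[OF L(1)] L(2,3)] L(1) by (rule UnionI[rotated])
        qed
        show "c \<odot> v \<in> \<Union>C" if c: "c \<in> carrier K" and v: "v \<in> \<Union>C" for c v
        proof -
          obtain N where N: "N \<in> C" "v \<in> N" using v by auto
          show ?thesis using subspaceD(4)[OF D[OF N(1)] c N(2)] N(1) by (rule UnionI[rotated])
        qed
      qed
      moreover have "P \<subseteq> \<Union>C" using CS[OF N0] N0 by auto
      moreover have "b \<notin> \<Union>C" using CS by auto
      ultimately show ?thesis by (intro bexI[of _ "\<Union>C"]) auto
    qed
  qed
  then obtain N where N0: "N \<in> ?S" and max: "\<forall>M \<in> ?S. N \<subseteq> M \<longrightarrow> M = N" ..
  from N0 have N: "subspace K V N" "P \<subseteq> N" "b \<notin> N" by auto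
  note D = subspaceD[OF N(1)]
  \<comment> \<open>For \<open>v\<close> outside \<open>N\<close>, maximality forces
    \<open>b\<close> into the span of \<open>N\<close> and \<open>v\<close>. The coefficient of
    \<open>v\<close> is nonzero because \<open>b\<close> is not in \<open>N\<close>, so division in
    the field expresses \<open>v\<close> through \<open>b\<close>.\<close>
  have ex: "\<exists>c n. c \<in> carrier K \<and> n \<in> N \<and> v = n \<oplus> c \<odot> b" if v: "v \<in> carrier V" for v
  proof (cases "v \<in> N")
    case True
    then show ?thesis using v b by (intro exI[of _ "\<zero>\<^bsub>K\<^esub>"] exI[of _ v]) simp
  next
    case False
    have sup: "N \<subseteq> extend_by N v" "v \<in> extend_by N v" using extend_by_supset[OF N(1) v] .
    have "b \<in> extend_by N v"
    proof (rule ccontr)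
      assume "b \<notin> extend_by N v"
      then have "extend_by N v \<in> ?S" using extend_by_subspace[OF N(1) v] sup(1) N(2) by auto
      then have "extend_by N v = N" using max sup(1) by simp
      then show False using sup(2) False by simp
    qed
    then obtain n c where n: "n \<in> N" "c \<in> carrier K" "b = n \<oplus> c \<odot> v" by (rule extend_byE)
    have nc: "n \<in> carrier V" using D(5)[OF n(1)] .
    have "c \<noteq> \<zero>\<^bsub>K\<^esub>"
    proof
      assume "c = \<zero>\<^bsub>K\<^esub>"
      then have "b = n" using n(3) v nc by simp
      then show False using n(1) N(3) by simp
    qed
    then have i: "inv\<^bsub>K\<^esub> c \<in> carrier K" "inv\<^bsub>K\<^esub> c \<otimes>\<^bsub>K\<^esub> c = \<one>\<^bsub>K\<^esub>"
      using n(2) K.field_Units by auto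
    have "inv\<^bsub>K\<^esub> c \<odot> b = inv\<^bsub>K\<^esub> c \<odot> n \<oplus> v"
      unfolding n(3) using i n(2) nc v by (simp add: smult_r_distr flip: smult_assoc1)
    then have "v = \<ominus> (inv\<^bsub>K\<^esub> c \<odot> n) \<oplus> inv\<^bsub>K\<^esub> c \<odot> b" using i nc v by (simp add: M.r_neg1)
    moreover have "\<ominus> (inv\<^bsub>K\<^esub> c \<odot> n) \<in> N" by (rule subspace_minus[OF N(1) D(4)[OF i(1) n(1)]])
    ultimately show ?thesis using i(1) by blast
  qed
  \<comment> \<open>Dividing by the difference of two distinct coefficients would put
    \<open>b\<close> into \<open>N\<close>.\<close>
  have uniq: "c = d" if c: "c \<in> carrier K" "d \<in> carrier K" "m \<in> N" "n \<in> N" "m \<oplus> c \<odot> b = n \<oplus> d \<odot> b"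
    for c d m n
  proof (rule ccontr)
    assume ne: "c \<noteq> d"
    let ?e = "c \<ominus>\<^bsub>K\<^esub> d"
    have e: "?e \<in> carrier K" "?e \<noteq> \<zero>\<^bsub>K\<^esub>" using c ne by auto
    then have i: "inv\<^bsub>K\<^esub> ?e \<in> carrier K" "inv\<^bsub>K\<^esub> ?e \<otimes>\<^bsub>K\<^esub> ?e = \<one>\<^bsub>K\<^esub>"
      using K.field_Units by auto
    have mn: "m \<in> carrier V" "n \<in> carrier V" using c D(5) by auto
    have "?e \<odot> b = c \<odot> b \<oplus> \<ominus> (d \<odot> b)"
      using c(1,2) b by (simp add: a_minus_def smult_l_distr smult_l_minus)
    also have "c \<odot> b = \<ominus> m \<oplus> (n \<oplus> d \<odot> b)" using c(1,2) mn b by (simp add: M.r_neg1 flip: c(5))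
    also have "\<dots> \<oplus> \<ominus> (d \<odot> b) = \<ominus> m \<oplus> n" using c(1,2) mn b by (simp add: M.a_assoc M.r_neg)
    finally have eb: "?e \<odot> b = \<ominus> m \<oplus> n" .
    have "\<ominus> m \<oplus> n \<in> N" by (rule D(3)[OF subspace_minus[OF N(1) c(3)] c(4)])
    then have "inv\<^bsub>K\<^esub> ?e \<odot> (?e \<odot> b) \<in> N" unfolding eb by (rule D(4)[OF i(1)])
    then show False using e i b(1) N(3) by (simp flip: smult_assoc1)
  qed
  \<comment> \<open>The coordinate along \<open>b\<close> in the decomposition of the space into
    \<open>N\<close> and the line through \<open>b\<close>.\<close>
  define f where "f v = (THE c. c \<in> carrier K \<and> (\<exists>n \<in> N. v = n \<oplus> c \<odot> b))" for v
  have f: "f v = c" if "c \<in> carrier K" "n \<in> N" "v = n \<oplus> c \<odot> b" for v c n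
    unfolding f_def
  proof (rule the_equality)
    show "c \<in> carrier K \<and> (\<exists>n \<in> N. v = n \<oplus> c \<odot> b)" using that by auto
    show "d = c" if "d \<in> carrier K \<and> (\<exists>n \<in> N. v = n \<oplus> d \<odot> b)" for d
      using that uniq[of d c _ n] \<open>c \<in> carrier K\<close> \<open>n \<in> N\<close> \<open>v = n \<oplus> c \<odot> b\<close> by metis
  qed
  have "linear_functional K V f"
    unfolding linear_functional_def
  proof (intro conjI ballI)
    fix v assume v: "v \<in> carrier V"
    obtain c n where c: "c \<in> carrier K" "n \<in> N" "v = n \<oplus> c \<odot> b" using ex[OF v] by auto
    show "f v \<in> carrier K" using f[OF c] c(1) by simp
    show "f (d \<odot> v) = d \<otimes>\<^bsub>K\<^esub> f v" if d: "d \<in> carrier K" for d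
    proof -
      have "d \<odot> v = d \<odot> n \<oplus> (d \<otimes>\<^bsub>K\<^esub> c) \<odot> b"
        unfolding c(3) using c(1) d b D(5)[OF c(2)] by (simp add: smult_r_distr smult_assoc1)
      from f[OF _ D(4)[OF d c(2)] this] show ?thesis using f[OF c] c(1) d by simp
    qed
    show "f (v \<oplus> w) = f v \<oplus>\<^bsub>K\<^esub> f w" if w0: "w \<in> carrier V" for w
    proof -
      obtain d m where d: "d \<in> carrier K" "m \<in> N" "w = m \<oplus> d \<odot> b" using ex[OF w0] by auto
      have "v \<oplus> w = (n \<oplus> m) \<oplus> (c \<oplus>\<^bsub>K\<^esub> d) \<odot> b"
        unfolding c(3) d(3) using c(1) d(1) b D(5)[OF c(2)] D(5)[OF d(2)]
        by (simp add: smult_l_distr M.a_ac)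
      from f[OF _ D(3)[OF c(2) d(2)] this] show ?thesis using f[OF c] f[OF d] c(1) d(1) by simp
    qed
  qed
  moreover have "f v = \<zero>\<^bsub>K\<^esub>" if "v \<in> P" for v
    by (rule f[of _ v]) (use that N(2) b D(5) in auto)
  moreover have "f b = \<one>\<^bsub>K\<^esub>" by (rule f[OF _ D(2)]) (use b in auto)
  ultimately show ?thesis by blast
qed

end

section \<open>Additive subgroups generated by a set\<close>

lemma (in abelian_group) add_subgroupI:
  assumes "S \<subseteq> carrier G" "\<zero> \<in> S" "\<And>u v. u \<in> S \<Longrightarrow> v \<in> S \<Longrightarrow> u \<oplus> v \<in> S"
    and "\<And>v. v \<in> S \<Longrightarrow> \<ominus> v \<in> S"
  shows "subgroup S (add_monoid G)"
  by (rule add.subgroupI) (use assms in \<open>auto simp flip: a_inv_def\<close>)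

lemma (in abelian_group) add_generate_least:
  assumes "S \<subseteq> H" "H \<subseteq> carrier G" "\<zero> \<in> H" "\<And>u v. u \<in> H \<Longrightarrow> v \<in> H \<Longrightarrow> u \<oplus> v \<in> H"
    and "\<And>v. v \<in> H \<Longrightarrow> \<ominus> v \<in> H"
  shows "generate (add_monoid G) S \<subseteq> H"
  by (rule add.generate_subgroup_incl[OF assms(1)]) (use assms in \<open>intro add_subgroupI\<close>)

lemma (in abelian_group) add_generateD:
  assumes "S \<subseteq> carrier G"
  shows "generate (add_monoid G) S \<subseteq> carrier G" "S \<subseteq> generate (add_monoid G) S"
    "\<zero> \<in> generate (add_monoid G) S"
    "\<And>u v. u \<in> generate (add_monoid G) S \<Longrightarrow> v \<in> generate (add_monoid G) S
       \<Longrightarrow> u \<oplus> v \<in> generate (add_monoid G) S"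
    "\<And>v. v \<in> generate (add_monoid G) S \<Longrightarrow> \<ominus> v \<in> generate (add_monoid G) S"
proof -
  have s: "subgroup (generate (add_monoid G) S) (add_monoid G)"
    by (rule add.generate_is_subgroup) (use assms in simp)
  show "generate (add_monoid G) S \<subseteq> carrier G" using subgroup.subset[OF s] by simp
  show "S \<subseteq> generate (add_monoid G) S" by (simp add: subsetI generate.incl)
  show "\<zero> \<in> generate (add_monoid G) S" using subgroup.one_closed[OF s] by simp
  show "u \<oplus> v \<in> generate (add_monoid G) S"
    if "u \<in> generate (add_monoid G) S" "v \<in> generate (add_monoid G) S" for u v
    using subgroup.m_closed[OF s that] by simp
  show "\<ominus> v \<in> generate (add_monoid G) S" if "v \<in> generate (add_monoid G) S" for v
    using subgroup.m_inv_closed[OF s that] by (simp add: a_inv_def)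
qed

section \<open>Tensor products of algebras over a field\<close>

text \<open>The map id \<otimes> f into A \<otimes> K, identified with \<open>A\<close>. When
  \<open>T\<close> is additively spanned by pure tensors, additivity and the values on these
  determine it.\<close>

definition slice_map ::
  "('k, 'a, 's) module_scheme \<Rightarrow> ('k, 'b, 't) module_scheme \<Rightarrow> ('c, 'u) ring_scheme
    \<Rightarrow> ('a \<Rightarrow> 'b \<Rightarrow> 'c) \<Rightarrow> ('b \<Rightarrow> 'k) \<Rightarrow> ('c \<Rightarrow> 'a) \<Rightarrow> bool" where
  "slice_map A B T p f g \<longleftrightarrow> (\<forall>t \<in> carrier T. g t \<in> carrier A) \<and>
    (\<forall>s \<in> carrier T. \<forall>t \<in> carrier T. g (s \<oplus>\<^bsub>T\<^esub> t) = g s \<oplus>\<^bsub>A\<^esub> g t) \<and>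
    (\<forall>a \<in> carrier A. \<forall>b \<in> carrier B. g (p a b) = f b \<odot>\<^bsub>A\<^esub> a)"

definition tensor_span ::
  "('c, 'u) ring_scheme \<Rightarrow> ('a \<Rightarrow> 'b \<Rightarrow> 'c) \<Rightarrow> 'a set \<Rightarrow> 'b set \<Rightarrow> 'c set" where
  "tensor_span T p S U = generate (add_monoid T) {p a b | a b. a \<in> S \<and> b \<in> U}"

text \<open>The ideal $Q \otimes B + A \otimes P$, written so that it also makes sense for subspaces.\<close>

definition mixed_span ::
  "('k, 'a, 's) module_scheme \<Rightarrow> ('k, 'b, 't) module_scheme \<Rightarrow> ('c, 'u) ring_scheme
    \<Rightarrow> ('a \<Rightarrow> 'b \<Rightarrow> 'c) \<Rightarrow> 'a set \<Rightarrow> 'b set \<Rightarrow> 'c set" where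
  "mixed_span A B T p Q P = generate (add_monoid T)
    {p a b | a b. a \<in> carrier A \<and> b \<in> carrier B \<and> (a \<in> Q \<or> b \<in> P)}"

text \<open>The existence of slices takes the place of the universal property: it provides enough
  maps out of \<open>T\<close> to show that elements are not in an ideal. Both sides are listed so
  that the conditions survive an exchange of the factors.\<close>

locale tensor_product =
  K: field K + A: algebra K A + B: algebra K B + T: cring T
  for K :: "('k, 'r) ring_scheme" and A :: "('k, 'a, 's) module_scheme"
    and B :: "('k, 'b, 't) module_scheme" and T :: "('c, 'u) ring_scheme" +
  fixes p :: "'a \<Rightarrow> 'b \<Rightarrow> 'c"
  assumes p_closed: "a \<in> carrier A \<Longrightarrow> b \<in> carrier B \<Longrightarrow> p a b \<in> carrier T"
    and p_add_l: "a \<in> carrier A \<Longrightarrow> a' \<in> carrier A \<Longrightarrow> b \<in> carrier B \<Longrightarrow>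
      p (a \<oplus>\<^bsub>A\<^esub> a') b = p a b \<oplus>\<^bsub>T\<^esub> p a' b"
    and p_add_r: "a \<in> carrier A \<Longrightarrow> b \<in> carrier B \<Longrightarrow> b' \<in> carrier B \<Longrightarrow>
      p a (b \<oplus>\<^bsub>B\<^esub> b') = p a b \<oplus>\<^bsub>T\<^esub> p a b'"
    and p_balanced: "c \<in> carrier K \<Longrightarrow> a \<in> carrier A \<Longrightarrow> b \<in> carrier B \<Longrightarrow>
      p (c \<odot>\<^bsub>A\<^esub> a) b = p a (c \<odot>\<^bsub>B\<^esub> b)"
    and p_mult: "a \<in> carrier A \<Longrightarrow> b \<in> carrier B \<Longrightarrow> a' \<in> carrier A \<Longrightarrow> b' \<in> carrier B \<Longrightarrow>
      p a b \<otimes>\<^bsub>T\<^esub> p a' b' = p (a \<otimes>\<^bsub>A\<^esub> a') (b \<otimes>\<^bsub>B\<^esub> b')"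
    and p_one: "p \<one>\<^bsub>A\<^esub> \<one>\<^bsub>B\<^esub> = \<one>\<^bsub>T\<^esub>"
    and spanned: "carrier T = tensor_span T p (carrier A) (carrier B)"
    and slice_l: "linear_functional K B f \<Longrightarrow> \<exists>g. slice_map A B T p f g"
    and slice_r: "linear_functional K A h \<Longrightarrow> \<exists>g. slice_map B A T (\<lambda>b a. p a b) h g"
    and A_nontrivial: "\<one>\<^bsub>A\<^esub> \<noteq> \<zero>\<^bsub>A\<^esub>" and B_nontrivial: "\<one>\<^bsub>B\<^esub> \<noteq> \<zero>\<^bsub>B\<^esub>"

sublocale tensor_product \<subseteq> A: vector_space K A
  by (intro vector_space.intro K.field_axioms A.module)
sublocale tensor_product \<subseteq> B: vector_space K B
  by (intro vector_space.intro K.field_axioms B.module)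

context tensor_product
begin

text \<open>The source of every statement about the right factor: it is the corresponding statement
  about the left factor in this interpretation.\<close>

lemma swapped: "tensor_product K B A T (\<lambda>b a. p a b)"
proof (intro tensor_product.intro K.field_axioms A.algebra_axioms B.algebra_axioms T.cring_axioms
    tensor_product_axioms.intro)
  have "{p a b | a b. a \<in> carrier A \<and> b \<in> carrier B} = {p b a | a b. a \<in> carrier B \<and> b \<in> carrier A}"
    by auto
  then show "carrier T = tensor_span T (\<lambda>b a. p a b) (carrier B) (carrier A)"
    using spanned by (simp add: tensor_span_def)
qed (use p_closed p_add_l p_add_r p_balanced p_mult p_one slice_l slice_r A_nontrivial B_nontrivial
  in \<open>simp_all\<close>)

lemma mixed_span_swapped:
  "mixed_span B A T (\<lambda>b a. p a b) P Q = mixed_span A B T p Q P"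
proof -
  have "{p b a | a b. a \<in> carrier B \<and> b \<in> carrier A \<and> (a \<in> P \<or> b \<in> Q)} =
    {p a b | a b. a \<in> carrier A \<and> b \<in> carrier B \<and> (a \<in> Q \<or> b \<in> P)}" by auto
  then show ?thesis by (simp add: mixed_span_def)
qed

abbreviation W :: "'a set \<Rightarrow> 'b set \<Rightarrow> 'c set" where
  "W Q P \<equiv> mixed_span A B T p Q P"

lemma p_zero_l: "b \<in> carrier B \<Longrightarrow> p \<zero>\<^bsub>A\<^esub> b = \<zero>\<^bsub>T\<^esub>"
  using p_add_l[of "\<zero>\<^bsub>A\<^esub>" "\<zero>\<^bsub>A\<^esub>" b] p_closed[of "\<zero>\<^bsub>A\<^esub>" b] by (simp add: T.add.r_cancel_one')

lemma p_zero_r: "a \<in> carrier A \<Longrightarrow> p a \<zero>\<^bsub>B\<^esub> = \<zero>\<^bsub>T\<^esub>"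
  using p_add_r[of a "\<zero>\<^bsub>B\<^esub>" "\<zero>\<^bsub>B\<^esub>"] p_closed[of a "\<zero>\<^bsub>B\<^esub>"] by (simp add: T.add.r_cancel_one')

lemma p_minus_l:
  assumes "a \<in> carrier A" "b \<in> carrier B"
  shows "\<ominus>\<^bsub>T\<^esub> p a b = p (\<ominus>\<^bsub>A\<^esub> a) b"
proof (rule T.minus_equality)
  have "p (\<ominus>\<^bsub>A\<^esub> a) b \<oplus>\<^bsub>T\<^esub> p a b = p (\<ominus>\<^bsub>A\<^esub> a \<oplus>\<^bsub>A\<^esub> a) b"
    using assms by (simp add: p_add_l)
  also have "\<dots> = \<zero>\<^bsub>T\<^esub>" using assms by (simp add: A.M.l_neg p_zero_l)
  finally show "p (\<ominus>\<^bsub>A\<^esub> a) b \<oplus>\<^bsub>T\<^esub> p a b = \<zero>\<^bsub>T\<^esub>" .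
qed (use assms p_closed in auto)

text \<open>Formal sums are lists because a pair may occur repeatedly and because the membership
  criterion is proved by removing one pure tensor at a time.\<close>

fun tsum :: "('a \<times> 'b) list \<Rightarrow> 'c" where
  "tsum [] = \<zero>\<^bsub>T\<^esub>"
| "tsum ((a, b) # xs) = p a b \<oplus>\<^bsub>T\<^esub> tsum xs"

lemma tsum_closed: "set xs \<subseteq> carrier A \<times> carrier B \<Longrightarrow> tsum xs \<in> carrier T"
  by (induction xs rule: tsum.induct) (auto simp: p_closed)

lemma tsum_append:
  "set xs \<subseteq> carrier A \<times> carrier B \<Longrightarrow> set ys \<subseteq> carrier A \<times> carrier B \<Longrightarrow>
    tsum (xs @ ys) = tsum xs \<oplus>\<^bsub>T\<^esub> tsum ys"
  by (induction xs rule: tsum.induct) (auto simp: p_closed tsum_closed T.a_assoc)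

lemma tsum_minus:
  "set xs \<subseteq> carrier A \<times> carrier B \<Longrightarrow> \<ominus>\<^bsub>T\<^esub> tsum xs = tsum (map (\<lambda>(a, b). (\<ominus>\<^bsub>A\<^esub> a, b)) xs)"
  by (induction xs rule: tsum.induct) (auto simp: p_closed tsum_closed T.minus_add p_minus_l)

text \<open>Signs are absorbed into the left factors, which is why only \<open>S\<close> has to be
  closed under negation.\<close>

lemma span_tsum:
  assumes S: "S \<subseteq> carrier A" and U: "U \<subseteq> carrier B" and m: "\<And>a. a \<in> S \<Longrightarrow> \<ominus>\<^bsub>A\<^esub> a \<in> S"
  shows "tensor_span T p S U \<subseteq> {tsum xs | xs. set xs \<subseteq> S \<times> U}"
  unfolding tensor_span_def
proof (rule T.add_generate_least)
  have c: "set xs \<subseteq> carrier A \<times> carrier B" if "set xs \<subseteq> S \<times> U" for xs using that S U by auto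
  show "{p a b |a b. a \<in> S \<and> b \<in> U} \<subseteq> {tsum xs | xs. set xs \<subseteq> S \<times> U}"
  proof
    fix t assume "t \<in> {p a b |a b. a \<in> S \<and> b \<in> U}"
    then obtain a b where "a \<in> S" "b \<in> U" "t = p a b" by auto
    then show "t \<in> {tsum xs | xs. set xs \<subseteq> S \<times> U}"
      using p_closed[of a b] S U by (intro CollectI exI[of _ "[(a, b)]"]) (simp add: subset_iff)
  qed
  show "{tsum xs | xs. set xs \<subseteq> S \<times> U} \<subseteq> carrier T" using tsum_closed[OF c] by auto
  show "\<zero>\<^bsub>T\<^esub> \<in> {tsum xs | xs. set xs \<subseteq> S \<times> U}" by (intro CollectI exI[of _ "[]"]) simp
  show "u \<oplus>\<^bsub>T\<^esub> v \<in> {tsum xs | xs. set xs \<subseteq> S \<times> U}"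
    if uv: "u \<in> {tsum xs | xs. set xs \<subseteq> S \<times> U}" "v \<in> {tsum xs | xs. set xs \<subseteq> S \<times> U}" for u v
  proof -
    obtain xs ys where "u = tsum xs" "set xs \<subseteq> S \<times> U" "v = tsum ys" "set ys \<subseteq> S \<times> U"
      using uv by auto
    then show ?thesis using tsum_append[OF c c] by (intro CollectI exI[of _ "xs @ ys"]) auto
  qed
  show "\<ominus>\<^bsub>T\<^esub> v \<in> {tsum xs | xs. set xs \<subseteq> S \<times> U}"
    if v: "v \<in> {tsum xs | xs. set xs \<subseteq> S \<times> U}" for v
  proof -
    obtain xs where "v = tsum xs" "set xs \<subseteq> S \<times> U" using v by auto
    then show ?thesis using tsum_minus[OF c, of xs] m
      by (intro CollectI exI[of _ "map (\<lambda>(a, b). (\<ominus>\<^bsub>A\<^esub> a, b)) xs"]) auto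
  qed
qed

lemma carrier_tsum:
  assumes "t \<in> carrier T"
  obtains xs where "set xs \<subseteq> carrier A \<times> carrier B" "t = tsum xs"
  using span_tsum[of "carrier A" "carrier B"] assms spanned by auto

lemma mixed_gens: "{p a b | a b. a \<in> carrier A \<and> b \<in> carrier B \<and> (a \<in> Q \<or> b \<in> P)} \<subseteq> carrier T"
  using p_closed by auto

lemmas W_rules = T.add_generateD[OF mixed_gens, folded mixed_span_def]

lemma W_gen: "a \<in> carrier A \<Longrightarrow> b \<in> carrier B \<Longrightarrow> a \<in> Q \<or> b \<in> P \<Longrightarrow> p a b \<in> W Q P"
  by (rule subsetD[OF W_rules(2)]) auto

lemma W_least:
  assumes "\<And>a b. a \<in> carrier A \<Longrightarrow> b \<in> carrier B \<Longrightarrow> a \<in> Q \<or> b \<in> P \<Longrightarrow> p a b \<in> H"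
    and "H \<subseteq> carrier T" "\<zero>\<^bsub>T\<^esub> \<in> H" "\<And>u v. u \<in> H \<Longrightarrow> v \<in> H \<Longrightarrow> u \<oplus>\<^bsub>T\<^esub> v \<in> H"
    and "\<And>v. v \<in> H \<Longrightarrow> \<ominus>\<^bsub>T\<^esub> v \<in> H"
  shows "W Q P \<subseteq> H"
  unfolding mixed_span_def by (rule T.add_generate_least) (use assms in auto)

lemma W_mono:
  assumes "Q \<subseteq> Q'" "P \<subseteq> P'"
  shows "W Q P \<subseteq> W Q' P'"
  by (rule W_least[OF W_gen W_rules(1) W_rules(3-5)]) (use assms in auto)

section \<open>Slices and membership in the mixed span\<close>

lemma slice_mapD:
  assumes "slice_map A B T p f g"
  shows "t \<in> carrier T \<Longrightarrow> g t \<in> carrier A"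
    "s \<in> carrier T \<Longrightarrow> t \<in> carrier T \<Longrightarrow> g (s \<oplus>\<^bsub>T\<^esub> t) = g s \<oplus>\<^bsub>A\<^esub> g t"
    "a \<in> carrier A \<Longrightarrow> b \<in> carrier B \<Longrightarrow> g (p a b) = f b \<odot>\<^bsub>A\<^esub> a"
  using assms by (auto simp: slice_map_def)

lemma slice_map_zero:
  assumes "slice_map A B T p f g"
  shows "g \<zero>\<^bsub>T\<^esub> = \<zero>\<^bsub>A\<^esub>"
  using slice_mapD(2)[OF assms, of "\<zero>\<^bsub>T\<^esub>" "\<zero>\<^bsub>T\<^esub>"] slice_mapD(1)[OF assms, of "\<zero>\<^bsub>T\<^esub>"]
  by (simp add: A.M.add.r_cancel_one')

lemma slice_map_minus:
  assumes g: "slice_map A B T p f g" and t: "t \<in> carrier T"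
  shows "g (\<ominus>\<^bsub>T\<^esub> t) = \<ominus>\<^bsub>A\<^esub> g t"
proof (rule A.M.minus_equality[symmetric])
  have "g (\<ominus>\<^bsub>T\<^esub> t) \<oplus>\<^bsub>A\<^esub> g t = g (\<ominus>\<^bsub>T\<^esub> t \<oplus>\<^bsub>T\<^esub> t)"
    using t by (simp add: slice_mapD(2)[OF g])
  then show "g (\<ominus>\<^bsub>T\<^esub> t) \<oplus>\<^bsub>A\<^esub> g t = \<zero>\<^bsub>A\<^esub>" using t by (simp add: T.l_neg slice_map_zero[OF g])
qed (use slice_mapD(1)[OF g] t in auto)

text \<open>Slices are \<open>A\<close>-linear, since on pure tensors \<open>f b\<close> is a scalar
  and commutes with \<open>x\<close>. This is what transports regularity from \<open>A\<close> to
  \<open>T\<close>.\<close>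

lemma slice_map_scale:
  assumes g: "slice_map A B T p f g" and f: "linear_functional K B f"
    and x: "x \<in> carrier A" and t: "t \<in> carrier T"
  shows "g (p x \<one>\<^bsub>B\<^esub> \<otimes>\<^bsub>T\<^esub> t) = x \<otimes>\<^bsub>A\<^esub> g t"
proof -
  have px: "p x \<one>\<^bsub>B\<^esub> \<in> carrier T" using x p_closed by simp
  have "g (p x \<one>\<^bsub>B\<^esub> \<otimes>\<^bsub>T\<^esub> tsum xs) = x \<otimes>\<^bsub>A\<^esub> g (tsum xs)"
    if "set xs \<subseteq> carrier A \<times> carrier B" for xs
    using that
  proof (induction xs rule: tsum.induct)
    case 1
    then show ?case using px x by (simp add: slice_map_zero[OF g])
  next
    case (2 a b xs)
    then have c: "a \<in> carrier A" "b \<in> carrier B" "set xs \<subseteq> carrier A \<times> carrier B" by auto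
    have fb: "f b \<in> carrier K" using f c by (simp add: linear_functional_def)
    have "g (p x \<one>\<^bsub>B\<^esub> \<otimes>\<^bsub>T\<^esub> tsum ((a, b) # xs)) =
      g (p x \<one>\<^bsub>B\<^esub> \<otimes>\<^bsub>T\<^esub> p a b) \<oplus>\<^bsub>A\<^esub> g (p x \<one>\<^bsub>B\<^esub> \<otimes>\<^bsub>T\<^esub> tsum xs)"
      using c px tsum_closed p_closed by (simp add: T.r_distr slice_mapD(2)[OF g])
    also have "g (p x \<one>\<^bsub>B\<^esub> \<otimes>\<^bsub>T\<^esub> p a b) = x \<otimes>\<^bsub>A\<^esub> g (p a b)"
      using c x fb by (simp add: p_mult slice_mapD(3)[OF g] A.smult_assoc2 A.m_comm[of x])
    also have "g (p x \<one>\<^bsub>B\<^esub> \<otimes>\<^bsub>T\<^esub> tsum xs) = x \<otimes>\<^bsub>A\<^esub> g (tsum xs)" using 2 c by simp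
    also have "x \<otimes>\<^bsub>A\<^esub> g (p a b) \<oplus>\<^bsub>A\<^esub> x \<otimes>\<^bsub>A\<^esub> g (tsum xs) = x \<otimes>\<^bsub>A\<^esub> g (tsum ((a, b) # xs))"
      using c x slice_mapD(1,2)[OF g] tsum_closed p_closed by (simp add: A.r_distr)
    finally show ?case .
  qed
  then show ?thesis using carrier_tsum[OF t] by metis
qed

text \<open>The easy half of the membership criterion, checked on generators: either
  \<open>a\<close> is in \<open>Q\<close>, or \<open>f b\<close> vanishes.\<close>

lemma slice_map_W:
  assumes g: "slice_map A B T p f g" and f: "linear_functional K B f"
    and P0: "\<And>v. v \<in> P \<Longrightarrow> f v = \<zero>\<^bsub>K\<^esub>" and Q: "subspace K A Q" and w: "w \<in> W Q P"
  shows "g w \<in> Q"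
proof -
  note D = A.subspaceD[OF Q]
  have "W Q P \<subseteq> {w \<in> carrier T. g w \<in> Q}"
  proof (rule W_least)
    fix a b assume c: "a \<in> carrier A" "b \<in> carrier B" "a \<in> Q \<or> b \<in> P"
    have fb: "f b \<in> carrier K" using f c by (simp add: linear_functional_def)
    have "f b \<odot>\<^bsub>A\<^esub> a \<in> Q" using c(3)
    proof
      assume "a \<in> Q" then show ?thesis using D(4) fb by simp
    next
      assume "b \<in> P" then show ?thesis using P0 c(1) D(2) by simp
    qed
    then show "p a b \<in> {w \<in> carrier T. g w \<in> Q}" using c p_closed slice_mapD(3)[OF g] by simp
  qed (use D A.subspace_minus[OF Q] in
      \<open>auto simp: slice_map_zero[OF g] slice_mapD(2)[OF g] slice_map_minus[OF g]\<close>)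
  then show ?thesis using w by auto
qed

text \<open>Enlarging \<open>P\<close> by the line through \<open>b\<close> adds only A \<otimes> b:
  scalars move to the left factor, and sums of tensors with the same right factor \<open>b\<close>
  combine into one.\<close>

lemma W_extend_by:
  assumes P: "subspace K B P" and b: "b \<in> carrier B" and w: "w \<in> W Q (B.extend_by P b)"
  shows "\<exists>a \<in> carrier A. \<exists>u \<in> W Q P. w = u \<oplus>\<^bsub>T\<^esub> p a b"
proof -
  let ?H = "{u \<oplus>\<^bsub>T\<^esub> p a b | u a. a \<in> carrier A \<and> u \<in> W Q P}"
  have Wc: "u \<in> carrier T" if "u \<in> W Q P" for u using that W_rules(1) by auto
  have "W Q (B.extend_by P b) \<subseteq> ?H"
  proof (rule W_least)
    fix x y assume c: "x \<in> carrier A" "y \<in> carrier B" "x \<in> Q \<or> y \<in> B.extend_by P b"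
    show "p x y \<in> ?H" using c(3)
    proof
      assume "x \<in> Q"
      then have "p x y \<in> W Q P" using W_gen c by simp
      then show ?thesis using p_zero_l[OF b] p_closed[OF c(1,2)]
        by (intro CollectI exI[of _ "p x y"] exI[of _ "\<zero>\<^bsub>A\<^esub>"]) simp
    next
      assume "y \<in> B.extend_by P b"
      then obtain v d where v: "v \<in> P" "d \<in> carrier K" "y = v \<oplus>\<^bsub>B\<^esub> d \<odot>\<^bsub>B\<^esub> b"
        by (rule B.extend_byE)
      have vc: "v \<in> carrier B" using B.subspaceD(5)[OF P v(1)] .
      have "p x y = p x v \<oplus>\<^bsub>T\<^esub> p (d \<odot>\<^bsub>A\<^esub> x) b"
        unfolding v(3) using c(1) vc v(2) b by (simp add: p_add_r p_balanced)
      then show ?thesis using W_gen[of x v Q P] c(1) vc v(1,2)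
        by (intro CollectI exI[of _ "p x v"] exI[of _ "d \<odot>\<^bsub>A\<^esub> x"]) simp
    qed
  next
    show "?H \<subseteq> carrier T" using Wc p_closed b by auto
    show "\<zero>\<^bsub>T\<^esub> \<in> ?H" using p_zero_l[OF b] W_rules(3)
      by (intro CollectI exI[of _ "\<zero>\<^bsub>T\<^esub>"] exI[of _ "\<zero>\<^bsub>A\<^esub>"]) simp
  next
    fix s t assume "s \<in> ?H" "t \<in> ?H"
    then obtain u a v d where s: "s = u \<oplus>\<^bsub>T\<^esub> p a b" "a \<in> carrier A" "u \<in> W Q P"
      and t: "t = v \<oplus>\<^bsub>T\<^esub> p d b" "d \<in> carrier A" "v \<in> W Q P" by auto
    have "s \<oplus>\<^bsub>T\<^esub> t = (u \<oplus>\<^bsub>T\<^esub> v) \<oplus>\<^bsub>T\<^esub> p (a \<oplus>\<^bsub>A\<^esub> d) b"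
      unfolding s(1) t(1) using s(2,3) t(2,3) b Wc p_closed by (simp add: p_add_l T.a_ac)
    then show "s \<oplus>\<^bsub>T\<^esub> t \<in> ?H" using W_rules(4)[OF s(3) t(3)] s(2) t(2)
      by (intro CollectI exI[of _ "u \<oplus>\<^bsub>T\<^esub> v"] exI[of _ "a \<oplus>\<^bsub>A\<^esub> d"]) simp
  next
    fix s assume "s \<in> ?H"
    then obtain u a where s: "s = u \<oplus>\<^bsub>T\<^esub> p a b" "a \<in> carrier A" "u \<in> W Q P" by auto
    have "\<ominus>\<^bsub>T\<^esub> s = (\<ominus>\<^bsub>T\<^esub> u) \<oplus>\<^bsub>T\<^esub> p (\<ominus>\<^bsub>A\<^esub> a) b"
      unfolding s(1) using s(2,3) b Wc p_closed by (simp add: T.minus_add flip: p_minus_l)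
    then show "\<ominus>\<^bsub>T\<^esub> s \<in> ?H" using W_rules(5)[OF s(3)] s(2)
      by (intro CollectI exI[of _ "\<ominus>\<^bsub>T\<^esub> u"] exI[of _ "\<ominus>\<^bsub>A\<^esub> a"]) simp
  qed
  then have "w \<in> ?H" using w by (rule subsetD)
  then show ?thesis by blast
qed

text \<open>Induction on the number of pure tensors, adjoining the second factor of the first one to
  \<open>P\<close>. This avoids choosing a basis.\<close>

lemma tsum_mem_W:
  assumes "set xs \<subseteq> carrier A \<times> carrier B" and Q: "subspace K A Q" and "subspace K B P"
    and "\<And>f g. linear_functional K B f \<Longrightarrow> (\<And>v. v \<in> P \<Longrightarrow> f v = \<zero>\<^bsub>K\<^esub>) \<Longrightarrow>
      slice_map A B T p f g \<Longrightarrow> g (tsum xs) \<in> Q"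
  shows "tsum xs \<in> W Q P"
  using assms(1,3,4)
proof (induction xs arbitrary: P rule: tsum.induct)
  case 1
  then show ?case using W_rules(3) by simp
next
  case (2 a b xs)
  note P = \<open>subspace K B P\<close>
  note QD = A.subspaceD[OF Q]
  have c: "a \<in> carrier A" "b \<in> carrier B" "set xs \<subseteq> carrier A \<times> carrier B" using 2 by auto
  note cl = p_closed[OF c(1,2)] tsum_closed[OF c(3)]
  \<comment> \<open>A functional vanishing on the enlarged subspace vanishes at \<open>b\<close>, so
    the first tensor is invisible to its slice and the hypothesis passes to
    \<open>xs\<close>.\<close>
  have "tsum xs \<in> W Q (B.extend_by P b)"
  proof (rule "2.IH"[OF c(3) B.extend_by_subspace[OF P c(2)]])
    fix f g assume f: "linear_functional K B f" "\<And>v. v \<in> B.extend_by P b \<Longrightarrow> f v = \<zero>\<^bsub>K\<^esub>"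
      and g: "slice_map A B T p f g"
    have "g (tsum ((a, b) # xs)) \<in> Q"
      by (rule "2.prems"(3)[OF f(1) f(2) g]) (use B.extend_by_supset(1)[OF P c(2)] in auto)
    moreover have "g (tsum ((a, b) # xs)) = g (tsum xs)"
      using cl slice_mapD[OF g] c f(2)[OF B.extend_by_supset(2)[OF P c(2)]] by simp
    ultimately show "g (tsum xs) \<in> Q" by simp
  qed
  from W_extend_by[OF P c(2) this] obtain d u where
    u: "d \<in> carrier A" "u \<in> W Q P" "tsum xs = u \<oplus>\<^bsub>T\<^esub> p d b" by auto
  have uc: "u \<in> carrier T" using u(2) W_rules(1) by auto
  \<comment> \<open>The remainder supplied by the enlarged subspace merges with the removed tensor;
    only one tensor over \<open>b\<close> is left to be placed in \<open>W Q P\<close>.\<close>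
  have eq: "tsum ((a, b) # xs) = u \<oplus>\<^bsub>T\<^esub> p (a \<oplus>\<^bsub>A\<^esub> d) b"
    using u(1,3) uc c p_closed by (simp add: p_add_l T.a_ac)
  have ad: "a \<oplus>\<^bsub>A\<^esub> d \<in> carrier A" using c u by simp
  have "p (a \<oplus>\<^bsub>A\<^esub> d) b \<in> W Q P"
  proof (cases "b \<in> P")
    case True
    then show ?thesis using W_gen ad c by simp
  next
    case False
    \<comment> \<open>With \<open>f b = 1\<close> and \<open>f\<close> zero on \<open>P\<close>, the
      slice of the whole sum is \<open>a + d\<close> up to the element \<open>g u\<close> of
      \<open>Q\<close>.\<close>
    obtain f where f: "linear_functional K B f" "\<And>v. v \<in> P \<Longrightarrow> f v = \<zero>\<^bsub>K\<^esub>" "f b = \<one>\<^bsub>K\<^esub>"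
      using B.exists_functional[OF P c(2) False] by auto
    obtain g where g: "slice_map A B T p f g" using slice_l[OF f(1)] by auto
    have gu: "g u \<in> Q" by (rule slice_map_W[OF g f(1,2) Q u(2)])
    have guc: "g u \<in> carrier A" using gu QD(5) by simp
    have "g (tsum ((a, b) # xs)) \<in> Q" by (rule "2.prems"(3)[OF f(1,2) g])
    moreover have "g (tsum ((a, b) # xs)) = g u \<oplus>\<^bsub>A\<^esub> (a \<oplus>\<^bsub>A\<^esub> d)"
      unfolding eq using slice_mapD(2,3)[OF g] uc p_closed[OF ad c(2)] ad c f(3) by simp
    ultimately have "\<ominus>\<^bsub>A\<^esub> g u \<oplus>\<^bsub>A\<^esub> (g u \<oplus>\<^bsub>A\<^esub> (a \<oplus>\<^bsub>A\<^esub> d)) \<in> Q"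
      using QD(3) A.subspace_minus[OF Q gu] by simp
    then have "a \<oplus>\<^bsub>A\<^esub> d \<in> Q" using guc ad c(1) u(1) by (simp add: A.M.r_neg1)
    then show ?thesis using W_gen ad c by simp
  qed
  then show ?case unfolding eq by (rule W_rules(4)[OF u(2)])
qed

text \<open>The slices of \<open>inl x \<otimes> t\<close> are \<open>x\<close> times those of
  \<open>t\<close>. If the former lie in \<open>Q\<close>, cancelling \<open>x\<close> puts the
  latter there, and the membership criterion returns to \<open>t\<close>. This does the work of
  flatness.\<close>

lemma regular_mod_W:
  assumes Q: "subspace K A Q" and P: "subspace K B P" and x: "x \<in> carrier A" "regular_mod A Q x"
  shows "regular_mod T (W Q P) (p x \<one>\<^bsub>B\<^esub>)"
  unfolding regular_mod_def
proof (intro ballI impI)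
  fix t assume t: "t \<in> carrier T" "p x \<one>\<^bsub>B\<^esub> \<otimes>\<^bsub>T\<^esub> t \<in> W Q P"
  obtain xs where xs: "set xs \<subseteq> carrier A \<times> carrier B" "t = tsum xs" by (rule carrier_tsum[OF t(1)])
  show "t \<in> W Q P"
    unfolding xs(2)
  proof (rule tsum_mem_W[OF xs(1) Q P])
    fix f g assume f: "linear_functional K B f" "\<And>v. v \<in> P \<Longrightarrow> f v = \<zero>\<^bsub>K\<^esub>"
      and g: "slice_map A B T p f g"
    have "g (p x \<one>\<^bsub>B\<^esub> \<otimes>\<^bsub>T\<^esub> t) \<in> Q" by (rule slice_map_W[OF g f Q t(2)])
    then have "x \<otimes>\<^bsub>A\<^esub> g t \<in> Q" using slice_map_scale[OF g f(1) x(1) t(1)] by simp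
    then have "g t \<in> Q" by (rule regular_modD[OF x(2)]) (rule slice_mapD(1)[OF g t(1)])
    then show "g (tsum xs) \<in> Q" using xs(2) by simp
  qed
qed

text \<open>A functional that is 1 at \<open>b\<close> and 0 on \<open>P\<close> has a slice sending
  the tensor to \<open>a\<close>, outside \<open>Q\<close>.\<close>

lemma p_not_in_W:
  assumes Q: "subspace K A Q" and P: "subspace K B P" and a: "a \<in> carrier A" "a \<notin> Q"
    and b: "b \<in> carrier B" "b \<notin> P"
  shows "p a b \<notin> W Q P"
proof
  assume w: "p a b \<in> W Q P"
  obtain f where f: "linear_functional K B f" "\<And>v. v \<in> P \<Longrightarrow> f v = \<zero>\<^bsub>K\<^esub>" "f b = \<one>\<^bsub>K\<^esub>"
    using B.exists_functional[OF P b] by auto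
  obtain g where g: "slice_map A B T p f g" using slice_l[OF f(1)] by auto
  have "g (p a b) \<in> Q" by (rule slice_map_W[OF g f(1,2) Q w])
  then show False using slice_mapD(3)[OF g a(1) b(1)] f(3) a by simp
qed

lemma ideal_subspace_A:
  assumes "ideal Q A"
  shows "subspace K A Q"
proof -
  interpret Q: ideal Q A by fact
  have "c \<odot>\<^bsub>A\<^esub> q \<in> Q" if c: "c \<in> carrier K" "q \<in> Q" for c q
  proof -
    have "(c \<odot>\<^bsub>A\<^esub> \<one>\<^bsub>A\<^esub>) \<otimes>\<^bsub>A\<^esub> q \<in> Q" by (rule Q.I_l_closed[OF c(2)]) (use c in simp)
    then show ?thesis using c Q.Icarr by (simp add: A.smult_assoc2)
  qed
  then show ?thesis using Q.Icarr by (auto simp: subspace_def)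
qed

lemma ideal_subspace_B:
  assumes "ideal P B"
  shows "subspace K B P"
  by (rule tensor_product.ideal_subspace_A[OF swapped assms])

lemma W_ideal:
  assumes Q: "ideal Q A" and P: "ideal P B"
  shows "ideal (W Q P) T"
proof (rule idealI[OF T.ring_axioms])
  show "subgroup (W Q P) (add_monoid T)" by (rule T.add_subgroupI[OF W_rules(1,3-5)])
  have mult: "p a b \<otimes>\<^bsub>T\<^esub> w \<in> W Q P" if c: "a \<in> carrier A" "b \<in> carrier B" and w: "w \<in> W Q P" for a b w
  proof -
    have pc: "p a b \<in> carrier T" using p_closed c by simp
    have "W Q P \<subseteq> {w \<in> carrier T. p a b \<otimes>\<^bsub>T\<^esub> w \<in> W Q P}"
    proof (rule W_least)
      fix x y assume x: "x \<in> carrier A" "y \<in> carrier B" "x \<in> Q \<or> y \<in> P"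
      have "p (a \<otimes>\<^bsub>A\<^esub> x) (b \<otimes>\<^bsub>B\<^esub> y) \<in> W Q P"
        by (rule W_gen) (use x c ideal.I_l_closed[OF Q] ideal.I_l_closed[OF P] in auto)
      then show "p x y \<in> {w \<in> carrier T. p a b \<otimes>\<^bsub>T\<^esub> w \<in> W Q P}"
        using c x p_closed by (simp add: p_mult)
    qed (use pc W_rules(3-5) in \<open>auto simp: T.r_distr T.r_minus\<close>)
    then show ?thesis using w by auto
  qed
  show l: "s \<otimes>\<^bsub>T\<^esub> w \<in> W Q P" if w: "w \<in> W Q P" and s: "s \<in> carrier T" for w s
  proof -
    have wc: "w \<in> carrier T" using w W_rules(1) by auto
    have "tsum xs \<otimes>\<^bsub>T\<^esub> w \<in> W Q P" if "set xs \<subseteq> carrier A \<times> carrier B" for xs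
      using that
    proof (induction xs rule: tsum.induct)
      case 1
      then show ?case using wc W_rules(3) by simp
    next
      case (2 a b xs)
      then show ?case using mult[OF _ _ w, of a b] W_rules(4) wc p_closed tsum_closed
        by (simp add: T.l_distr)
    qed
    then show ?thesis using carrier_tsum[OF s] by metis
  qed
  show "w \<otimes>\<^bsub>T\<^esub> s \<in> W Q P" if "w \<in> W Q P" "s \<in> carrier T" for w s
    using l[OF that] that W_rules(1) by (metis T.m_comm subsetD)
qed

end

section \<open>Grades of ideals in a tensor product\<close>

context tensor_product
begin

abbreviation inl :: "'a \<Rightarrow> 'c" where "inl x \<equiv> p x \<one>\<^bsub>B\<^esub>"
abbreviation inr :: "'b \<Rightarrow> 'c" where "inr y \<equiv> p \<one>\<^bsub>A\<^esub> y"

lemmas A_cring = A.M_cring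
lemmas B_cring = B.M_cring

text \<open>Makes the base ideal of a regular sequence in \<open>T\<close> an instance of
  \<open>W\<close>.\<close>

lemma W_zero: "W {\<zero>\<^bsub>A\<^esub>} {\<zero>\<^bsub>B\<^esub>} = {\<zero>\<^bsub>T\<^esub>}"
proof (rule equalityI)
  show "W {\<zero>\<^bsub>A\<^esub>} {\<zero>\<^bsub>B\<^esub>} \<subseteq> {\<zero>\<^bsub>T\<^esub>}"
    by (rule W_least) (auto simp: p_zero_l p_zero_r)
qed (use W_rules(3) in simp)

text \<open>The nontrivial inclusion splits \<open>(q + x s) \<otimes> b\<close> into
  \<open>q \<otimes> b\<close> and a multiple of \<open>inl x\<close>.\<close>

lemma W_Idl_insert:
  assumes Q: "ideal Q A" and P: "ideal P B" and x: "x \<in> carrier A"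
  shows "W (Idl\<^bsub>A\<^esub> (insert x Q)) P = Idl\<^bsub>T\<^esub> (insert (inl x) (W Q P))"
proof (rule equalityI)
  let ?Q = "Idl\<^bsub>A\<^esub> (insert x Q)" and ?L = "Idl\<^bsub>T\<^esub> (insert (inl x) (W Q P))"
  have xc: "inl x \<in> carrier T" using x p_closed by simp
  have Q': "ideal ?Q A" by (rule cring.ideal_Idl_insert[OF A_cring Q x])
  have c: "insert (inl x) (W Q P) \<subseteq> carrier T" using xc W_rules(1) by auto
  have L: "ideal ?L T" by (rule T.genideal_ideal[OF c])
  interpret L: ideal ?L T by (rule L)
  note self = T.genideal_self[OF c]
  have "insert x Q \<subseteq> carrier A" using x cring.ideal_subset[OF A_cring Q] by simp
  note selfQ = ring.genideal_self[OF cring.axioms(1)[OF A_cring] this]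
  show "W ?Q P \<subseteq> ?L"
  proof (rule W_least)
    fix a b assume ab: "a \<in> carrier A" "b \<in> carrier B" "a \<in> ?Q \<or> b \<in> P"
    show "p a b \<in> ?L" using ab(3)
    proof
      assume "b \<in> P"
      then have "p a b \<in> W Q P" using W_gen ab by simp
      then show ?thesis using self by auto
    next
      assume "a \<in> ?Q"
      then obtain q s where q: "q \<in> Q" "s \<in> carrier A" "a = q \<oplus>\<^bsub>A\<^esub> x \<otimes>\<^bsub>A\<^esub> s"
        using cring.mem_Idl_insert[OF A_cring Q x] by auto
      have qc: "q \<in> carrier A" using q cring.ideal_subset[OF A_cring Q] by auto
      have eq: "p a b = p q b \<oplus>\<^bsub>T\<^esub> inl x \<otimes>\<^bsub>T\<^esub> p s b"
        unfolding q(3) using qc q(2) x ab(2) by (simp add: p_add_l p_mult)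
      have "p q b \<in> ?L" using W_gen[of q b Q P] q(1) qc ab(2) self by auto
      moreover have "inl x \<otimes>\<^bsub>T\<^esub> p s b \<in> ?L"
        by (rule L.I_r_closed) (use self p_closed q(2) ab(2) in auto)
      ultimately show ?thesis unfolding eq by (rule L.a_closed)
    qed
  qed (use L.Icarr L.a_inv_closed in auto)
  have "inl x \<in> W ?Q P" by (rule W_gen) (use x selfQ in auto)
  moreover have "W Q P \<subseteq> W ?Q P" by (rule W_mono) (use selfQ in auto)
  ultimately show "?L \<subseteq> W ?Q P" by (intro T.genideal_minimal W_ideal Q' P) simp
qed

text \<open>The equation of ideals accompanies regularity because it supplies the base for whatever
  follows the sequence. The general \<open>P\<close> is what lets the mirrored version start from an
  ideal already enlarged in the other factor.\<close>

lemma regular_over_W_l: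
  assumes "ideal Q A" and P: "ideal P B" and "set xs \<subseteq> carrier A" "regular_over A Q xs"
  shows "regular_over T (W Q P) (map inl xs) \<and>
    Idl\<^bsub>T\<^esub> (W Q P \<union> set (map inl xs)) = W (Idl\<^bsub>A\<^esub> (Q \<union> set xs)) P"
  using assms(1,3,4)
proof (induction xs arbitrary: Q)
  case Nil
  then show ?case
    using T.Idl_ideal[OF W_ideal[OF _ P]] cring.Idl_ideal[OF A_cring] by simp
next
  case (Cons x xs)
  note Q = \<open>ideal Q A\<close>
  have c: "x \<in> carrier A" "set xs \<subseteq> carrier A" using Cons by auto
  have ic: "inl x \<in> carrier T" "set (map inl xs) \<subseteq> carrier T" using c p_closed by auto
  let ?Q = "Idl\<^bsub>A\<^esub> (insert x Q)"
  have Q': "ideal ?Q A" by (rule cring.ideal_Idl_insert[OF A_cring Q c(1)])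
  have reg: "regular_mod A Q x" "regular_over A ?Q xs"
    using Cons.prems(3) cring.regular_over_Cons[OF A_cring Q c] by auto
  have IH: "regular_over T (W ?Q P) (map inl xs)"
    "Idl\<^bsub>T\<^esub> (W ?Q P \<union> set (map inl xs)) = W (Idl\<^bsub>A\<^esub> (?Q \<union> set xs)) P"
    using Cons.IH[OF Q' c(2) reg(2)] by auto
  have "regular_mod T (W Q P) (inl x)"
    by (rule regular_mod_W[OF ideal_subspace_A[OF Q] ideal_subspace_B[OF P] c(1) reg(1)])
  then have "regular_over T (W Q P) (inl x # map inl xs)"
    using T.regular_over_Cons[OF W_ideal[OF Q P] ic] IH(1) W_Idl_insert[OF Q P c(1)] by simp
  moreover have "Idl\<^bsub>T\<^esub> (W Q P \<union> set (map inl (x # xs))) = W (Idl\<^bsub>A\<^esub> (Q \<union> set (x # xs))) P"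
    using T.Idl_insert_Un[OF W_ideal[OF Q P] ic] cring.Idl_insert_Un[OF A_cring Q c]
      IH(2) W_Idl_insert[OF Q P c(1)] by simp
  ultimately show ?case by simp
qed

lemma regular_over_W_r:
  assumes "ideal Q A" "ideal P B" "set ys \<subseteq> carrier B" "regular_over B P ys"
  shows "regular_over T (W Q P) (map inr ys) \<and>
    Idl\<^bsub>T\<^esub> (W Q P \<union> set (map inr ys)) = W Q (Idl\<^bsub>B\<^esub> (P \<union> set ys))"
  using tensor_product.regular_over_W_l[OF swapped assms(2,1,3,4)]
  unfolding mixed_span_swapped .

lemma grade_witness_W:
  assumes I: "ideal I A" and J: "ideal J B"
    and x: "grade_witness A I xs" and y: "grade_witness B J ys"
  shows "grade_witness T (W I J) (map inl xs @ map inr ys)"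
proof -
  let ?Q = "Idl\<^bsub>A\<^esub> (insert \<zero>\<^bsub>A\<^esub> (set xs))" and ?P = "Idl\<^bsub>B\<^esub> (insert \<zero>\<^bsub>B\<^esub> (set ys))"
  have A0: "ideal {\<zero>\<^bsub>A\<^esub>} A" and B0: "ideal {\<zero>\<^bsub>B\<^esub>} B"
    using ring.zeroideal cring.axioms(1) A_cring B_cring by blast+
  have xI: "set xs \<subseteq> I" "regular_over A {\<zero>\<^bsub>A\<^esub>} xs" "killed_mod A I ?Q"
    using x by (auto simp: grade_witness_def)
  have yJ: "set ys \<subseteq> J" "regular_over B {\<zero>\<^bsub>B\<^esub>} ys" "killed_mod B J ?P"
    using y by (auto simp: grade_witness_def)
  note Ic = cring.ideal_subset[OF A_cring I] and Jc = cring.ideal_subset[OF B_cring J]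
  have xc: "set xs \<subseteq> carrier A" and yc: "set ys \<subseteq> carrier B" using xI yJ Ic Jc by auto
  have Q: "ideal ?Q A" using cring.ideal_Idl_Un[OF A_cring A0 xc] by simp
  have P: "ideal ?P B" using cring.ideal_Idl_Un[OF B_cring B0 yc] by simp
  \<comment> \<open>The sequence runs in two stages: \<open>xs\<close> leads from zero to
    \<open>W ?Q {\<zero>}\<close>, and over that ideal \<open>ys\<close> is regular and leads to
    \<open>W ?Q ?P\<close>.\<close>
  have l: "regular_over T {\<zero>\<^bsub>T\<^esub>} (map inl xs)"
    "Idl\<^bsub>T\<^esub> ({\<zero>\<^bsub>T\<^esub>} \<union> set (map inl xs)) = W ?Q {\<zero>\<^bsub>B\<^esub>}"
    using regular_over_W_l[OF A0 B0 xc xI(2)] unfolding W_zero by auto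
  have r: "regular_over T (W ?Q {\<zero>\<^bsub>B\<^esub>}) (map inr ys)"
    "Idl\<^bsub>T\<^esub> (W ?Q {\<zero>\<^bsub>B\<^esub>} \<union> set (map inr ys)) = W ?Q ?P"
    using regular_over_W_r[OF Q B0 yc yJ(2)] by auto
  have lc: "set (map inl xs) \<subseteq> carrier T" and rc: "set (map inr ys) \<subseteq> carrier T"
    using xc yc p_closed by auto
  have reg: "regular_over T {\<zero>\<^bsub>T\<^esub>} (map inl xs @ map inr ys)"
    using T.regular_over_append[OF T.zeroideal lc rc] l r(1) by simp
  have "Idl\<^bsub>T\<^esub> (Idl\<^bsub>T\<^esub> ({\<zero>\<^bsub>T\<^esub>} \<union> set (map inl xs)) \<union> set (map inr ys)) =
      Idl\<^bsub>T\<^esub> (({\<zero>\<^bsub>T\<^esub>} \<union> set (map inl xs)) \<union> set (map inr ys))"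
    by (rule T.Idl_Un_Idl) (use lc rc in auto)
  then have "Idl\<^bsub>T\<^esub> (insert \<zero>\<^bsub>T\<^esub> (set (map inl xs @ map inr ys))) = W ?Q ?P"
    using l(2) r(2) by (simp add: Un_assoc)
  moreover have "killed_mod T (W I J) (W ?Q ?P)"
  proof -
    obtain a where a: "a \<in> carrier A" "a \<notin> ?Q" "\<forall>i \<in> I. i \<otimes>\<^bsub>A\<^esub> a \<in> ?Q"
      using xI(3) unfolding killed_mod_def by auto
    obtain b where b: "b \<in> carrier B" "b \<notin> ?P" "\<forall>j \<in> J. j \<otimes>\<^bsub>B\<^esub> b \<in> ?P"
      using yJ(3) unfolding killed_mod_def by auto
    have pc: "p a b \<in> carrier T" using p_closed a b by simp
    \<comment> \<open>On a generator \<open>p i j\<close> one of the factors is in its ideal, so one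
      factor of \<open>p (i a) (j b)\<close> falls into \<open>?Q\<close> or \<open>?P\<close>; the
      mixed ideal asks for no more than that.\<close>
    have "W I J \<subseteq> {t \<in> carrier T. t \<otimes>\<^bsub>T\<^esub> p a b \<in> W ?Q ?P}"
    proof (rule W_least)
      fix i j assume ij: "i \<in> carrier A" "j \<in> carrier B" "i \<in> I \<or> j \<in> J"
      have "p (i \<otimes>\<^bsub>A\<^esub> a) (j \<otimes>\<^bsub>B\<^esub> b) \<in> W ?Q ?P"
        by (rule W_gen) (use ij a b in auto)
      then show "p i j \<in> {t \<in> carrier T. t \<otimes>\<^bsub>T\<^esub> p a b \<in> W ?Q ?P}"
        using ij a(1) b(1) p_closed by (simp add: p_mult)
    qed (use pc W_rules(3-5) in \<open>auto simp: T.l_distr T.l_minus\<close>)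
    moreover have "p a b \<notin> W ?Q ?P"
      by (rule p_not_in_W[OF ideal_subspace_A[OF Q] ideal_subspace_B[OF P] a(1,2) b(1,2)])
    ultimately show ?thesis using pc unfolding killed_mod_def by (intro bexI[of _ "p a b"]) auto
  qed
  moreover have "set (map inl xs @ map inr ys) \<subseteq> W I J"
  proof
    fix t assume "t \<in> set (map inl xs @ map inr ys)"
    then consider x where "x \<in> set xs" "t = inl x" | y where "y \<in> set ys" "t = inr y" by auto
    then show "t \<in> W I J"
    proof cases
      case 1
      then show ?thesis using W_gen[of x "\<one>\<^bsub>B\<^esub>" I J] xI(1) xc by auto
    next
      case 2
      then show ?thesis using W_gen[of "\<one>\<^bsub>A\<^esub>" y I J] yJ(1) yc by auto
    qed
  qed
  ultimately show ?thesis using reg unfolding grade_witness_def by simp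
qed

lemma W_proper:
  assumes I: "ideal I A" "I \<noteq> carrier A" and J: "ideal J B" "J \<noteq> carrier B"
  shows "W I J \<noteq> carrier T"
proof -
  have "\<one>\<^bsub>A\<^esub> \<notin> I" "\<one>\<^bsub>B\<^esub> \<notin> J"
    using I J ideal.one_imp_carrier by auto
  then have "\<one>\<^bsub>T\<^esub> \<notin> W I J"
    using p_not_in_W[OF ideal_subspace_A[OF I(1)] ideal_subspace_B[OF J(1)],
        of "\<one>\<^bsub>A\<^esub>" "\<one>\<^bsub>B\<^esub>"] p_one by simp
  then show ?thesis by auto
qed

text \<open>An ideal of \<open>A\<close> is recovered from its extension, since \<open>inl i\<close>
  is in Q \<otimes> B only if \<open>i\<close> is in \<open>Q\<close>. The extension of
  \<open>I\<close> is generated by finitely many \<open>inl s\<close> with \<open>s\<close> in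
  \<open>I\<close>, and these \<open>s\<close> then generate \<open>I\<close>.\<close>

lemma noetherian_A:
  assumes "noetherian_ring T"
  shows "noetherian_ring A"
proof (rule ring.noetherian_ringI[OF cring.axioms(1)[OF A_cring]])
  fix I assume I: "ideal I A"
  interpret I: ideal I A by (rule I)
  interpret TN: noetherian_cring T
    by (intro noetherian_cring.intro assms T.cring_axioms)
  have B0: "ideal {\<zero>\<^bsub>B\<^esub>} B" using ring.zeroideal cring.axioms(1) B_cring by blast
  have Ic: "inl ` I \<subseteq> carrier T" using p_closed I.Icarr by auto
  obtain Y where Y: "finite Y" "Y \<subseteq> inl ` I" "Idl\<^bsub>T\<^esub> Y = Idl\<^bsub>T\<^esub> (inl ` I)"
    by (rule TN.finite_generating_subset[OF Ic])
  obtain S where S: "S \<subseteq> I" "finite S" "Y = inl ` S"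
    using finite_subset_image[OF Y(1,2)] by auto
  have Sc: "S \<subseteq> carrier A" using S(1) I.Icarr by auto
  let ?Q = "Idl\<^bsub>A\<^esub> S"
  have Q: "ideal ?Q A" by (rule ring.genideal_ideal[OF cring.axioms(1)[OF A_cring] Sc])
  have "?Q \<subseteq> I" by (rule ring.genideal_minimal[OF cring.axioms(1)[OF A_cring] I S(1)])
  moreover have "i \<in> ?Q" if i: "i \<in> I" for i
  proof (rule ccontr)
    assume n: "i \<notin> ?Q"
    have "Y \<subseteq> W ?Q {\<zero>\<^bsub>B\<^esub>}"
    proof
      fix y assume "y \<in> Y"
      then obtain s where s: "s \<in> S" "y = inl s" using S(3) by auto
      have "s \<in> ?Q" using ring.genideal_self[OF cring.axioms(1)[OF A_cring] Sc] s(1) by auto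
      then show "y \<in> W ?Q {\<zero>\<^bsub>B\<^esub>}" unfolding s(2) using s(1) Sc by (intro W_gen) auto
    qed
    then have "Idl\<^bsub>T\<^esub> Y \<subseteq> W ?Q {\<zero>\<^bsub>B\<^esub>}" by (intro T.genideal_minimal W_ideal Q B0)
    moreover have "inl i \<in> Idl\<^bsub>T\<^esub> Y" using T.genideal_self[OF Ic] i Y(3) by auto
    ultimately have "inl i \<in> W ?Q {\<zero>\<^bsub>B\<^esub>}" by auto
    moreover have "inl i \<notin> W ?Q {\<zero>\<^bsub>B\<^esub>}"
      by (rule p_not_in_W[OF ideal_subspace_A[OF Q] ideal_subspace_B[OF B0]])
        (use i I.Icarr n B_nontrivial in auto)
    ultimately show False by simp
  qed
  ultimately have "I = ?Q" by auto
  then show "\<exists>S \<subseteq> carrier A. finite S \<and> I = Idl\<^bsub>A\<^esub> S" using Sc S(2) by auto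
qed

lemma grade_W:
  assumes noeth: "noetherian_ring T"
    and I: "ideal I A" "I \<noteq> carrier A" and J: "ideal J B" "J \<noteq> carrier B"
  shows "grade T (W I J) = grade A I + grade B J"
proof -
  interpret TN: noetherian_cring T
    by (intro noetherian_cring.intro noeth T.cring_axioms)
  interpret AN: noetherian_cring A
    by (intro noetherian_cring.intro noetherian_A noeth A_cring)
  interpret BN: noetherian_cring B
    by (intro noetherian_cring.intro tensor_product.noetherian_A[OF swapped] noeth B_cring)
  obtain xs where x: "grade_witness A I xs" by (rule AN.exists_grade_witness[OF I])
  obtain ys where y: "grade_witness B J ys" by (rule BN.exists_grade_witness[OF J])
  have "grade T (W I J) = length (map inl xs @ map inr ys)"
    by (rule TN.grade_eqI[OF W_ideal[OF I(1) J(1)] W_proper[OF I J] grade_witness_W[OF I(1) J(1) x y]])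
  then show ?thesis using AN.grade_eqI[OF I x] BN.grade_eqI[OF J y] by simp
qed

lemma grade_W_zero_r:
  assumes noeth: "noetherian_ring T" and I: "ideal I A" "I \<noteq> carrier A"
  shows "grade T (W I {\<zero>\<^bsub>B\<^esub>}) = grade A I"
proof -
  interpret BN: noetherian_cring B
    by (intro noetherian_cring.intro tensor_product.noetherian_A[OF swapped] noeth B_cring)
  have BZ: "ideal {\<zero>\<^bsub>B\<^esub>} B" using ring.zeroideal cring.axioms(1) B_cring by blast
  have "\<one>\<^bsub>B\<^esub> \<in> carrier B" by simp
  then have B0: "{\<zero>\<^bsub>B\<^esub>} \<noteq> carrier B" using B_nontrivial by auto
  have "grade B {\<zero>\<^bsub>B\<^esub>} = 0"
    using BN.grade_eqI[OF BZ B0 BN.grade_witness_zero_ideal[OF B_nontrivial]] by simp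
  then show ?thesis using grade_W[OF noeth I BZ B0] by simp
qed

lemma grade_W_zero_l:
  assumes noeth: "noetherian_ring T" and J: "ideal J B" "J \<noteq> carrier B"
  shows "grade T (W {\<zero>\<^bsub>A\<^esub>} J) = grade B J"
  using tensor_product.grade_W_zero_r[OF swapped noeth J] unfolding mixed_span_swapped .

section \<open>The ideals of the statement as mixed spans\<close>

lemma tensor_span_carrier_r:
  assumes I: "ideal I A"
  shows "tensor_span T p I (carrier B) = W I {\<zero>\<^bsub>B\<^esub>}"
proof (rule equalityI)
  note Ic = cring.ideal_subset[OF A_cring I]
  have z: "\<zero>\<^bsub>A\<^esub> \<in> I" using I by (simp add: additive_subgroup.zero_closed ideal.axioms(1))
  have g: "{p a b | a b. a \<in> I \<and> b \<in> carrier B} \<subseteq> carrier T" using Ic p_closed by auto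
  note r = T.add_generateD[OF g, folded tensor_span_def]
  show "W I {\<zero>\<^bsub>B\<^esub>} \<subseteq> tensor_span T p I (carrier B)"
  proof (rule W_least)
    fix a b assume ab: "a \<in> carrier A" "b \<in> carrier B" "a \<in> I \<or> b \<in> {\<zero>\<^bsub>B\<^esub>}"
    show "p a b \<in> tensor_span T p I (carrier B)"
    proof (cases "a \<in> I")
      case True
      then show ?thesis using ab(2) by (intro subsetD[OF r(2)]) auto
    next
      case False
      then show ?thesis using ab r(3) by (simp add: p_zero_r)
    qed
  qed (use r(1,3-5) in auto)
  show "tensor_span T p I (carrier B) \<subseteq> W I {\<zero>\<^bsub>B\<^esub>}"
    unfolding tensor_span_def
  proof (rule T.add_generate_least[OF _ W_rules(1,3-5)])
    show "{p a b | a b. a \<in> I \<and> b \<in> carrier B} \<subseteq> W I {\<zero>\<^bsub>B\<^esub>}" using Ic W_gen by blast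
  qed
qed

lemma tensor_span_swapped: "tensor_span T (\<lambda>b a. p a b) U S = tensor_span T p S U"
proof -
  have "{p b a | a b. a \<in> U \<and> b \<in> S} = {p a b | a b. a \<in> S \<and> b \<in> U}" by auto
  then show ?thesis by (simp add: tensor_span_def)
qed

lemma tensor_span_carrier_l:
  assumes "ideal J B"
  shows "tensor_span T p (carrier A) J = W {\<zero>\<^bsub>A\<^esub>} J"
  using tensor_product.tensor_span_carrier_r[OF swapped assms]
  unfolding mixed_span_swapped tensor_span_swapped .

lemma W_zero_add_W_zero:
  assumes I: "ideal I A" and J: "ideal J B"
  shows "W I {\<zero>\<^bsub>B\<^esub>} <+>\<^bsub>T\<^esub> W {\<zero>\<^bsub>A\<^esub>} J = W I J"
proof (rule equalityI)
  have A0: "ideal {\<zero>\<^bsub>A\<^esub>} A" and B0: "ideal {\<zero>\<^bsub>B\<^esub>} B"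
    using ring.zeroideal cring.axioms(1) A_cring B_cring by blast+
  have zI: "{\<zero>\<^bsub>A\<^esub>} \<subseteq> I" and zJ: "{\<zero>\<^bsub>B\<^esub>} \<subseteq> J"
    using I J by (simp_all add: additive_subgroup.zero_closed ideal.axioms(1))
  let ?S = "W I {\<zero>\<^bsub>B\<^esub>} <+>\<^bsub>T\<^esub> W {\<zero>\<^bsub>A\<^esub>} J"
  have sum: "u \<oplus>\<^bsub>T\<^esub> v \<in> ?S" if "u \<in> W I {\<zero>\<^bsub>B\<^esub>}" "v \<in> W {\<zero>\<^bsub>A\<^esub>} J" for u v
    using that unfolding set_add_def' by blast
  show "?S \<subseteq> W I J"
    using subsetD[OF W_mono[OF subset_refl zJ]] subsetD[OF W_mono[OF zI subset_refl]] W_rules(4)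
    by (auto simp: set_add_def')
  have S: "ideal ?S T" by (rule T.add_ideals[OF W_ideal[OF I B0] W_ideal[OF A0 J]])
  interpret S: ideal ?S T by (rule S)
  show "W I J \<subseteq> ?S"
  proof (rule W_least)
    fix a b assume ab: "a \<in> carrier A" "b \<in> carrier B" "a \<in> I \<or> b \<in> J"
    have pc: "p a b \<in> carrier T" using p_closed ab by simp
    show "p a b \<in> ?S" using ab(3)
    proof
      assume "a \<in> I"
      then show ?thesis using sum[OF W_gen W_rules(3), of a b] ab pc by simp
    next
      assume "b \<in> J"
      then show ?thesis using sum[OF W_rules(3) W_gen, of a b] ab pc by simp
    qed
  qed (use S.Icarr S.a_inv_closed in auto)
qed

text \<open>One bilinearity argument for two uses. With the carriers in the two inner places it puts
  products from I \<otimes> B and A \<otimes> J into I \<otimes> J; with both carriers in the left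
  operand it shows that I \<otimes> J is an ideal.\<close>

lemma tensor_span_mult:
  assumes c: "Q \<subseteq> carrier A" "P \<subseteq> carrier B" "Q' \<subseteq> carrier A" "P' \<subseteq> carrier B"
      "S \<subseteq> carrier A" "U \<subseteq> carrier B"
    and S: "\<And>a a'. a \<in> Q \<Longrightarrow> a' \<in> Q' \<Longrightarrow> a \<otimes>\<^bsub>A\<^esub> a' \<in> S"
    and U: "\<And>b b'. b \<in> P \<Longrightarrow> b' \<in> P' \<Longrightarrow> b \<otimes>\<^bsub>B\<^esub> b' \<in> U"
    and s: "s \<in> tensor_span T p Q P" and t: "t \<in> tensor_span T p Q' P'"
  shows "s \<otimes>\<^bsub>T\<^esub> t \<in> tensor_span T p S U"
proof -
  let ?L = "tensor_span T p S U"
  have g: "{p a b | a b. a \<in> Y \<and> b \<in> Z} \<subseteq> carrier T"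
    if "Y \<subseteq> carrier A" "Z \<subseteq> carrier B" for Y Z using that p_closed by auto
  note r = T.add_generateD[OF g[OF c(5,6)], folded tensor_span_def]
  have 1: "p a b \<otimes>\<^bsub>T\<^esub> t \<in> ?L" if ab: "a \<in> Q" "b \<in> P" for a b
  proof -
    have abc: "a \<in> carrier A" "b \<in> carrier B" using ab c by auto
    have pc: "p a b \<in> carrier T" using abc p_closed by simp
    have "tensor_span T p Q' P' \<subseteq> {t \<in> carrier T. p a b \<otimes>\<^bsub>T\<^esub> t \<in> ?L}"
    proof (subst (1) tensor_span_def, rule T.add_generate_least)
      show "{p a b | a b. a \<in> Q' \<and> b \<in> P'} \<subseteq> {t \<in> carrier T. p a b \<otimes>\<^bsub>T\<^esub> t \<in> ?L}"
      proof
        fix u assume "u \<in> {p a b | a b. a \<in> Q' \<and> b \<in> P'}"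
        then obtain a' b' where u: "a' \<in> Q'" "b' \<in> P'" "u = p a' b'" by auto
        have uc: "a' \<in> carrier A" "b' \<in> carrier B" using u c by auto
        have "p (a \<otimes>\<^bsub>A\<^esub> a') (b \<otimes>\<^bsub>B\<^esub> b') \<in> ?L"
          by (rule subsetD[OF r(2)]) (use S[OF ab(1) u(1)] U[OF ab(2) u(2)] in auto)
        then show "u \<in> {t \<in> carrier T. p a b \<otimes>\<^bsub>T\<^esub> t \<in> ?L}"
          using u(3) uc abc p_closed by (simp add: p_mult)
      qed
    qed (use pc r(3-5) in \<open>auto simp: T.r_distr T.r_minus\<close>)
    then show ?thesis using t by auto
  qed
  have tc: "t \<in> carrier T"
    using t T.add_generateD(1)[OF g[OF c(3,4)]] by (auto simp: tensor_span_def)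
  have "tensor_span T p Q P \<subseteq> {s \<in> carrier T. s \<otimes>\<^bsub>T\<^esub> t \<in> ?L}"
  proof (subst (1) tensor_span_def, rule T.add_generate_least)
    show "{p a b | a b. a \<in> Q \<and> b \<in> P} \<subseteq> {s \<in> carrier T. s \<otimes>\<^bsub>T\<^esub> t \<in> ?L}"
      using 1 g[OF c(1,2)] by blast
  qed (use tc r(3-5) in \<open>auto simp: T.l_distr T.l_minus\<close>)
  then show ?thesis using s by auto
qed

lemma grade_tensor_span:
  assumes noeth: "noetherian_ring T"
    and I: "ideal I A" "I \<noteq> carrier A" and J: "ideal J B" "J \<noteq> carrier B"
  shows "grade T (tensor_span T p I J) = min (grade A I) (grade B J)"
proof -
  interpret TN: noetherian_cring T
    by (intro noetherian_cring.intro noeth T.cring_axioms)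
  have A0: "ideal {\<zero>\<^bsub>A\<^esub>} A" and B0: "ideal {\<zero>\<^bsub>B\<^esub>} B"
    using ring.zeroideal cring.axioms(1) A_cring B_cring by blast+
  have A0': "{\<zero>\<^bsub>A\<^esub>} \<noteq> carrier A" and B0': "{\<zero>\<^bsub>B\<^esub>} \<noteq> carrier B"
    using A_nontrivial B_nontrivial A.M.zero_closed by auto
  note Ic = cring.ideal_subset[OF A_cring I(1)] and Jc = cring.ideal_subset[OF B_cring J(1)]
  let ?L = "tensor_span T p I J"
  have gc: "{p a b | a b. a \<in> I \<and> b \<in> J} \<subseteq> carrier T" using Ic Jc p_closed by auto
  note r = T.add_generateD[OF gc, folded tensor_span_def]
  have prod: "u \<otimes>\<^bsub>T\<^esub> v \<in> ?L" if "u \<in> W I {\<zero>\<^bsub>B\<^esub>}" "v \<in> W {\<zero>\<^bsub>A\<^esub>} J" for u v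
  proof (rule tensor_span_mult[where Q = I and P = "carrier B" and Q' = "carrier A" and P' = J])
    show "u \<in> tensor_span T p I (carrier B)" "v \<in> tensor_span T p (carrier A) J"
      using that I J by (simp_all add: tensor_span_carrier_r tensor_span_carrier_l)
  qed (use Ic Jc ideal.I_r_closed[OF I(1)] ideal.I_l_closed[OF J(1)] in auto)
  have L: "ideal ?L T"
  proof (rule idealI[OF T.ring_axioms])
    show "subgroup ?L (add_monoid T)" by (rule T.add_subgroupI[OF r(1,3-5)])
    show scale: "s \<otimes>\<^bsub>T\<^esub> l \<in> ?L" if "l \<in> ?L" "s \<in> carrier T" for l s
      by (rule tensor_span_mult[where Q = "carrier A" and P = "carrier B" and Q' = I and P' = J])
        (use that Ic Jc spanned ideal.I_l_closed[OF I(1)] ideal.I_l_closed[OF J(1)] in auto)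
    show "l \<otimes>\<^bsub>T\<^esub> s \<in> ?L" if "l \<in> ?L" "s \<in> carrier T" for l s
      using scale[OF that] that r(1) by (metis T.m_comm subsetD)
  qed
  have sub: "?L \<subseteq> W Q P" if "\<And>a b. a \<in> I \<Longrightarrow> b \<in> J \<Longrightarrow> a \<in> Q \<or> b \<in> P" for Q P
    unfolding tensor_span_def
  proof (rule T.add_generate_least[OF _ W_rules(1,3-5)])
    show "{p a b | a b. a \<in> I \<and> b \<in> J} \<subseteq> W Q P"
    proof
      fix u assume "u \<in> {p a b | a b. a \<in> I \<and> b \<in> J}"
      then obtain a b where "a \<in> I" "b \<in> J" "u = p a b" by auto
      then show "u \<in> W Q P" using that[of a b] Ic Jc W_gen[of a b Q P] by auto
    qed
  qed
  have "grade T ?L = min (grade T (W I {\<zero>\<^bsub>B\<^esub>})) (grade T (W {\<zero>\<^bsub>A\<^esub>} J))"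
    by (rule TN.grade_between_product_and_inter[OF W_ideal[OF I(1) B0] W_proper[OF I B0 B0']
          W_ideal[OF A0 J(1)] W_proper[OF A0 A0' J] L sub sub prod]) auto
  then show ?thesis using grade_W_zero_r[OF noeth I] grade_W_zero_l[OF noeth J] by simp
qed

end

section \<open>The monoid algebra\<close>

locale comm_monoid_algebra = K: cring K + M: comm_monoid M
  for K :: "('k, 'r) ring_scheme" and M :: "('m, 's) monoid_scheme"
begin

abbreviation F :: "('m \<Rightarrow> 'k) ring" where "F \<equiv> monoid_algebra K M"
abbreviation supp :: "('m \<Rightarrow> 'k) \<Rightarrow> 'm set" where "supp f \<equiv> {p. f p \<noteq> \<zero>\<^bsub>K\<^esub>}"

lemma mem_carrier_iff:
  "f \<in> carrier F \<longleftrightarrow> (\<forall>p. f p \<in> carrier K) \<and> finite (supp f) \<and> supp f \<subseteq> carrier M"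
  by (auto simp: monoid_algebra_def)

lemma carrierD:
  assumes "f \<in> carrier F"
  shows "f p \<in> carrier K" "finite (supp f)" "supp f \<subseteq> carrier M"
  using assms by (simp_all add: mem_carrier_iff)

lemma add_apply: "(f \<oplus>\<^bsub>F\<^esub> g) p = f p \<oplus>\<^bsub>K\<^esub> g p"
  by (simp add: monoid_algebra_def)

lemma zero_apply: "\<zero>\<^bsub>F\<^esub> p = \<zero>\<^bsub>K\<^esub>"
  by (simp add: monoid_algebra_def)

lemma one_eq: "\<one>\<^bsub>F\<^esub> = monomial K \<one>\<^bsub>K\<^esub> \<one>\<^bsub>M\<^esub>"
  by (simp add: monoid_algebra_def monomial_def)

lemma monomial_closed:
  assumes "c \<in> carrier K" "p \<in> carrier M"
  shows "monomial K c p \<in> carrier F"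
proof -
  have "supp (monomial K c p) \<subseteq> {p}" by (auto simp: monomial_def)
  moreover from this have "finite (supp (monomial K c p))" by (rule finite_subset) simp
  ultimately show ?thesis using assms by (auto simp: mem_carrier_iff monomial_def)
qed

lemma add_closed:
  assumes f: "f \<in> carrier F" and g: "g \<in> carrier F"
  shows "f \<oplus>\<^bsub>F\<^esub> g \<in> carrier F"
proof -
  have "supp (f \<oplus>\<^bsub>F\<^esub> g) \<subseteq> supp f \<union> supp g" by (auto simp: add_apply)
  moreover from this have "finite (supp (f \<oplus>\<^bsub>F\<^esub> g))"
    by (rule finite_subset) (use carrierD(2) f g in simp)
  ultimately show ?thesis
    unfolding mem_carrier_iff using carrierD[OF f] carrierD[OF g] by (auto simp: add_apply)
qed

lemma zero_closed: "\<zero>\<^bsub>F\<^esub> \<in> carrier F"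
  by (simp add: mem_carrier_iff zero_apply)

lemma F_abelian_group: "abelian_group F"
proof (rule abelian_groupI)
  fix f g h assume f: "f \<in> carrier F" and g: "g \<in> carrier F" and h: "h \<in> carrier F"
  show "f \<oplus>\<^bsub>F\<^esub> g \<in> carrier F" using f g by (rule add_closed)
  show "f \<oplus>\<^bsub>F\<^esub> g \<oplus>\<^bsub>F\<^esub> h = f \<oplus>\<^bsub>F\<^esub> (g \<oplus>\<^bsub>F\<^esub> h)"
    using carrierD(1)[OF f] carrierD(1)[OF g] carrierD(1)[OF h]
    by (intro ext) (simp add: add_apply K.a_assoc)
  show "f \<oplus>\<^bsub>F\<^esub> g = g \<oplus>\<^bsub>F\<^esub> f"
    using carrierD(1)[OF f] carrierD(1)[OF g] by (intro ext) (simp add: add_apply K.a_comm)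
  show "\<zero>\<^bsub>F\<^esub> \<oplus>\<^bsub>F\<^esub> f = f"
    using carrierD(1)[OF f] by (intro ext) (simp add: add_apply zero_apply)
  have "supp (\<lambda>p. \<ominus>\<^bsub>K\<^esub> f p) \<subseteq> supp f" by auto
  then have "(\<lambda>p. \<ominus>\<^bsub>K\<^esub> f p) \<in> carrier F"
    using carrierD[OF f] finite_subset unfolding mem_carrier_iff by auto
  moreover have "(\<lambda>p. \<ominus>\<^bsub>K\<^esub> f p) \<oplus>\<^bsub>F\<^esub> f = \<zero>\<^bsub>F\<^esub>"
    using carrierD(1)[OF f] by (intro ext) (simp add: add_apply zero_apply K.l_neg)
  ultimately show "\<exists>g \<in> carrier F. g \<oplus>\<^bsub>F\<^esub> f = \<zero>\<^bsub>F\<^esub>" by blast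
qed (rule zero_closed)

text \<open>The induction clears one point of the support at a time.\<close>

lemma monomial_induct [consumes 1, case_names zero monomial add]:
  assumes "f \<in> carrier F" and zero: "P \<zero>\<^bsub>F\<^esub>"
    and mono: "\<And>c p. c \<in> carrier K \<Longrightarrow> p \<in> carrier M \<Longrightarrow> P (monomial K c p)"
    and add: "\<And>f g. f \<in> carrier F \<Longrightarrow> g \<in> carrier F \<Longrightarrow> P f \<Longrightarrow> P g \<Longrightarrow> P (f \<oplus>\<^bsub>F\<^esub> g)"
  shows "P f"
proof -
  have "P f" if "finite S" "supp f \<subseteq> S" "f \<in> carrier F" for S f
    using that
  proof (induction S arbitrary: f rule: finite_induct)
    case empty
    then have "f = \<zero>\<^bsub>F\<^esub>" by (auto simp: zero_apply)
    then show ?case using zero by simp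
  next
    case (insert p S)
    note f = carrierD[OF insert.prems(2)]
    let ?g = "f(p := \<zero>\<^bsub>K\<^esub>)"
    have sub: "supp ?g \<subseteq> supp f" "supp ?g \<subseteq> S" using insert.prems(1) by auto
    have g: "?g \<in> carrier F" unfolding mem_carrier_iff
    proof (intro conjI)
      show "\<forall>q. ?g q \<in> carrier K" using f(1) by simp
    qed (use finite_subset[OF sub(1) f(2)] subset_trans[OF sub(1) f(3)] in simp_all)
    show ?case
    proof (cases "f p = \<zero>\<^bsub>K\<^esub>")
      case True
      then have "?g = f" by auto
      then show ?thesis using insert.IH[OF sub(2) g] by simp
    next
      case False
      then have p: "p \<in> carrier M" using f(3) by auto
      have "f = monomial K (f p) p \<oplus>\<^bsub>F\<^esub> ?g"
        using f(1) by (intro ext) (simp add: add_apply monomial_def)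
      moreover have "P (monomial K (f p) p \<oplus>\<^bsub>F\<^esub> ?g)"
        by (rule add[OF monomial_closed[OF f(1) p] g mono[OF f(1) p] insert.IH[OF sub(2) g]])
      ultimately show ?thesis by simp
    qed
  qed
  then show ?thesis using carrierD(2)[OF assms(1)] assms(1) by blast
qed

text \<open>The definition sums over the exact supports, which change under addition. Allowing
  larger finite sets gives several products a common index set.\<close>

lemma mult_apply:
  assumes f: "f \<in> carrier F" and g: "g \<in> carrier F"
    and S: "finite S" "supp f \<subseteq> S" and U: "finite U" "supp g \<subseteq> U"
  shows "(f \<otimes>\<^bsub>F\<^esub> g) p =
    (\<Oplus>\<^bsub>K\<^esub>x \<in> {x \<in> S \<times> U. fst x \<otimes>\<^bsub>M\<^esub> snd x = p}. f (fst x) \<otimes>\<^bsub>K\<^esub> g (snd x))"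
proof -
  have "(f \<otimes>\<^bsub>F\<^esub> g) p = (\<Oplus>\<^bsub>K\<^esub>x \<in> {(q, r). f q \<noteq> \<zero>\<^bsub>K\<^esub> \<and> g r \<noteq> \<zero>\<^bsub>K\<^esub> \<and> q \<otimes>\<^bsub>M\<^esub> r = p}.
      f (fst x) \<otimes>\<^bsub>K\<^esub> g (snd x))"
    by (simp add: monoid_algebra_def)
  also have "\<dots> =
    (\<Oplus>\<^bsub>K\<^esub>x \<in> {x \<in> S \<times> U. fst x \<otimes>\<^bsub>M\<^esub> snd x = p}. f (fst x) \<otimes>\<^bsub>K\<^esub> g (snd x))"
    by (rule K.add.finprod_mono_neutral_cong_left)
      (use S U carrierD(1)[OF f] carrierD(1)[OF g] in auto)
  finally show ?thesis .
qed

lemma mult_closed: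
  assumes f: "f \<in> carrier F" and g: "g \<in> carrier F"
  shows "f \<otimes>\<^bsub>F\<^esub> g \<in> carrier F"
proof -
  note F = carrierD[OF f] and G = carrierD[OF g]
  note eq = mult_apply[OF f g F(2) subset_refl G(2) subset_refl]
  let ?I = "(\<lambda>x. fst x \<otimes>\<^bsub>M\<^esub> snd x) ` (supp f \<times> supp g)"
  have "(f \<otimes>\<^bsub>F\<^esub> g) p = \<zero>\<^bsub>K\<^esub>" if p: "p \<notin> ?I" for p
  proof -
    have e: "{x \<in> supp f \<times> supp g. fst x \<otimes>\<^bsub>M\<^esub> snd x = p} = {}" using p by force
    show ?thesis unfolding eq e by simp
  qed
  then have sub: "supp (f \<otimes>\<^bsub>F\<^esub> g) \<subseteq> ?I" by blast
  then have "finite (supp (f \<otimes>\<^bsub>F\<^esub> g))" by (rule finite_subset) (use F G in simp)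
  moreover have "?I \<subseteq> carrier M" using F(3) G(3) by (auto simp: subset_iff)
  moreover have "(f \<otimes>\<^bsub>F\<^esub> g) p \<in> carrier K" for p
    unfolding eq using F(1) G(1) by (intro K.finsum_closed) auto
  ultimately show ?thesis using sub unfolding mem_carrier_iff by blast
qed

lemma mult_comm:
  assumes f: "f \<in> carrier F" and g: "g \<in> carrier F"
  shows "f \<otimes>\<^bsub>F\<^esub> g = g \<otimes>\<^bsub>F\<^esub> f"
proof
  fix p
  note F = carrierD[OF f] and G = carrierD[OF g]
  let ?A = "{x \<in> supp f \<times> supp g. fst x \<otimes>\<^bsub>M\<^esub> snd x = p}"
  let ?B = "{x \<in> supp g \<times> supp f. fst x \<otimes>\<^bsub>M\<^esub> snd x = p}"
  have B: "?B = prod.swap ` ?A"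
  proof (rule Set.set_eqI)
    fix x :: "'m \<times> 'm"
    obtain q r where x: "x = (q, r)" by (cases x)
    show "x \<in> ?B \<longleftrightarrow> x \<in> prod.swap ` ?A"
      unfolding x using F(3) G(3) M.m_comm[of q r] by (auto simp: image_iff subset_iff)
  qed
  have "(g \<otimes>\<^bsub>F\<^esub> f) p = (\<Oplus>\<^bsub>K\<^esub>x \<in> prod.swap ` ?A. g (fst x) \<otimes>\<^bsub>K\<^esub> f (snd x))"
    using mult_apply[OF g f G(2) subset_refl F(2) subset_refl, of p] unfolding B .
  also have "\<dots> = (\<Oplus>\<^bsub>K\<^esub>x \<in> ?A. g (fst (prod.swap x)) \<otimes>\<^bsub>K\<^esub> f (snd (prod.swap x)))"
    by (rule K.finsum_reindex) (use F(1) G(1) in \<open>auto simp: inj_on_def\<close>)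
  also have "\<dots> = (\<Oplus>\<^bsub>K\<^esub>x \<in> ?A. f (fst x) \<otimes>\<^bsub>K\<^esub> g (snd x))"
    by (rule K.finsum_cong') (use F(1) G(1) in \<open>auto simp: K.m_comm\<close>)
  also have "\<dots> = (f \<otimes>\<^bsub>F\<^esub> g) p"
    using mult_apply[OF f g F(2) subset_refl G(2) subset_refl] by simp
  finally show "(f \<otimes>\<^bsub>F\<^esub> g) p = (g \<otimes>\<^bsub>F\<^esub> f) p" by simp
qed

lemma mult_l_distr:
  assumes f: "f \<in> carrier F" and g: "g \<in> carrier F" and h: "h \<in> carrier F"
  shows "(f \<oplus>\<^bsub>F\<^esub> g) \<otimes>\<^bsub>F\<^esub> h = f \<otimes>\<^bsub>F\<^esub> h \<oplus>\<^bsub>F\<^esub> g \<otimes>\<^bsub>F\<^esub> h"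
proof
  fix p
  note F = carrierD[OF f] and G = carrierD[OF g] and H = carrierD[OF h]
  let ?S = "supp f \<union> supp g"
  let ?A = "{x \<in> ?S \<times> supp h. fst x \<otimes>\<^bsub>M\<^esub> snd x = p}"
  have S: "finite ?S" using F G by simp
  have eq: "(u \<otimes>\<^bsub>F\<^esub> h) p = (\<Oplus>\<^bsub>K\<^esub>x \<in> ?A. u (fst x) \<otimes>\<^bsub>K\<^esub> h (snd x))"
    if "u \<in> carrier F" "supp u \<subseteq> ?S" for u
    by (rule mult_apply[OF that(1) h S that(2) H(2) subset_refl])
  have sfg: "supp (f \<oplus>\<^bsub>F\<^esub> g) \<subseteq> ?S" by (auto simp: add_apply)
  have "((f \<oplus>\<^bsub>F\<^esub> g) \<otimes>\<^bsub>F\<^esub> h) p =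
      (\<Oplus>\<^bsub>K\<^esub>x \<in> ?A. f (fst x) \<otimes>\<^bsub>K\<^esub> h (snd x) \<oplus>\<^bsub>K\<^esub> g (fst x) \<otimes>\<^bsub>K\<^esub> h (snd x))"
    unfolding eq[OF add_closed[OF f g] sfg]
    by (rule K.finsum_cong') (use F(1) G(1) H(1) in \<open>auto simp: add_apply K.l_distr\<close>)
  also have "\<dots> = (f \<otimes>\<^bsub>F\<^esub> h) p \<oplus>\<^bsub>K\<^esub> (g \<otimes>\<^bsub>F\<^esub> h) p"
    unfolding eq[OF f Un_upper1] eq[OF g Un_upper2]
    by (rule K.finsum_addf) (use F(1) G(1) H(1) in auto)
  finally show "((f \<oplus>\<^bsub>F\<^esub> g) \<otimes>\<^bsub>F\<^esub> h) p = (f \<otimes>\<^bsub>F\<^esub> h \<oplus>\<^bsub>F\<^esub> g \<otimes>\<^bsub>F\<^esub> h) p"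
    by (simp add: add_apply)
qed

lemma mult_r_distr:
  assumes "f \<in> carrier F" "g \<in> carrier F" "h \<in> carrier F"
  shows "h \<otimes>\<^bsub>F\<^esub> (f \<oplus>\<^bsub>F\<^esub> g) = h \<otimes>\<^bsub>F\<^esub> f \<oplus>\<^bsub>F\<^esub> h \<otimes>\<^bsub>F\<^esub> g"
  using mult_l_distr[OF assms] assms
  by (simp add: mult_comm[of h] add_closed)

lemma monomial_mult:
  assumes c: "c \<in> carrier K" "d \<in> carrier K" and p: "p \<in> carrier M" "q \<in> carrier M"
  shows "monomial K c p \<otimes>\<^bsub>F\<^esub> monomial K d q = monomial K (c \<otimes>\<^bsub>K\<^esub> d) (p \<otimes>\<^bsub>M\<^esub> q)"
proof
  fix r
  have eq: "(monomial K c p \<otimes>\<^bsub>F\<^esub> monomial K d q) r =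
    (\<Oplus>\<^bsub>K\<^esub>x \<in> {x \<in> {p} \<times> {q}. fst x \<otimes>\<^bsub>M\<^esub> snd x = r}.
      monomial K c p (fst x) \<otimes>\<^bsub>K\<^esub> monomial K d q (snd x))"
    by (rule mult_apply) (use c p monomial_closed in \<open>auto simp: monomial_def\<close>)
  show "(monomial K c p \<otimes>\<^bsub>F\<^esub> monomial K d q) r = monomial K (c \<otimes>\<^bsub>K\<^esub> d) (p \<otimes>\<^bsub>M\<^esub> q) r"
  proof (cases "r = p \<otimes>\<^bsub>M\<^esub> q")
    case True
    then have e: "{x \<in> {p} \<times> {q}. fst x \<otimes>\<^bsub>M\<^esub> snd x = r} = {(p, q)}" by auto
    show ?thesis unfolding eq e using c True by (simp add: monomial_def)
  next
    case False
    then have e: "{x \<in> {p} \<times> {q}. fst x \<otimes>\<^bsub>M\<^esub> snd x = r} = {}" by auto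
    show ?thesis unfolding eq e using False by (simp add: monomial_def)
  qed
qed

lemma mult_zero:
  assumes f: "f \<in> carrier F"
  shows "\<zero>\<^bsub>F\<^esub> \<otimes>\<^bsub>F\<^esub> f = \<zero>\<^bsub>F\<^esub>"
proof -
  interpret abelian_group F by (rule F_abelian_group)
  have "\<zero>\<^bsub>F\<^esub> \<otimes>\<^bsub>F\<^esub> f = \<zero>\<^bsub>F\<^esub> \<otimes>\<^bsub>F\<^esub> f \<oplus>\<^bsub>F\<^esub> \<zero>\<^bsub>F\<^esub> \<otimes>\<^bsub>F\<^esub> f"
    using mult_l_distr[OF zero_closed zero_closed f] by simp
  then show ?thesis using mult_closed[OF zero_closed f] add.r_cancel_one' by metis
qed

text \<open>Distributivity, established beforehand, reduces the claim to three monomials, where it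
  is associativity in \<open>K\<close> and \<open>M\<close>; no double sums have to be
  rearranged.\<close>

lemma mult_assoc:
  assumes f: "f \<in> carrier F" and g: "g \<in> carrier F" and h: "h \<in> carrier F"
  shows "(f \<otimes>\<^bsub>F\<^esub> g) \<otimes>\<^bsub>F\<^esub> h = f \<otimes>\<^bsub>F\<^esub> (g \<otimes>\<^bsub>F\<^esub> h)"
  using f
proof (induction f rule: monomial_induct)
  case zero
  then show ?case using g h by (simp add: mult_zero mult_closed)
next
  case (add f f')
  then show ?case using g h by (simp add: mult_l_distr mult_closed)
next
  case (monomial c p)
  note m = monomial_closed[OF monomial]
  note z = mult_comm[OF zero_closed, symmetric] mult_zero
  show ?case
    using g
  proof (induction g rule: monomial_induct)
    case zero
    then show ?case using m h by (simp add: z mult_closed zero_closed)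
  next
    case (add g g')
    then show ?case using m h by (simp add: mult_l_distr mult_r_distr mult_closed)
  next
    case (monomial d q)
    note m' = monomial_closed[OF monomial]
    show ?case
      using h
    proof (induction h rule: monomial_induct)
      case zero
      then show ?case using m m' by (simp add: z mult_closed zero_closed)
    next
      case (add h h')
      then show ?case using m m' by (simp add: mult_r_distr mult_closed)
    next
      case (monomial e r)
      then show ?case using \<open>c \<in> carrier K\<close> \<open>p \<in> carrier M\<close> \<open>d \<in> carrier K\<close> \<open>q \<in> carrier M\<close>
        by (simp add: monomial_mult K.m_assoc M.m_assoc)
    qed
  qed
qed

lemma mult_one:
  assumes "f \<in> carrier F"
  shows "\<one>\<^bsub>F\<^esub> \<otimes>\<^bsub>F\<^esub> f = f"
  using assms
proof (induction f rule: monomial_induct)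
  case zero
  have o: "\<one>\<^bsub>F\<^esub> \<in> carrier F" unfolding one_eq by (rule monomial_closed) simp_all
  show ?case using mult_comm[OF o zero_closed] mult_zero[OF o] by simp
next
  case (monomial c p)
  then show ?case by (simp add: one_eq monomial_mult)
next
  case (add f g)
  have o: "\<one>\<^bsub>F\<^esub> \<in> carrier F" unfolding one_eq by (rule monomial_closed) simp_all
  show ?case using add o by (simp add: mult_r_distr)
qed

lemma F_cring: "cring F"
proof (intro cringI comm_monoidI F_abelian_group)
  show "\<one>\<^bsub>F\<^esub> \<in> carrier F" unfolding one_eq by (rule monomial_closed) simp_all
qed (auto intro: mult_closed mult_assoc mult_one mult_comm mult_l_distr)

end

text \<open>On finitely supported families, the linear map out of the free module on
  \<open>M\<close> that sends the basis element \<open>p\<close> to \<open>b p\<close>.\<close>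

definition linear_extension ::
  "('k, 'r) ring_scheme \<Rightarrow> ('k, 'c, 's) module_scheme \<Rightarrow> ('m \<Rightarrow> 'c) \<Rightarrow> ('m \<Rightarrow> 'k) \<Rightarrow> 'c" where
  "linear_extension K C b f = (\<Oplus>\<^bsub>C\<^esub>p \<in> {p. f p \<noteq> \<zero>\<^bsub>K\<^esub>}. f p \<odot>\<^bsub>C\<^esub> b p)"

locale monoid_algebra_module = comm_monoid_algebra K M + C: module K C
  for K :: "('k, 'r) ring_scheme" and M :: "('m, 's) monoid_scheme"
    and C :: "('k, 'c, 't) module_scheme"
begin

abbreviation L :: "('m \<Rightarrow> 'c) \<Rightarrow> ('m \<Rightarrow> 'k) \<Rightarrow> 'c" where "L \<equiv> linear_extension K C"

lemma L_eq:
  assumes f: "f \<in> carrier F" and b: "\<And>p. p \<in> carrier M \<Longrightarrow> b p \<in> carrier C"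
    and S: "finite S" "supp f \<subseteq> S" "S \<subseteq> carrier M"
  shows "L b f = (\<Oplus>\<^bsub>C\<^esub>p \<in> S. f p \<odot>\<^bsub>C\<^esub> b p)"
  unfolding linear_extension_def
proof (rule C.M.add.finprod_mono_neutral_cong_left)
  show "f p \<odot>\<^bsub>C\<^esub> b p = \<zero>\<^bsub>C\<^esub>" if "p \<in> S - supp f" for p using that b S(3) by auto
  show "(\<lambda>p. f p \<odot>\<^bsub>C\<^esub> b p) \<in> S \<rightarrow> carrier C" using b S(3) carrierD(1)[OF f] by auto
qed (use S in auto)

lemma L_closed:
  assumes f: "f \<in> carrier F" and b: "\<And>p. p \<in> carrier M \<Longrightarrow> b p \<in> carrier C"
  shows "L b f \<in> carrier C"
  unfolding linear_extension_def
  by (rule C.M.finsum_closed) (use b carrierD[OF f] in auto)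

lemma L_add:
  assumes f: "f \<in> carrier F" and g: "g \<in> carrier F" and b: "\<And>p. p \<in> carrier M \<Longrightarrow> b p \<in> carrier C"
  shows "L b (f \<oplus>\<^bsub>F\<^esub> g) = L b f \<oplus>\<^bsub>C\<^esub> L b g"
proof -
  note F = carrierD[OF f] and G = carrierD[OF g]
  let ?S = "supp f \<union> supp g"
  have S: "finite ?S" "?S \<subseteq> carrier M" using F G by auto
  have sfg: "supp (f \<oplus>\<^bsub>F\<^esub> g) \<subseteq> ?S" by (auto simp: add_apply)
  have eq: "L b u = (\<Oplus>\<^bsub>C\<^esub>p \<in> ?S. u p \<odot>\<^bsub>C\<^esub> b p)" if "u \<in> carrier F" "supp u \<subseteq> ?S" for u
    by (rule L_eq[OF that(1) b S(1) that(2) S(2)])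
  have "L b (f \<oplus>\<^bsub>F\<^esub> g) = (\<Oplus>\<^bsub>C\<^esub>p \<in> ?S. f p \<odot>\<^bsub>C\<^esub> b p \<oplus>\<^bsub>C\<^esub> g p \<odot>\<^bsub>C\<^esub> b p)"
    unfolding eq[OF add_closed[OF f g] sfg]
    by (rule C.M.finsum_cong') (use F G b in \<open>auto simp: add_apply C.smult_l_distr\<close>)
  also have "\<dots> = L b f \<oplus>\<^bsub>C\<^esub> L b g"
    unfolding eq[OF f Un_upper1] eq[OF g Un_upper2]
    by (rule C.M.finsum_addf) (use F G b in auto)
  finally show ?thesis .
qed

lemma L_zero: "L b \<zero>\<^bsub>F\<^esub> = \<zero>\<^bsub>C\<^esub>"
  by (simp add: linear_extension_def zero_apply)

lemma L_monomial:
  assumes c: "c \<in> carrier K" and p: "p \<in> carrier M" and b: "\<And>p. p \<in> carrier M \<Longrightarrow> b p \<in> carrier C"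
  shows "L b (monomial K c p) = c \<odot>\<^bsub>C\<^esub> b p"
proof -
  have "L b (monomial K c p) = (\<Oplus>\<^bsub>C\<^esub>q \<in> {p}. monomial K c p q \<odot>\<^bsub>C\<^esub> b q)"
    by (rule L_eq[OF monomial_closed[OF c p] b]) (use p in \<open>auto simp: monomial_def\<close>)
  then show ?thesis using c b[OF p] by (simp add: monomial_def)
qed

lemma L_minus:
  assumes f: "f \<in> carrier F" and g: "g \<in> carrier F" and b: "\<And>p. p \<in> carrier M \<Longrightarrow> b p \<in> carrier C"
  shows "L b (f \<ominus>\<^bsub>F\<^esub> g) = L b f \<ominus>\<^bsub>C\<^esub> L b g"
proof -
  interpret F: cring F by (rule F_cring)
  have fg: "f \<ominus>\<^bsub>F\<^esub> g \<in> carrier F" using f g by simp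
  have "L b f = L b ((f \<ominus>\<^bsub>F\<^esub> g) \<oplus>\<^bsub>F\<^esub> g)"
    using f g by (simp add: a_minus_def F.a_assoc F.l_neg)
  also have "\<dots> = L b (f \<ominus>\<^bsub>F\<^esub> g) \<oplus>\<^bsub>C\<^esub> L b g" by (rule L_add[OF fg g b])
  finally show ?thesis
    using L_closed[OF fg b] L_closed[OF g b] by (simp add: a_minus_def C.M.a_assoc C.M.r_neg)
qed

text \<open>Multiplication by a monomial on the argument becomes a translation of the map
  \<open>b\<close>; this turns closure under multiplication into a property of the family of maps
  \<open>b\<close>.\<close>

lemma L_monomial_mult:
  assumes c: "c \<in> carrier K" and p: "p \<in> carrier M" and f: "f \<in> carrier F"
    and b: "\<And>p. p \<in> carrier M \<Longrightarrow> b p \<in> carrier C"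
  shows "L b (monomial K c p \<otimes>\<^bsub>F\<^esub> f) = c \<odot>\<^bsub>C\<^esub> L (\<lambda>q. b (p \<otimes>\<^bsub>M\<^esub> q)) f"
proof -
  interpret F: cring F by (rule F_cring)
  have m: "monomial K c p \<in> carrier F" by (rule monomial_closed[OF c p])
  have b': "b (p \<otimes>\<^bsub>M\<^esub> q) \<in> carrier C" if "q \<in> carrier M" for q using that p b by simp
  show ?thesis
    using f
  proof (induction f rule: monomial_induct)
    case zero
    then show ?case using m c by (simp add: L_zero)
  next
    case (monomial d q)
    then show ?case using c p b b'
      by (simp add: monomial_mult L_monomial C.smult_assoc1)
  next
    case (add f g)
    have "L b (monomial K c p \<otimes>\<^bsub>F\<^esub> (f \<oplus>\<^bsub>F\<^esub> g)) =
        L b (monomial K c p \<otimes>\<^bsub>F\<^esub> f) \<oplus>\<^bsub>C\<^esub> L b (monomial K c p \<otimes>\<^bsub>F\<^esub> g)"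
      using add.hyps m by (simp add: F.r_distr L_add b)
    then show ?case using add c b'
      by (simp add: L_add L_closed C.smult_r_distr)
  qed
qed

end

section \<open>The universal property of the tensor algebra\<close>

definition bilinear_map ::
  "('k, 'r) ring_scheme \<Rightarrow> ('k, 'a, 's) module_scheme \<Rightarrow> ('k, 'b, 't) module_scheme
    \<Rightarrow> ('k, 'c, 'u) module_scheme \<Rightarrow> ('a \<times> 'b \<Rightarrow> 'c) \<Rightarrow> bool" where
  "bilinear_map K A B C h \<longleftrightarrow>
    (\<forall>a \<in> carrier A. \<forall>b \<in> carrier B. h (a, b) \<in> carrier C) \<and>
    (\<forall>a \<in> carrier A. \<forall>a' \<in> carrier A. \<forall>b \<in> carrier B. h (a \<oplus>\<^bsub>A\<^esub> a', b) = h (a, b) \<oplus>\<^bsub>C\<^esub> h (a', b)) \<and>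
    (\<forall>a \<in> carrier A. \<forall>b \<in> carrier B. \<forall>b' \<in> carrier B. h (a, b \<oplus>\<^bsub>B\<^esub> b') = h (a, b) \<oplus>\<^bsub>C\<^esub> h (a, b')) \<and>
    (\<forall>c \<in> carrier K. \<forall>a \<in> carrier A. \<forall>b \<in> carrier B. h (c \<odot>\<^bsub>A\<^esub> a, b) = c \<odot>\<^bsub>C\<^esub> h (a, b)) \<and>
    (\<forall>c \<in> carrier K. \<forall>a \<in> carrier A. \<forall>b \<in> carrier B. h (a, c \<odot>\<^bsub>B\<^esub> b) = c \<odot>\<^bsub>C\<^esub> h (a, b))"

lemma bilinear_mapD:
  assumes "bilinear_map K A B C h"
  shows "a \<in> carrier A \<Longrightarrow> b \<in> carrier B \<Longrightarrow> h (a, b) \<in> carrier C"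
    "a \<in> carrier A \<Longrightarrow> a' \<in> carrier A \<Longrightarrow> b \<in> carrier B \<Longrightarrow>
      h (a \<oplus>\<^bsub>A\<^esub> a', b) = h (a, b) \<oplus>\<^bsub>C\<^esub> h (a', b)"
    "a \<in> carrier A \<Longrightarrow> b \<in> carrier B \<Longrightarrow> b' \<in> carrier B \<Longrightarrow>
      h (a, b \<oplus>\<^bsub>B\<^esub> b') = h (a, b) \<oplus>\<^bsub>C\<^esub> h (a, b')"
    "c \<in> carrier K \<Longrightarrow> a \<in> carrier A \<Longrightarrow> b \<in> carrier B \<Longrightarrow> h (c \<odot>\<^bsub>A\<^esub> a, b) = c \<odot>\<^bsub>C\<^esub> h (a, b)"
    "c \<in> carrier K \<Longrightarrow> a \<in> carrier A \<Longrightarrow> b \<in> carrier B \<Longrightarrow> h (a, c \<odot>\<^bsub>B\<^esub> b) = c \<odot>\<^bsub>C\<^esub> h (a, b)"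
  using assms by (auto simp: bilinear_map_def)

lemma DirProd_comm_monoid:
  assumes "comm_monoid G" "comm_monoid H"
  shows "comm_monoid (G \<times>\<times> H)"
proof -
  interpret G: comm_monoid G by fact
  interpret H: comm_monoid H by fact
  show ?thesis
    by (rule comm_monoidI) (auto simp: G.m_ac H.m_ac)
qed

locale tensor_construction = A: algebra K A + B: algebra K B
  for K :: "('k, 'r) ring_scheme" and A :: "('k, 'a, 's) module_scheme"
    and B :: "('k, 'b, 't) module_scheme"

sublocale tensor_construction \<subseteq> comm_monoid_algebra K "A \<times>\<times> B"
  by (intro comm_monoid_algebra.intro DirProd_comm_monoid A.R_cring
      cring.axioms(2) A.M_cring B.M_cring)

context tensor_construction
begin

lemma monomial_pair_closed: "c \<in> carrier K \<Longrightarrow> a \<in> carrier A \<Longrightarrow> b \<in> carrier B \<Longrightarrow>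
    monomial K c (a, b) \<in> carrier F"
  by (rule monomial_closed) simp_all

interpretation F: cring F by (rule F_cring)

lemma bilinear_relations_closed: "bilinear_relations K A B \<subseteq> carrier F"
  unfolding bilinear_relations_def Let_def
  by (auto intro!: F.minus_closed monomial_pair_closed)

lemma kernel_ideal: "ideal (tensor_kernel K A B) F"
  unfolding tensor_kernel_def by (rule F.genideal_ideal[OF bilinear_relations_closed])

interpretation N: ideal "tensor_kernel K A B" F by (rule kernel_ideal)

abbreviation T :: "('a \<times> 'b \<Rightarrow> 'k) set ring" where "T \<equiv> tensor_algebra K A B"
abbreviation \<pi> :: "('a \<times> 'b \<Rightarrow> 'k) \<Rightarrow> ('a \<times> 'b \<Rightarrow> 'k) set" where
  "\<pi> f \<equiv> tensor_kernel K A B +>\<^bsub>F\<^esub> f"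

lemma T_cring: "cring T"
  unfolding tensor_algebra_def by (rule N.quotient_is_cring[OF F_cring])

lemma proj_ring_hom: "ring_hom_ring F T \<pi>"
  unfolding tensor_algebra_def by (rule N.rcos_ring_hom_ring)

interpretation T: cring T by (rule T_cring)

interpretation proj: ring_hom_ring F T \<pi> by (rule proj_ring_hom)

lemma carrier_T: "carrier T = \<pi> ` carrier F"
  unfolding tensor_algebra_def FactRing_def A_RCOSETS_def' by (simp add: UNION_singleton_eq_range)

lemma proj_eq_iff:
  assumes f: "f \<in> carrier F" and g: "g \<in> carrier F"
  shows "\<pi> f = \<pi> g \<longleftrightarrow> f \<ominus>\<^bsub>F\<^esub> g \<in> tensor_kernel K A B"
  using F.quotient_eq_iff_same_a_r_cos[OF kernel_ideal f g] by blast

lemma relation_mem: "r \<in> bilinear_relations K A B \<Longrightarrow> r \<in> tensor_kernel K A B"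
  unfolding tensor_kernel_def using F.genideal_self[OF bilinear_relations_closed] by blast

lemma proj_add_relation:
  assumes f: "f \<in> carrier F" "g \<in> carrier F" "h \<in> carrier F"
    and r: "f \<ominus>\<^bsub>F\<^esub> g \<ominus>\<^bsub>F\<^esub> h \<in> bilinear_relations K A B"
  shows "\<pi> f = \<pi> g \<oplus>\<^bsub>T\<^esub> \<pi> h"
proof -
  have "f \<ominus>\<^bsub>F\<^esub> (g \<oplus>\<^bsub>F\<^esub> h) = f \<ominus>\<^bsub>F\<^esub> g \<ominus>\<^bsub>F\<^esub> h"
    using f by (simp add: a_minus_def F.minus_add F.a_assoc)
  then have "\<pi> f = \<pi> (g \<oplus>\<^bsub>F\<^esub> h)" using proj_eq_iff[of f "g \<oplus>\<^bsub>F\<^esub> h"] f relation_mem[OF r] by simp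
  then show ?thesis using proj.hom_add f by simp
qed

lemma pure_tensor_eq: "pure_tensor K A B a b = \<pi> (monomial K \<one>\<^bsub>K\<^esub> (a, b))"
  by (simp add: pure_tensor_def)

text \<open>Scaling either factor gives the class of the same monomial, whence balancedness. Read
  backwards, it absorbs a coefficient into a pure tensor.\<close>

lemma pure_tensor_scale_l:
  assumes "c \<in> carrier K" "a \<in> carrier A" "b \<in> carrier B"
  shows "pure_tensor K A B (c \<odot>\<^bsub>A\<^esub> a) b = \<pi> (monomial K c (a, b))"
proof -
  have "monomial K \<one>\<^bsub>K\<^esub> (c \<odot>\<^bsub>A\<^esub> a, b) \<ominus>\<^bsub>F\<^esub> monomial K c (a, b) \<in> bilinear_relations K A B"
    using assms unfolding bilinear_relations_def Let_def by blast
  then show ?thesis unfolding pure_tensor_eq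
    using assms by (subst proj_eq_iff) (auto intro: monomial_pair_closed relation_mem)
qed

lemma pure_tensor_scale_r:
  assumes "c \<in> carrier K" "a \<in> carrier A" "b \<in> carrier B"
  shows "pure_tensor K A B a (c \<odot>\<^bsub>B\<^esub> b) = \<pi> (monomial K c (a, b))"
proof -
  have "monomial K \<one>\<^bsub>K\<^esub> (a, c \<odot>\<^bsub>B\<^esub> b) \<ominus>\<^bsub>F\<^esub> monomial K c (a, b) \<in> bilinear_relations K A B"
    using assms unfolding bilinear_relations_def Let_def by blast
  then show ?thesis unfolding pure_tensor_eq
    using assms by (subst proj_eq_iff) (auto intro: monomial_pair_closed relation_mem)
qed

lemma pure_tensor_add_l:
  assumes "a \<in> carrier A" "a' \<in> carrier A" "b \<in> carrier B"
  shows "pure_tensor K A B (a \<oplus>\<^bsub>A\<^esub> a') b = pure_tensor K A B a b \<oplus>\<^bsub>T\<^esub> pure_tensor K A B a' b"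
  unfolding pure_tensor_eq
proof (rule proj_add_relation)
  show "monomial K \<one>\<^bsub>K\<^esub> (a \<oplus>\<^bsub>A\<^esub> a', b) \<ominus>\<^bsub>F\<^esub> monomial K \<one>\<^bsub>K\<^esub> (a, b)
      \<ominus>\<^bsub>F\<^esub> monomial K \<one>\<^bsub>K\<^esub> (a', b) \<in> bilinear_relations K A B"
    using assms unfolding bilinear_relations_def Let_def by blast
qed (use assms in \<open>auto intro: monomial_pair_closed\<close>)

lemma pure_tensor_add_r:
  assumes "a \<in> carrier A" "b \<in> carrier B" "b' \<in> carrier B"
  shows "pure_tensor K A B a (b \<oplus>\<^bsub>B\<^esub> b') = pure_tensor K A B a b \<oplus>\<^bsub>T\<^esub> pure_tensor K A B a b'"
  unfolding pure_tensor_eq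
proof (rule proj_add_relation)
  show "monomial K \<one>\<^bsub>K\<^esub> (a, b \<oplus>\<^bsub>B\<^esub> b') \<ominus>\<^bsub>F\<^esub> monomial K \<one>\<^bsub>K\<^esub> (a, b)
      \<ominus>\<^bsub>F\<^esub> monomial K \<one>\<^bsub>K\<^esub> (a, b') \<in> bilinear_relations K A B"
    using assms unfolding bilinear_relations_def Let_def by blast
qed (use assms in \<open>auto intro: monomial_pair_closed\<close>)

lemma pure_tensor_closed:
  "a \<in> carrier A \<Longrightarrow> b \<in> carrier B \<Longrightarrow> pure_tensor K A B a b \<in> carrier T"
  unfolding pure_tensor_eq carrier_T by (intro imageI monomial_pair_closed) simp_all

lemma pure_tensor_mult:
  assumes "a \<in> carrier A" "b \<in> carrier B" "a' \<in> carrier A" "b' \<in> carrier B"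
  shows "pure_tensor K A B a b \<otimes>\<^bsub>T\<^esub> pure_tensor K A B a' b' =
    pure_tensor K A B (a \<otimes>\<^bsub>A\<^esub> a') (b \<otimes>\<^bsub>B\<^esub> b')"
  unfolding pure_tensor_eq
  using assms by (simp add: monomial_pair_closed monomial_mult flip: proj.hom_mult)

lemma pure_tensor_one: "pure_tensor K A B \<one>\<^bsub>A\<^esub> \<one>\<^bsub>B\<^esub> = \<one>\<^bsub>T\<^esub>"
  unfolding pure_tensor_eq using one_eq proj.hom_one by simp

lemma carrier_T_span: "carrier T = tensor_span T (pure_tensor K A B) (carrier A) (carrier B)"
proof (rule equalityI)
  have g: "{pure_tensor K A B a b | a b. a \<in> carrier A \<and> b \<in> carrier B} \<subseteq> carrier T"
    using pure_tensor_closed by auto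
  note r = T.add_generateD[OF g, folded tensor_span_def]
  show "tensor_span T (pure_tensor K A B) (carrier A) (carrier B) \<subseteq> carrier T" by (rule r(1))
  have "\<pi> f \<in> tensor_span T (pure_tensor K A B) (carrier A) (carrier B)" if "f \<in> carrier F" for f
    using that
  proof (induction f rule: monomial_induct)
    case zero
    then show ?case using r(3) proj.hom_zero by simp
  next
    case (monomial c p)
    then obtain a b where p: "p = (a, b)" "a \<in> carrier A" "b \<in> carrier B" by auto
    \<comment> \<open>The coefficient \<open>c\<close> goes into the left factor, so sums of pure
      tensors suffice to span.\<close>
    have "pure_tensor K A B (c \<odot>\<^bsub>A\<^esub> a) b \<in> tensor_span T (pure_tensor K A B) (carrier A) (carrier B)"
      by (rule subsetD[OF r(2)]) (use p monomial in auto)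
    then show ?case using pure_tensor_scale_l[OF monomial(1) p(2,3)] p(1) by simp
  next
    case (add f g)
    then show ?case using r(4) proj.hom_add by simp
  qed
  then show "carrier T \<subseteq> tensor_span T (pure_tensor K A B) (carrier A) (carrier B)"
    unfolding carrier_T by auto
qed

text \<open>The common kernel of all linear extensions of bilinear maps is an ideal, since translating a
  bilinear map by \<open>(a, b)\<close> gives a bilinear map. As it contains the relations, it contains the
  ideal they generate.\<close>

lemma linear_extension_kernel:
  assumes C: "module K C" and h: "bilinear_map K A B C h" and f: "f \<in> tensor_kernel K A B"
  shows "linear_extension K C h f = \<zero>\<^bsub>C\<^esub>"
proof -
  interpret C: module K C by (rule C)
  interpret LC: monoid_algebra_module K "A \<times>\<times> B" C
    by (intro monoid_algebra_module.intro comm_monoid_algebra_axioms C)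
  \<comment> \<open>The kernel of a single extension need not be closed under multiplication, so
    \<open>N\<close> takes all bilinear maps into the fixed module \<open>C\<close>
    together.\<close>
  define N where "N = {f \<in> carrier F. \<forall>h. bilinear_map K A B C h \<longrightarrow> linear_extension K C h f = \<zero>\<^bsub>C\<^esub>}"
  have hc: "h p \<in> carrier C" if "bilinear_map K A B C h" "p \<in> carrier (A \<times>\<times> B)" for h p
    using that bilinear_mapD(1) by (cases p) auto
  have shift: "bilinear_map K A B C (\<lambda>q. h ((a, b) \<otimes>\<^bsub>A \<times>\<times> B\<^esub> q))"
    if h: "bilinear_map K A B C h" and ab: "a \<in> carrier A" "b \<in> carrier B" for h a b
  proof -
    have 1: "a \<otimes>\<^bsub>A\<^esub> (c \<odot>\<^bsub>A\<^esub> x) = c \<odot>\<^bsub>A\<^esub> (a \<otimes>\<^bsub>A\<^esub> x)" if "c \<in> carrier K" "x \<in> carrier A" for c x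
      using that ab by (simp add: A.smult_assoc2 A.m_comm[of a])
    have 2: "b \<otimes>\<^bsub>B\<^esub> (c \<odot>\<^bsub>B\<^esub> x) = c \<odot>\<^bsub>B\<^esub> (b \<otimes>\<^bsub>B\<^esub> x)" if "c \<in> carrier K" "x \<in> carrier B" for c x
      using that ab by (simp add: B.smult_assoc2 B.m_comm[of b])
    show ?thesis
      unfolding bilinear_map_def using ab bilinear_mapD[OF h]
      by (auto simp: A.r_distr B.r_distr 1 2)
  qed
  have mono: "monomial K c (a, b) \<otimes>\<^bsub>F\<^esub> f \<in> N"
    if c: "c \<in> carrier K" "a \<in> carrier A" "b \<in> carrier B" and f: "f \<in> N" for c a b f
  proof -
    have fc: "f \<in> carrier F" using f by (simp add: N_def)
    have "linear_extension K C h (monomial K c (a, b) \<otimes>\<^bsub>F\<^esub> f) = \<zero>\<^bsub>C\<^esub>"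
      if h: "bilinear_map K A B C h" for h
    proof -
      have "linear_extension K C h (monomial K c (a, b) \<otimes>\<^bsub>F\<^esub> f) =
        c \<odot>\<^bsub>C\<^esub> linear_extension K C (\<lambda>q. h ((a, b) \<otimes>\<^bsub>A \<times>\<times> B\<^esub> q)) f"
        by (rule LC.L_monomial_mult[OF c(1) _ fc hc[OF h]]) (use c in auto)
      also have "\<dots> = \<zero>\<^bsub>C\<^esub>" using f shift[OF h c(2,3)] c(1) by (simp add: N_def)
      finally show ?thesis .
    qed
    then show ?thesis using fc c monomial_pair_closed by (simp add: N_def)
  qed
  have N_add: "f \<oplus>\<^bsub>F\<^esub> g \<in> N" if "f \<in> N" "g \<in> N" for f g
  proof -
    have c: "f \<in> carrier F" "g \<in> carrier F" using that by (simp_all add: N_def)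
    have "linear_extension K C h (f \<oplus>\<^bsub>F\<^esub> g) = \<zero>\<^bsub>C\<^esub>" if h: "bilinear_map K A B C h" for h
      using LC.L_add[OF c hc[OF h]] \<open>f \<in> N\<close> \<open>g \<in> N\<close> h by (simp add: N_def)
    then show ?thesis using c by (simp add: N_def)
  qed
  have N_zero: "\<zero>\<^bsub>F\<^esub> \<in> N" by (simp add: N_def LC.L_zero)
  have N_scale: "g \<otimes>\<^bsub>F\<^esub> f \<in> N" if f: "f \<in> N" and g: "g \<in> carrier F" for f g
  proof -
    have fc: "f \<in> carrier F" using f by (simp add: N_def)
    show ?thesis
      using g
    proof (induction g rule: monomial_induct)
      case zero
      then show ?case using fc N_zero by simp
    next
      case (monomial c p)
      then show ?case using mono f by (cases p) auto
    next
      case (add g g')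
      then show ?case using fc N_add by (simp add: F.l_distr)
    qed
  qed
  have "ideal N F"
  proof (rule idealI[OF F.ring_axioms])
    show "subgroup N (add_monoid F)"
    proof (rule F.add_subgroupI)
      show "N \<subseteq> carrier F" by (auto simp: N_def)
      show "\<ominus>\<^bsub>F\<^esub> f \<in> N" if f: "f \<in> N" for f
      proof -
        have "(\<ominus>\<^bsub>F\<^esub> \<one>\<^bsub>F\<^esub>) \<otimes>\<^bsub>F\<^esub> f = \<ominus>\<^bsub>F\<^esub> f"
          using f by (simp add: N_def F.l_minus)
        then show ?thesis using N_scale[OF f, of "\<ominus>\<^bsub>F\<^esub> \<one>\<^bsub>F\<^esub>"] by simp
      qed
    qed (use N_add N_zero in auto)
    show "g \<otimes>\<^bsub>F\<^esub> f \<in> N" if "f \<in> N" "g \<in> carrier F" for f g using N_scale[OF that] .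
    show "f \<otimes>\<^bsub>F\<^esub> g \<in> N" if "f \<in> N" "g \<in> carrier F" for f g
      using N_scale[OF that] that by (simp add: N_def F.m_comm)
  qed
  moreover have "bilinear_relations K A B \<subseteq> N"
  proof
    fix r assume r: "r \<in> bilinear_relations K A B"
    have rc: "r \<in> carrier F" using r bilinear_relations_closed by auto
    have "linear_extension K C h r = \<zero>\<^bsub>C\<^esub>" if h: "bilinear_map K A B C h" for h
    proof -
      note D = bilinear_mapD[OF h]
      have m: "linear_extension K C h (monomial K c (a, b)) = c \<odot>\<^bsub>C\<^esub> h (a, b)"
        if "c \<in> carrier K" "a \<in> carrier A" "b \<in> carrier B" for c a b
        by (rule LC.L_monomial[OF _ _ hc[OF h]]) (use that in auto)
      have mi: "linear_extension K C h (f \<ominus>\<^bsub>F\<^esub> g) = linear_extension K C h f \<ominus>\<^bsub>C\<^esub> linear_extension K C h g"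
        if "f \<in> carrier F" "g \<in> carrier F" for f g
        by (rule LC.L_minus[OF that hc[OF h]])
      have cancel1: "u \<ominus>\<^bsub>C\<^esub> u = \<zero>\<^bsub>C\<^esub>" if "u \<in> carrier C" for u
        using that by (simp add: a_minus_def C.M.r_neg)
      have "u \<oplus>\<^bsub>C\<^esub> v \<ominus>\<^bsub>C\<^esub> u = v" if "u \<in> carrier C" "v \<in> carrier C" for u v
        using that by (simp add: a_minus_def C.M.a_assoc C.M.r_neg C.M.a_comm[of u v])
      then have cancel: "u \<oplus>\<^bsub>C\<^esub> v \<ominus>\<^bsub>C\<^esub> u \<ominus>\<^bsub>C\<^esub> v = \<zero>\<^bsub>C\<^esub>"
        if "u \<in> carrier C" "v \<in> carrier C" for u v using that cancel1 by simp
      \<comment> \<open>The two additivity relations evaluate to \<open>u + v - u - v\<close>, the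
        two scaling relations to \<open>u - u\<close>.\<close>
      show ?thesis
        using r unfolding bilinear_relations_def Let_def
        by (elim UnE CollectE exE conjE)
          (simp_all add: m mi D cancel cancel1 monomial_pair_closed F.minus_closed)
    qed
    then show "r \<in> N" using rc by (simp add: N_def)
  qed
  ultimately have "tensor_kernel K A B \<subseteq> N"
    unfolding tensor_kernel_def by (rule F.genideal_minimal)
  then show ?thesis using f h by (auto simp: N_def)
qed

text \<open>The value at a class is read off from a chosen representative, and
  \<open>linear_extension_kernel\<close> makes the choice irrelevant. The three clauses are those
  required of a slice.\<close>

lemma universal_property:
  assumes C: "module K C" and h: "bilinear_map K A B C h"
  shows "\<exists>g. (\<forall>t \<in> carrier T. g t \<in> carrier C) \<and>
    (\<forall>s \<in> carrier T. \<forall>t \<in> carrier T. g (s \<oplus>\<^bsub>T\<^esub> t) = g s \<oplus>\<^bsub>C\<^esub> g t) \<and>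
    (\<forall>a \<in> carrier A. \<forall>b \<in> carrier B. g (pure_tensor K A B a b) = h (a, b))"
proof -
  interpret C: module K C by (rule C)
  interpret LC: monoid_algebra_module K "A \<times>\<times> B" C
    by (intro monoid_algebra_module.intro comm_monoid_algebra_axioms C)
  have hc: "h p \<in> carrier C" if "p \<in> carrier (A \<times>\<times> B)" for p
    using that bilinear_mapD(1)[OF h] by (cases p) auto
  let ?L = "linear_extension K C h"
  define g where "g t = ?L (SOME f. f \<in> carrier F \<and> \<pi> f = t)" for t
  have g: "g (\<pi> f) = ?L f" if f: "f \<in> carrier F" for f
  proof -
    let ?e = "SOME e. e \<in> carrier F \<and> \<pi> e = \<pi> f"
    have e: "?e \<in> carrier F \<and> \<pi> ?e = \<pi> f" by (rule someI[of _ f]) (use f in simp)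
    then have "?e \<ominus>\<^bsub>F\<^esub> f \<in> tensor_kernel K A B" using proj_eq_iff f by blast
    then have "?L (?e \<ominus>\<^bsub>F\<^esub> f) = \<zero>\<^bsub>C\<^esub>" by (rule linear_extension_kernel[OF C h])
    moreover have "?L (?e \<ominus>\<^bsub>F\<^esub> f) = ?L ?e \<ominus>\<^bsub>C\<^esub> ?L f"
      using e f by (intro LC.L_minus hc) auto
    ultimately have z: "?L ?e \<ominus>\<^bsub>C\<^esub> ?L f = \<zero>\<^bsub>C\<^esub>" by simp
    have c: "?L ?e \<in> carrier C" "?L f \<in> carrier C"
      using e f hc by (auto intro: LC.L_closed)
    then have "?L ?e = (?L ?e \<ominus>\<^bsub>C\<^esub> ?L f) \<oplus>\<^bsub>C\<^esub> ?L f"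
      by (simp add: a_minus_def C.M.a_assoc C.M.l_neg)
    then show ?thesis unfolding g_def z using c by simp
  qed
  show ?thesis
  proof (intro exI[of _ g] conjI ballI)
    show "g t \<in> carrier C" if t: "t \<in> carrier T" for t
    proof -
      obtain f where f: "f \<in> carrier F" "t = \<pi> f" using t unfolding carrier_T by auto
      then show ?thesis using g[OF f(1)] LC.L_closed[OF f(1) hc] by simp
    qed
    show "g (s \<oplus>\<^bsub>T\<^esub> t) = g s \<oplus>\<^bsub>C\<^esub> g t" if st: "s \<in> carrier T" "t \<in> carrier T" for s t
    proof -
      obtain e f where ef: "e \<in> carrier F" "s = \<pi> e" "f \<in> carrier F" "t = \<pi> f"
        using st unfolding carrier_T by auto
      have st_eq: "s \<oplus>\<^bsub>T\<^esub> t = \<pi> (e \<oplus>\<^bsub>F\<^esub> f)" using ef proj.hom_add by simp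
      have "g (s \<oplus>\<^bsub>T\<^esub> t) = ?L (e \<oplus>\<^bsub>F\<^esub> f)"
        unfolding st_eq by (rule g[OF add_closed[OF ef(1,3)]])
      also have "\<dots> = g s \<oplus>\<^bsub>C\<^esub> g t" unfolding ef(2,4) using g ef LC.L_add[OF ef(1,3) hc] by simp
      finally show ?thesis .
    qed
    show "g (pure_tensor K A B a b) = h (a, b)" if ab: "a \<in> carrier A" "b \<in> carrier B" for a b
    proof -
      have "g (pure_tensor K A B a b) = ?L (monomial K \<one>\<^bsub>K\<^esub> (a, b))"
        unfolding pure_tensor_eq by (rule g) (use ab monomial_pair_closed in simp)
      also have "\<dots> = \<one>\<^bsub>K\<^esub> \<odot>\<^bsub>C\<^esub> h (a, b)" by (rule LC.L_monomial) (use ab hc in auto)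
      finally show ?thesis using bilinear_mapD(1)[OF h ab] by simp
    qed
  qed
qed

end

text \<open>The slice for a functional \<open>f\<close> on \<open>B\<close> is induced by the
  bilinear map sending \<open>(a, b)\<close> to \<open>f b\<close> times \<open>a\<close>, and
  symmetrically for a functional on \<open>A\<close>.\<close>

lemma tensor_algebra_tensor_product:
  assumes K: "field K" and A: "algebra K A" "\<one>\<^bsub>A\<^esub> \<noteq> \<zero>\<^bsub>A\<^esub>" and B: "algebra K B" "\<one>\<^bsub>B\<^esub> \<noteq> \<zero>\<^bsub>B\<^esub>"
  shows "tensor_product K A B (tensor_algebra K A B) (pure_tensor K A B)"
proof -
  interpret K: field K by (rule K)
  interpret A: algebra K A by (rule A(1))
  interpret B: algebra K B by (rule B(1))
  interpret tensor_construction K A B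
    by (intro tensor_construction.intro A(1) B(1))
  show ?thesis
  proof (intro tensor_product.intro K A(1) B(1) T_cring tensor_product_axioms.intro)
    fix f assume f: "linear_functional K B f"
    have fD: "\<And>b. b \<in> carrier B \<Longrightarrow> f b \<in> carrier K"
      "\<And>b b'. b \<in> carrier B \<Longrightarrow> b' \<in> carrier B \<Longrightarrow> f (b \<oplus>\<^bsub>B\<^esub> b') = f b \<oplus>\<^bsub>K\<^esub> f b'"
      "\<And>c b. c \<in> carrier K \<Longrightarrow> b \<in> carrier B \<Longrightarrow> f (c \<odot>\<^bsub>B\<^esub> b) = c \<otimes>\<^bsub>K\<^esub> f b"
      using f by (auto simp: linear_functional_def)
    have "bilinear_map K A B A (\<lambda>(a, b). f b \<odot>\<^bsub>A\<^esub> a)"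
      unfolding bilinear_map_def
      by (auto simp: fD A.smult_r_distr A.smult_l_distr A.smult_assoc1 K.m_comm
          simp flip: A.smult_assoc1)
    from universal_property[OF A.module this]
    show "\<exists>g. slice_map A B T (pure_tensor K A B) f g" by (auto simp: slice_map_def)
  next
    fix f assume f: "linear_functional K A f"
    have fD: "\<And>b. b \<in> carrier A \<Longrightarrow> f b \<in> carrier K"
      "\<And>b b'. b \<in> carrier A \<Longrightarrow> b' \<in> carrier A \<Longrightarrow> f (b \<oplus>\<^bsub>A\<^esub> b') = f b \<oplus>\<^bsub>K\<^esub> f b'"
      "\<And>c b. c \<in> carrier K \<Longrightarrow> b \<in> carrier A \<Longrightarrow> f (c \<odot>\<^bsub>A\<^esub> b) = c \<otimes>\<^bsub>K\<^esub> f b"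
      using f by (auto simp: linear_functional_def)
    have "bilinear_map K A B B (\<lambda>(a, b). f a \<odot>\<^bsub>B\<^esub> b)"
      unfolding bilinear_map_def
      by (auto simp: fD B.smult_r_distr B.smult_l_distr B.smult_assoc1 K.m_comm
          simp flip: B.smult_assoc1)
    from universal_property[OF B.module this]
    show "\<exists>g. slice_map B A T (\<lambda>b a. pure_tensor K A B a b) f g" by (auto simp: slice_map_def)
  qed (use pure_tensor_closed pure_tensor_add_l pure_tensor_add_r pure_tensor_mult pure_tensor_one
      carrier_T_span pure_tensor_scale_l pure_tensor_scale_r A(2) B(2) in simp_all)
qed

theorem theorem1p1:
  fixes K :: "('k, 'r) ring_scheme"
    and A :: "('k, 'a, 's) module_scheme"
    and B :: "('k, 'b, 't) module_scheme"
    and I :: "'a set" and J :: "'b set"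
  assumes "field K"
    and "algebra K A" and "\<one>\<^bsub>A\<^esub> \<noteq> \<zero>\<^bsub>A\<^esub>"
    and "algebra K B" and "\<one>\<^bsub>B\<^esub> \<noteq> \<zero>\<^bsub>B\<^esub>"
    and "noetherian_ring (tensor_algebra K A B)"
    and "ideal I A" and "I \<noteq> carrier A"
    and "ideal J B" and "J \<noteq> carrier B"
  shows "grade (tensor_algebra K A B) (tensor_image K A B I (carrier B)) = grade A I \<and>
     grade (tensor_algebra K A B) (tensor_image K A B (carrier A) J) = grade B J \<and>
     grade (tensor_algebra K A B)
           (tensor_image K A B I (carrier B) <+>\<^bsub>tensor_algebra K A B\<^esub> tensor_image K A B (carrier A) J)
         = grade A I + grade B J \<and>
     grade (tensor_algebra K A B) (tensor_image K A B I J) = min (grade A I) (grade B J)"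
proof -
  let ?T = "tensor_algebra K A B"
  interpret tensor_product K A B ?T "pure_tensor K A B"
    by (rule tensor_algebra_tensor_product[OF assms(1-5)])
  have image: "tensor_image K A B S U = tensor_span ?T (pure_tensor K A B) S U" for S U
    by (simp add: tensor_image_def tensor_span_def)
  \<comment> \<open>After rewriting, the first three ideals are \<open>W I {\<zero>}\<close>,
    \<open>W {\<zero>} J\<close> and \<open>W I J\<close>; the last remains the span of the tensors
    from \<open>I\<close> and \<open>J\<close>.\<close>
  show ?thesis
    unfolding image tensor_span_carrier_r[OF assms(7)] tensor_span_carrier_l[OF assms(9)]
      W_zero_add_W_zero[OF assms(7,9)]
    using grade_W_zero_r[OF assms(6-8)] grade_W_zero_l[OF assms(6,9,10)] grade_W[OF assms(6-10)]
      grade_tensor_span[OF assms(6-10)] by simp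
qed

end
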